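(* Let $G$ be a locally profinite group, $H\subset G$ a closed subgroup, $G^\natural$ a $G$-twisted space, $H^\natural\subset G^\natural$ an $H$-twisted space which is a twisted subspace of $G^\natural$, and $\omega$ a character of $G$. Suppose that $G$ is compact modulo $H$ and that there exists an open compact subgroup $K$ of $G$ with $HK=KH$. Choose such a $K$, and a system of representatives $\{x_1=1,x_2,\ldots,x_n\}$ in $G$ of the (finite) quotient $HK\backslash G$, and put $\Omega'=\bigcup_{i=1}^nKx_i$. Let $\Sigma$ be an admissible $\omega$-representation of $H^\natural$, and let $\Pi={}^\omega{\rm ind}_{H^\natural}^{G^\natural}(\Sigma)$. Then for every $\phi\in C^\infty_{\rm c}(G^\natural)$ one has the descent formula $$\Theta_\Pi(\phi)=\Theta_\Sigma(\phi_{\Omega'}|_{H^\natural}),$$ where $$\phi_{\Omega'}(\gamma)={\rm vol}(H\cap\Omega',d_rh)^{-1}\int_{\Omega'}\omega(g)\,\phi(g^{-1}\cdot\gamma\cdot g)\,d_lg\qquad(\gamma\in G^\natural).$$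
   Context: A $G$-twisted space (topological) is a topological space $G^\natural$ with a continuous left action of $G$ such that $g\mapsto g\cdot\delta$ is a homeomorphism $G\to G^\natural$ for each $\delta\in G^\natural$, together with a map ${\rm Int}_{G^\natural}:G^\natural\to{\rm Aut}(G)$ (topological automorphisms) with ${\rm Int}_{G^\natural}(g\cdot\delta)={\rm Int}_G(g)\circ{\rm Int}_{G^\natural}(\delta)$; the right action is $\delta\cdot g={\rm Int}_{G^\natural}(\delta)(g)\cdot\delta$. A twisted subspace $H^\natural$ for $H$ is a subset $H\cdot\delta$ with ${\rm Int}_{G^\natural}(\delta)(H)=H$. A character of $G$ is a continuous morphism $G\to\mathbb C^\times$; $\omega$ also denotes $\omega|_H$. A smooth $\omega$-representation of $G^\natural$ is a smooth complex representation $(\pi,V)$ of $G$ with a map $\Pi:G^\natural\to{\rm Aut}_{\mathbb C}(V)$ with $\Pi(x\cdot\gamma\cdot y)=\omega(y)\pi(x)\Pi(\gamma)\pi(y)$; $\pi=\Pi^\circ$; $\Pi$ is admissible if $\pi$ is. Same for $H^\natural$. Compact modulo $H$: $G=H\Omega$ for some compact subset $\Omega$ of $G$. Induction (unnormalized): for $(\Sigma,W)$ a smooth $\omega$-representation of $H^\natural$ with $\sigma=\Sigma^\circ$, the space of ${}^\omega{\rm ind}_{H^\natural}^{G^\natural}(\Sigma)$ is the space of functions $f:G\to W$ with $f(hg)=\sigma(h)f(g)$, right invariant under some open compact subgroup, with support compact modulo $H$. For such $f$ define $f^\natural:G^\natural\to W$ by $f^\natural(\delta\cdot g)=\omega(g)\Sigma(\delta)(f(g))$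 ($\delta\in H^\natural$, $g\in G$), which is well defined, and put $\Pi(\gamma)(f)(g)=f^\natural(g\cdot\gamma)$. Measures: $d_lg$, $d_lh$ are left Haar measures on $G$, $H$. $\Delta_H$ is the module of $H$: $\int_Hf(hx^{-1})d_lh=\Delta_H(x)\int_Hf(h)d_lh$; $d_rh=\Delta_H(h^{-1})d_lh$. With $\delta_1\in H^\natural$, $d_l\gamma$ (resp. $d_l\delta$) is the image of $d_lg$ (resp. $d_lh$) under $g\mapsto\delta_1\cdot g$ (resp. $h\mapsto\delta_1\cdot h$); it does not depend on $\delta_1$. $\Theta_\Pi(\phi)={\rm tr}\int_{G^\natural}\phi(\gamma)\Pi(\gamma)d_l\gamma$ and $\Theta_\Sigma(\psi)={\rm tr}\int_{H^\natural}\psi(\delta)\Sigma(\delta)d_l\delta$, for $\phi\in C^\infty_{\rm c}(G^\natural)$, $\psi\in C_{\rm c}^\infty(H^\natural)$ (locally constant, compactly supported). *)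

theory Defs
  imports
    "HOL-Analysis.Analysis"
    "HOL-Algebra.Coset"
    "HOL-Library.Function_Algebras"
begin

section \<open>Locally profinite groups\<close>

locale topological_group = group G for G (structure) +
  fixes T :: "'a topology"
  assumes topspace_eq: "topspace T = carrier G"
    and continuous_mult: "continuous_map (prod_topology T T) T (\<lambda>(x, y). x \<otimes> y)"
    and continuous_inv: "continuous_map T T (\<lambda>x. inv x)"

definition open_compact_subgroup :: "('a, 'b) monoid_scheme \<Rightarrow> 'a topology \<Rightarrow> 'a set \<Rightarrow> bool"
  where "open_compact_subgroup G T K \<longleftrightarrow> subgroup K G \<and> openin T K \<and> compactin T K"

locale locally_profinite_group = topological_group +
  assumes Hausdorff: "Hausdorff_space T"
    and basis_at_one: "\<lbrakk>openin T U; \<one> \<in> U\<rbrakk> \<Longrightarrow> \<exists>K. open_compact_subgroup G T K \<and> K \<subseteq> U"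

text \<open>Characters are not required to be unitary.\<close>

definition group_character :: "('a, 'b) monoid_scheme \<Rightarrow> 'a topology \<Rightarrow> ('a \<Rightarrow> complex) \<Rightarrow> bool"
  where "group_character G T \<omega> \<longleftrightarrow>
    continuous_map T euclidean \<omega> \<and>
    (\<forall>x\<in>carrier G. \<omega> x \<noteq> 0) \<and>
    (\<forall>x\<in>carrier G. \<forall>y\<in>carrier G. \<omega> (x \<otimes>\<^bsub>G\<^esub> y) = \<omega> x * \<omega> y)"

definition compact_modulo :: "('a, 'b) monoid_scheme \<Rightarrow> 'a topology \<Rightarrow> 'a set \<Rightarrow> 'a set \<Rightarrow> bool"
  where "compact_modulo G T H S \<longleftrightarrow> (\<exists>C. compactin T C \<and> S = H <#>\<^bsub>G\<^esub> C)"

section \<open>Twisted spaces\<close>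

text \<open>\<open>X\<close> is the topology of the twisted space (whose points are \<open>topspace X\<close>),
  \<open>act\<close> the left action and \<open>\<iota>\<close> the map Int.\<close>

locale twisted_space = topological_group G T for G (structure) and T +
  fixes X :: "'x topology"
    and act :: "'a \<Rightarrow> 'x \<Rightarrow> 'x"
    and \<iota> :: "'x \<Rightarrow> 'a \<Rightarrow> 'a"
  assumes act_continuous: "continuous_map (prod_topology T X) X (\<lambda>(g, \<delta>). act g \<delta>)"
    and act_one: "\<delta> \<in> topspace X \<Longrightarrow> act \<one> \<delta> = \<delta>"
    and act_mult: "\<lbrakk>g \<in> carrier G; h \<in> carrier G; \<delta> \<in> topspace X\<rbrakk>
      \<Longrightarrow> act (g \<otimes> h) \<delta> = act g (act h \<delta>)"
    and orbit_homeomorphism: "\<delta> \<in> topspace X \<Longrightarrow> homeomorphic_map T X (\<lambda>g. act g \<delta>)"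
    and Int_automorphism: "\<delta> \<in> topspace X \<Longrightarrow> \<iota> \<delta> \<in> iso G G \<and> homeomorphic_map T T (\<iota> \<delta>)"
    and Int_act: "\<lbrakk>g \<in> carrier G; \<delta> \<in> topspace X; x \<in> carrier G\<rbrakk>
      \<Longrightarrow> \<iota> (act g \<delta>) x = g \<otimes> \<iota> \<delta> x \<otimes> inv g"

definition right_act :: "('a \<Rightarrow> 'x \<Rightarrow> 'x) \<Rightarrow> ('x \<Rightarrow> 'a \<Rightarrow> 'a) \<Rightarrow> 'x \<Rightarrow> 'a \<Rightarrow> 'x"
  where "right_act act \<iota> \<delta> g = act (\<iota> \<delta> g) \<delta>"

definition twisted_subspace ::
  "'x topology \<Rightarrow> ('a \<Rightarrow> 'x \<Rightarrow> 'x) \<Rightarrow> ('x \<Rightarrow> 'a \<Rightarrow> 'a) \<Rightarrow> 'a set \<Rightarrow> 'x set \<Rightarrow> bool"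
  where "twisted_subspace X act \<iota> H Y \<longleftrightarrow>
    (\<exists>\<delta>\<in>topspace X. Y = (\<lambda>h. act h \<delta>) ` H \<and> \<iota> \<delta> ` H = H)"

text \<open>A twisted subspace for a subgroup \<open>H\<close> is itself an \<open>H\<close>-twisted space.\<close>

lemma (in twisted_space) twisted_subspace_is_twisted_space:
  assumes H: "subgroup H G" and Y: "twisted_subspace X act \<iota> H Y"
  shows "twisted_space (G\<lparr>carrier := H\<rparr>) (subtopology T H) (subtopology X Y) act \<iota>"
proof -
  let ?H = "G\<lparr>carrier := H\<rparr>"
  have HG: "H \<subseteq> carrier G" by (rule subgroup.subset[OF H])
  interpret H: group ?H by (rule subgroup.subgroup_is_group[OF H is_group])
  have inv_H: "inv\<^bsub>?H\<^esub> h = inv h" if "h \<in> H" for h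
    by (rule m_inv_consistent[OF H that])
  obtain \<delta> where \<delta>: "\<delta> \<in> topspace X" and Y_eq: "Y = (\<lambda>h. act h \<delta>) ` H" and \<iota>H: "\<iota> \<delta> ` H = H"
    using Y unfolding twisted_subspace_def by blast
  have act_in: "act g \<gamma> \<in> topspace X" if "g \<in> carrier G" "\<gamma> \<in> topspace X" for g \<gamma>
    using orbit_homeomorphism[OF that(2)] that(1) topspace_eq
    by (metis homeomorphic_imp_surjective_map imageI)
  have YX: "Y \<subseteq> topspace X" using Y_eq HG act_in \<delta> by auto
  have orbit: "(\<lambda>g. act g \<gamma>) ` H = Y" if \<gamma>: "\<gamma> \<in> Y" for \<gamma>
  proof -
    obtain h where h: "h \<in> H" "\<gamma> = act h \<delta>" using \<gamma> Y_eq by auto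
    have eq: "act g \<gamma> = act (g \<otimes> h) \<delta>" if "g \<in> H" for g
      using that h HG \<delta> by (simp add: act_mult subset_iff)
    have "(\<lambda>g. g \<otimes> h) ` H = H"
    proof
      show "(\<lambda>g. g \<otimes> h) ` H \<subseteq> H" using h(1) subgroup.m_closed[OF H] by auto
      show "H \<subseteq> (\<lambda>g. g \<otimes> h) ` H"
      proof
        fix g assume g: "g \<in> H"
        have "(g \<otimes> inv h) \<otimes> h = g" using g h(1) HG by (simp add: m_assoc subset_iff)
        moreover have "g \<otimes> inv h \<in> H"
          using g h(1) subgroup.m_closed[OF H] subgroup.m_inv_closed[OF H] by auto
        ultimately show "g \<in> (\<lambda>g. g \<otimes> h) ` H" by (metis imageI)
      qed
    qed
    then have "Y = (\<lambda>k. act k \<delta>) ` (\<lambda>g. g \<otimes> h) ` H" unfolding Y_eq by (rule ssubst) (rule refl)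
    also have "\<dots> = (\<lambda>g. act g \<gamma>) ` H" unfolding image_image by (rule image_cong) (simp_all add: eq)
    finally show ?thesis by (rule sym)
  qed
  have Int_H: "\<iota> \<gamma> ` H = H" if \<gamma>: "\<gamma> \<in> Y" for \<gamma>
  proof -
    obtain h where h: "h \<in> H" "\<gamma> = act h \<delta>" using \<gamma> Y_eq by auto
    have eq: "\<iota> \<gamma> k = h \<otimes> \<iota> \<delta> k \<otimes> inv h" if "k \<in> H" for k
      using that h HG \<delta> by (simp add: Int_act subset_iff)
    have hi: "inv h \<in> H" using h(1) subgroup.m_inv_closed[OF H] by auto
    show ?thesis
    proof
      show "\<iota> \<gamma> ` H \<subseteq> H"
      proof
        fix y assume "y \<in> \<iota> \<gamma> ` H"
        then obtain k where k: "k \<in> H" "y = \<iota> \<gamma> k" by blast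
        then have "\<iota> \<delta> k \<in> H" using \<iota>H by blast
        then show "y \<in> H" unfolding k(2) eq[OF k(1)] using h(1) hi subgroup.m_closed[OF H] by blast
      qed
      show "H \<subseteq> \<iota> \<gamma> ` H"
      proof
        fix k assume k: "k \<in> H"
        then have "inv h \<otimes> k \<otimes> h \<in> H" using h(1) hi subgroup.m_closed[OF H] by auto
        then obtain l where l: "l \<in> H" "\<iota> \<delta> l = inv h \<otimes> k \<otimes> h" using \<iota>H by (metis imageE)
        have hc: "h \<in> carrier G" "k \<in> carrier G" using h(1) k HG by auto
        have "h \<otimes> (inv h \<otimes> k \<otimes> h) = k \<otimes> h" using hc by (simp add: m_assoc[symmetric])
        then have "h \<otimes> (inv h \<otimes> k \<otimes> h) \<otimes> inv h = k" using hc by (simp add: m_assoc)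
        then have "\<iota> \<gamma> l = k" using eq[OF l(1)] l(2) by simp
        then show "k \<in> \<iota> \<gamma> ` H" using l(1) by blast
      qed
    qed
  qed
  have top_H: "topspace (subtopology T H) = H" using HG topspace_eq by auto
  have top_Y: "topspace (subtopology X Y) = Y" using YX by auto
  have Hmul: "continuous_map (prod_topology (subtopology T H) (subtopology T H)) (subtopology T H)
      (\<lambda>(x, y). x \<otimes> y)"
    using continuous_map_from_subtopology[OF continuous_mult, of "H \<times> H"] HG topspace_eq
      subgroup.m_closed[OF H]
    by (auto simp: continuous_map_in_subtopology subtopology_Times)
  have Hinv: "continuous_map (subtopology T H) (subtopology T H) (\<lambda>x. inv x)"
    using continuous_map_from_subtopology[OF continuous_inv, of H] subgroup.m_inv_closed[OF H]
    by (auto simp: continuous_map_in_subtopology)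
  have act_Y: "act g \<gamma> \<in> Y" if "g \<in> H" "\<gamma> \<in> Y" for g \<gamma>
    using orbit[OF that(2)] that(1) by auto
  have act_c: "continuous_map (prod_topology (subtopology T H) (subtopology X Y)) (subtopology X Y)
      (\<lambda>(g, \<gamma>). act g \<gamma>)"
    using continuous_map_from_subtopology[OF act_continuous, of "H \<times> Y"] act_Y
    by (auto simp: continuous_map_in_subtopology subtopology_Times)
  have orbit_hom: "homeomorphic_map (subtopology T H) (subtopology X Y) (\<lambda>g. act g \<gamma>)"
    if "\<gamma> \<in> Y" for \<gamma>
    by (rule homeomorphic_map_subtopologies[OF orbit_homeomorphism])
      (use that YX HG topspace_eq orbit in \<open>auto simp: Int_absorb1\<close>)
  have Int_hom: "homeomorphic_map (subtopology T H) (subtopology T H) (\<iota> \<gamma>)" if "\<gamma> \<in> Y" for \<gamma>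
    by (rule homeomorphic_map_subtopologies[OF conjunct2[OF Int_automorphism]])
      (use that YX HG topspace_eq Int_H in \<open>auto simp: Int_absorb1\<close>)
  have Int_iso: "\<iota> \<gamma> \<in> iso ?H ?H" if "\<gamma> \<in> Y" for \<gamma>
  proof -
    have i: "\<iota> \<gamma> \<in> iso G G" using Int_automorphism that YX by blast
    have "inj_on (\<iota> \<gamma>) H" using i HG by (auto simp: iso_def bij_betw_def intro: inj_on_subset)
    then have "bij_betw (\<iota> \<gamma>) H H" using Int_H[OF that] by (simp add: bij_betw_def)
    moreover have "\<iota> \<gamma> (a \<otimes> b) = \<iota> \<gamma> a \<otimes> \<iota> \<gamma> b" if "a \<in> H" "b \<in> H" for a b
      using i that HG by (auto simp: iso_def hom_def)
    moreover have "\<iota> \<gamma> a \<in> H" if "a \<in> H" for a using Int_H[OF \<open>\<gamma> \<in> Y\<close>] that by blast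
    ultimately show ?thesis by (auto simp: iso_def hom_def)
  qed
  have inv_cong: "continuous_map (subtopology T H) (subtopology T H) (\<lambda>x. inv\<^bsub>?H\<^esub> x)"
    by (rule continuous_map_eq[OF Hinv]) (use top_H inv_H in auto)
  show ?thesis
  proof (unfold_locales, goal_cases)
    case 1 show ?case using top_H by simp
  next
    case 2 show ?case using Hmul by simp
  next
    case 3 show ?case by (rule inv_cong)
  next
    case 4 show ?case by (rule act_c)
  next
    case (5 \<gamma>) then show ?case using act_one YX by auto
  next
    case (6 g h \<gamma>) then show ?case using HG YX by (simp add: act_mult subset_iff)
  next
    case (7 \<gamma>) then show ?case using orbit_hom top_Y by blast
  next
    case (8 \<gamma>) then show ?case using Int_hom Int_iso top_Y by blast
  next
    case (9 g \<gamma> k) then show ?case using HG YX inv_H by (simp add: Int_act subset_iff)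
  qed
qed

section \<open>Smooth representations\<close>

text \<open>Representation spaces are subspaces \<open>V\<close> of an ambient complex vector space with
  scalar multiplication \<open>s\<close>.\<close>

definition linear_on ::
  "(complex \<Rightarrow> 'v::ab_group_add \<Rightarrow> 'v) \<Rightarrow> 'v set \<Rightarrow> ('v \<Rightarrow> 'v) \<Rightarrow> bool"
  where "linear_on s V A \<longleftrightarrow>
    (\<forall>v\<in>V. \<forall>w\<in>V. A (v + w) = A v + A w) \<and> (\<forall>c. \<forall>v\<in>V. A (s c v) = s c (A v))"

definition linear_automorphism ::
  "(complex \<Rightarrow> 'v::ab_group_add \<Rightarrow> 'v) \<Rightarrow> 'v set \<Rightarrow> ('v \<Rightarrow> 'v) \<Rightarrow> bool"
  where "linear_automorphism s V A \<longleftrightarrow> linear_on s V A \<and> bij_betw A V V"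

definition smooth_rep ::
  "('a, 'b) monoid_scheme \<Rightarrow> 'a topology \<Rightarrow> (complex \<Rightarrow> 'v::ab_group_add \<Rightarrow> 'v) \<Rightarrow> 'v set
    \<Rightarrow> ('a \<Rightarrow> 'v \<Rightarrow> 'v) \<Rightarrow> bool"
  where "smooth_rep G T s V \<pi> \<longleftrightarrow>
    vector_space s \<and> module.subspace s V \<and>
    (\<forall>g\<in>carrier G. linear_automorphism s V (\<pi> g)) \<and>
    (\<forall>g\<in>carrier G. \<forall>h\<in>carrier G. \<forall>v\<in>V. \<pi> (g \<otimes>\<^bsub>G\<^esub> h) v = \<pi> g (\<pi> h v)) \<and>
    (\<forall>v\<in>V. openin T {g \<in> carrier G. \<pi> g v = v})"

definition admissible_rep ::
  "('a, 'b) monoid_scheme \<Rightarrow> 'a topology \<Rightarrow> (complex \<Rightarrow> 'v::ab_group_add \<Rightarrow> 'v) \<Rightarrow> 'v set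
    \<Rightarrow> ('a \<Rightarrow> 'v \<Rightarrow> 'v) \<Rightarrow> bool"
  where "admissible_rep G T s V \<pi> \<longleftrightarrow>
    smooth_rep G T s V \<pi> \<and>
    (\<forall>K. open_compact_subgroup G T K \<longrightarrow>
      (\<exists>B. finite B \<and> {v\<in>V. \<forall>k\<in>K. \<pi> k v = v} \<subseteq> module.span s B))"

text \<open>\<open>\<pi>\<close> is the underlying representation of the group and \<open>P\<close> the map on the twisted space.\<close>

definition smooth_twisted_rep ::
  "('a, 'b) monoid_scheme \<Rightarrow> 'a topology \<Rightarrow> 'x topology \<Rightarrow> ('a \<Rightarrow> 'x \<Rightarrow> 'x) \<Rightarrow> ('x \<Rightarrow> 'a \<Rightarrow> 'a)
    \<Rightarrow> ('a \<Rightarrow> complex) \<Rightarrow> (complex \<Rightarrow> 'v::ab_group_add \<Rightarrow> 'v) \<Rightarrow> 'v set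
    \<Rightarrow> ('a \<Rightarrow> 'v \<Rightarrow> 'v) \<Rightarrow> ('x \<Rightarrow> 'v \<Rightarrow> 'v) \<Rightarrow> bool"
  where "smooth_twisted_rep G T X act \<iota> \<omega> s V \<pi> P \<longleftrightarrow>
    smooth_rep G T s V \<pi> \<and>
    (\<forall>\<gamma>\<in>topspace X. linear_automorphism s V (P \<gamma>)) \<and>
    (\<forall>x\<in>carrier G. \<forall>y\<in>carrier G. \<forall>\<gamma>\<in>topspace X. \<forall>v\<in>V.
      P (right_act act \<iota> (act x \<gamma>) y) v = s (\<omega> y) (\<pi> x (P \<gamma> (\<pi> y v))))"

section \<open>Induction\<close>

definition scale_fun :: "(complex \<Rightarrow> 'w \<Rightarrow> 'w) \<Rightarrow> complex \<Rightarrow> ('a \<Rightarrow> 'w) \<Rightarrow> 'a \<Rightarrow> 'w"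
  where "scale_fun s c f = (\<lambda>g. s c (f g))"

text \<open>A function on \<open>G\<close> is represented by its extension by zero to the ambient type.\<close>

definition ind_space ::
  "('a, 'b) monoid_scheme \<Rightarrow> 'a topology \<Rightarrow> 'a set \<Rightarrow> 'w::ab_group_add set
    \<Rightarrow> ('a \<Rightarrow> 'w \<Rightarrow> 'w) \<Rightarrow> ('a \<Rightarrow> 'w) set"
  where "ind_space G T H W \<sigma> = {f.
    (\<forall>g\<in>carrier G. f g \<in> W) \<and> (\<forall>g. g \<notin> carrier G \<longrightarrow> f g = 0) \<and>
    (\<forall>h\<in>H. \<forall>g\<in>carrier G. f (h \<otimes>\<^bsub>G\<^esub> g) = \<sigma> h (f g)) \<and>
    (\<exists>K. open_compact_subgroup G T K \<and>
      (\<forall>g\<in>carrier G. \<forall>k\<in>K. f (g \<otimes>\<^bsub>G\<^esub> k) = f g)) \<and>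
    compact_modulo G T H {g\<in>carrier G. f g \<noteq> 0}}"

text \<open>The function on the twisted space attached to an element of the induced space.\<close>

definition ind_natural ::
  "('a, 'b) monoid_scheme \<Rightarrow> 'x set \<Rightarrow> ('a \<Rightarrow> 'x \<Rightarrow> 'x) \<Rightarrow> ('x \<Rightarrow> 'a \<Rightarrow> 'a)
    \<Rightarrow> ('a \<Rightarrow> complex) \<Rightarrow> (complex \<Rightarrow> 'w \<Rightarrow> 'w) \<Rightarrow> ('x \<Rightarrow> 'w \<Rightarrow> 'w)
    \<Rightarrow> ('a \<Rightarrow> 'w) \<Rightarrow> 'x \<Rightarrow> 'w"
  where "ind_natural G Y act \<iota> \<omega> s S f \<gamma> =
    (THE w. \<exists>\<delta>\<in>Y. \<exists>g\<in>carrier G. \<gamma> = right_act act \<iota> \<delta> g \<and> w = s (\<omega> g) (S \<delta> (f g)))"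

definition ind_map ::
  "('a, 'b) monoid_scheme \<Rightarrow> 'x set \<Rightarrow> ('a \<Rightarrow> 'x \<Rightarrow> 'x) \<Rightarrow> ('x \<Rightarrow> 'a \<Rightarrow> 'a)
    \<Rightarrow> ('a \<Rightarrow> complex) \<Rightarrow> (complex \<Rightarrow> 'w::ab_group_add \<Rightarrow> 'w) \<Rightarrow> ('x \<Rightarrow> 'w \<Rightarrow> 'w)
    \<Rightarrow> 'x \<Rightarrow> ('a \<Rightarrow> 'w) \<Rightarrow> 'a \<Rightarrow> 'w"
  where "ind_map G Y act \<iota> \<omega> s S \<gamma> f =
    (\<lambda>g. if g \<in> carrier G then ind_natural G Y act \<iota> \<omega> s S f (act g \<gamma>) else 0)"

section \<open>Measures\<close>

definition borel_sigma :: "'a topology \<Rightarrow> 'a measure"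
  where "borel_sigma X = sigma (topspace X) {U. openin X U}"

text \<open>Nonzero left invariant Radon measures. Regularity is part of the definition because the
  group is not assumed to be second countable.\<close>

definition left_haar_measure ::
  "('a, 'b) monoid_scheme \<Rightarrow> 'a topology \<Rightarrow> 'a measure \<Rightarrow> bool"
  where "left_haar_measure G T \<mu> \<longleftrightarrow>
    space \<mu> = carrier G \<and> sets \<mu> = sets (borel_sigma T) \<and>
    (\<forall>g\<in>carrier G. \<forall>A\<in>sets \<mu>. emeasure \<mu> (g <#\<^bsub>G\<^esub> A) = emeasure \<mu> A) \<and>
    (\<forall>C. compactin T C \<longrightarrow> emeasure \<mu> C < \<infinity>) \<and>
    (\<forall>U. openin T U \<and> U \<noteq> {} \<longrightarrow> emeasure \<mu> U > 0) \<and>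
    (\<forall>A\<in>sets \<mu>. emeasure \<mu> A = (INF U\<in>{U. openin T U \<and> A \<subseteq> U}. emeasure \<mu> U)) \<and>
    (\<forall>U. openin T U \<longrightarrow> emeasure \<mu> U = (SUP C\<in>{C. compactin T C \<and> C \<subseteq> U}. emeasure \<mu> C))"

text \<open>Locally constant, compactly supported functions; values outside \<open>topspace X\<close> are
  irrelevant.\<close>

definition test_function :: "'x topology \<Rightarrow> ('x \<Rightarrow> complex) \<Rightarrow> bool"
  where "test_function X \<phi> \<longleftrightarrow>
    (\<forall>x\<in>topspace X. \<exists>U. openin X U \<and> x \<in> U \<and> (\<forall>y\<in>U. \<phi> y = \<phi> x)) \<and>
    compactin X (X closure_of {x\<in>topspace X. \<phi> x \<noteq> 0})"

definition group_modulus ::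
  "('a, 'b) monoid_scheme \<Rightarrow> 'a topology \<Rightarrow> 'a measure \<Rightarrow> 'a \<Rightarrow> real"
  where "group_modulus G T \<mu> x = (THE c. c > 0 \<and>
    (\<forall>f. test_function T f \<longrightarrow>
      (LINT h|\<mu>. f (h \<otimes>\<^bsub>G\<^esub> inv\<^bsub>G\<^esub> x)) = complex_of_real c * (LINT h|\<mu>. f h)))"

definition right_haar_measure ::
  "('a, 'b) monoid_scheme \<Rightarrow> 'a topology \<Rightarrow> 'a measure \<Rightarrow> 'a measure"
  where "right_haar_measure G T \<mu> = density \<mu> (\<lambda>h. ennreal (group_modulus G T \<mu> (inv\<^bsub>G\<^esub> h)))"

text \<open>Image of the measure \<open>\<mu>\<close> under the map from \<open>g\<close> to \<open>\<delta> \<cdot> g\<close>.\<close>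

definition twisted_measure ::
  "'x topology \<Rightarrow> ('a \<Rightarrow> 'x \<Rightarrow> 'x) \<Rightarrow> ('x \<Rightarrow> 'a \<Rightarrow> 'a) \<Rightarrow> 'a measure \<Rightarrow> 'x \<Rightarrow> 'x measure"
  where "twisted_measure X act \<iota> \<mu> \<delta> = distr \<mu> (borel_sigma X) (\<lambda>g. right_act act \<iota> \<delta> g)"

section \<open>Characters of twisted representations\<close>

text \<open>Integral of a function with finitely many values, in a vector space without topology. For
  a test function \<open>\<phi>\<close> and a vector \<open>v\<close> of a smooth twisted representation given by \<open>P\<close>, the function
  \<open>\<phi> \<gamma> \<cdot> P \<gamma> v\<close> of \<open>\<gamma>\<close> is locally constant with compact support, hence of this kind.\<close>

definition simple_integral ::
  "(complex \<Rightarrow> 'v::ab_group_add \<Rightarrow> 'v) \<Rightarrow> 'x measure \<Rightarrow> ('x \<Rightarrow> 'v) \<Rightarrow> 'v"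
  where "simple_integral s M f =
    (\<Sum>w\<in>f ` space M - {0}. s (complex_of_real (measure M {x\<in>space M. f x = w})) w)"

text \<open>The trace of an operator of finite rank is the trace of its restriction to its image.\<close>

definition finite_rank_trace ::
  "(complex \<Rightarrow> 'v::ab_group_add \<Rightarrow> 'v) \<Rightarrow> 'v set \<Rightarrow> ('v \<Rightarrow> 'v) \<Rightarrow> complex"
  where "finite_rank_trace s V A =
    (let B = (SOME B. \<not> module.dependent s B \<and> module.span s B = A ` V)
     in \<Sum>b\<in>B. module.representation s B (A b) b)"

definition twisted_character ::
  "(complex \<Rightarrow> 'v::ab_group_add \<Rightarrow> 'v) \<Rightarrow> 'v set \<Rightarrow> ('x \<Rightarrow> 'v \<Rightarrow> 'v) \<Rightarrow> 'x measure
    \<Rightarrow> ('x \<Rightarrow> complex) \<Rightarrow> complex"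
  where "twisted_character s V P M \<phi> =
    finite_rank_trace s V (\<lambda>v. simple_integral s M (\<lambda>\<gamma>. s (\<phi> \<gamma>) (P \<gamma> v)))"

definition descent ::
  "('a, 'b) monoid_scheme \<Rightarrow> ('a \<Rightarrow> 'x \<Rightarrow> 'x) \<Rightarrow> ('x \<Rightarrow> 'a \<Rightarrow> 'a) \<Rightarrow> ('a \<Rightarrow> complex)
    \<Rightarrow> 'a measure \<Rightarrow> 'a measure \<Rightarrow> 'a set \<Rightarrow> 'a set \<Rightarrow> ('x \<Rightarrow> complex) \<Rightarrow> 'x \<Rightarrow> complex"
  where "descent G act \<iota> \<omega> \<mu> \<nu> H D \<phi> \<gamma> =
    inverse (complex_of_real (measure \<nu> (H \<inter> D))) *
    (LINT g:D|\<mu>. \<omega> g * \<phi> (right_act act \<iota> (act (inv\<^bsub>G\<^esub> g) \<gamma>) g))"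

end

theory Submission
  imports Defs
begin

text \<open>
  Fix the base point \<open>\<delta>\<^sub>1\<close>. It identifies the twisted space with \<open>G\<close>; the test function becomes a
  function \<open>\<psi>\<close> on \<open>G\<close>, the automorphism of the base point has an inverse \<open>\<theta>\<close>, and with \<open>D = S \<delta>\<^sub>1\<close> the
  operator defined by the test function on the induced space sends \<open>f\<close> to the function whose value at
  \<open>g\<close> is the integral over \<open>x\<close> in \<open>G\<close> of \<open>\<psi> (inv (\<theta> g) \<otimes> x) * \<omega> x\<close> times \<open>D (f x)\<close>.

  The function \<open>f\<close> is determined by its restriction to the compact set \<open>\<Omega>'\<close>, because every element of
  \<open>G\<close> is \<open>h \<otimes> y\<close> with \<open>h\<close> in \<open>H\<close> and \<open>y\<close> in \<open>\<Omega>'\<close>. For each \<open>x\<close> in \<open>G\<close> the possible \<open>h\<close> form a left coset of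
  \<open>H \<inter> K\<close> (\<open>fundamental_domain\<close>). Counting each \<open>x\<close> with this multiplicity turns the integral over \<open>G\<close>
  into the integral over \<open>H\<close> and \<open>\<Omega>'\<close>, divided by the volume of \<open>H \<inter> K = H \<inter> \<Omega>'\<close>
  (\<open>orbit_volume\<close>, \<open>A_kernel\<close>). The operator thus has a kernel on \<open>\<Omega>'\<close> with operator values, given by
  integrals of the test function against \<open>\<Sigma>\<close>. The trace is the integral of the traces on the diagonal,
  and the diagonal integrates to the operator attached to the descended function.

  No convergence question arises. One small open compact subgroup \<open>L\<close> leaves all data invariant, so the
  operator factors through the projection onto the vectors fixed by \<open>L\<close> (\<open>A_average\<close>) and integrals are
  finite sums over cosets of \<open>L\<close>. By admissibility, a function fixed by \<open>L\<close> takes at \<open>y\<close> values in a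
  space of finite dimension, and the trace is computed by expanding these values in bases
  (\<open>finite_rank_trace_eq\<close>, \<open>trace_induced\<close>).

  The volume in the descended function refers to a right Haar measure on \<open>H\<close>. It agrees with the given
  left Haar measure on open compact subgroups because the modulus is trivial there
  (\<open>measure_right_haar_ocs\<close>).
\<close>

section \<open>Traces and integrals in abstract vector spaces\<close>

text \<open>The defining sum runs over a basis of the image of \<open>A\<close>. Extending it to a basis of the span
  of the image and the \<open>u i\<close> adds only zero diagonal entries, because \<open>A\<close> maps into the span of the
  original basis. In the larger basis the diagonal sum is bilinear in the \<open>\<xi> i\<close> and \<open>u i\<close>.\<close>

lemma finite_rank_trace_eq:
  assumes vs: "vector_space s" and V: "module.subspace s V"
    and I: "finite I" and u: "\<And>i. i \<in> I \<Longrightarrow> u i \<in> V"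
    and add: "\<And>i v w. \<lbrakk>i \<in> I; v \<in> V; w \<in> V\<rbrakk> \<Longrightarrow> \<xi> i (v + w) = \<xi> i v + \<xi> i w"
    and scale: "\<And>i c v. \<lbrakk>i \<in> I; v \<in> V\<rbrakk> \<Longrightarrow> \<xi> i (s c v) = c * \<xi> i v"
    and A: "\<And>v. v \<in> V \<Longrightarrow> A v = (\<Sum>i\<in>I. s (\<xi> i v) (u i))"
  shows "finite_rank_trace s V A = (\<Sum>i\<in>I. \<xi> i (u i))"
proof -
  interpret vector_space s by (rule vs)
  have subV: "subspace V" by (rule V)
  have zero: "\<xi> i 0 = 0" if "i \<in> I" for i
    using scale[OF that subspace_0[OF subV], of 0] by simp
  have sumV: "\<xi> i (\<Sum>c\<in>C. s (a c) c) = (\<Sum>c\<in>C. a c * \<xi> i c)"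
    if "i \<in> I" "finite C" "C \<subseteq> V" for i C a
    using that(2,3)
  proof (induction C rule: finite_induct)
    case empty
    show ?case using zero[OF that(1)] by simp
  next
    case (insert c C)
    have "(\<Sum>c\<in>C. s (a c) c) \<in> V"
      using insert.prems by (intro subspace_sum[OF subV] subspace_scale[OF subV]) auto
    then show ?case
      using insert that(1) by (simp add: add scale subspace_scale[OF subV])
  qed
  have "A ` V \<subseteq> V"
    using A u by (auto intro!: subspace_sum[OF subV] subspace_scale[OF subV])
  have A_add: "A (v + w) = A v + A w" if "v \<in> V" "w \<in> V" for v w
    using that by (simp add: A add subspace_add[OF subV] scale_left_distrib sum.distrib)
  have A_scale: "A (s c v) = s c (A v)" if "v \<in> V" for v c
    using that by (simp add: A scale subspace_scale[OF subV] scale_sum_right)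
  have sub: "subspace (A ` V)"
  proof (rule subspaceI)
    show "0 \<in> A ` V"
      using A_scale[OF subspace_0[OF subV], of 0] subspace_0[OF subV] by force
    show "a + b \<in> A ` V" if "a \<in> A ` V" "b \<in> A ` V" for a b
      using that by (auto simp: A_add[symmetric] subspace_add[OF subV])
    show "s c a \<in> A ` V" if "a \<in> A ` V" for a c
      using that by (auto simp: A_scale[symmetric] subspace_scale[OF subV])
  qed
  define B where "B = (SOME B. independent B \<and> span B = A ` V)"
  have "\<exists>B. independent B \<and> span B = A ` V"
    by (metis maximal_independent_subset span_minimal sub subset_antisym)
  then have B: "independent B" "span B = A ` V"
    unfolding B_def using someI_ex[of "\<lambda>B. independent B \<and> span B = A ` V"] by blast+
  have trace: "finite_rank_trace s V A = (\<Sum>b\<in>B. representation B (A b) b)"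
    unfolding finite_rank_trace_def B_def Let_def by simp
  have B_sub: "B \<subseteq> A ` V" using B(2) span_superset by blast
  have im: "A v \<in> span (u ` I)" if "v \<in> V" for v
    unfolding A[OF that] by (intro span_sum span_scale span_base imageI)
  obtain C where C: "B \<subseteq> C" "C \<subseteq> B \<union> u ` I" "independent C" "B \<union> u ` I \<subseteq> span C"
    by (rule maximal_independent_subset_extend[OF Un_upper1 B(1)])
  have "B \<subseteq> span (u ` I)" using B_sub im by auto
  then have "C \<subseteq> span (u ` I)"
    using C(2) span_superset[of "u ` I"] by (meson Un_least order_trans)
  then have fin: "finite C"
    using independent_span_bound[OF _ C(3), of "u ` I"] I by blast
  have CV: "C \<subseteq> V" using C(2) B_sub \<open>A ` V \<subseteq> V\<close> u by blast
  have uC: "u i \<in> span C" if "i \<in> I" for i using C(4) that by auto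
  let ?r = "representation C"
  have "(\<Sum>i\<in>I. \<xi> i (u i)) = (\<Sum>i\<in>I. \<Sum>c\<in>C. ?r (u i) c * \<xi> i c)"
  proof (rule sum.cong[OF refl])
    fix i assume i: "i \<in> I"
    have "u i = (\<Sum>c\<in>C. s (?r (u i) c) c)"
      by (rule sum_representation_eq[symmetric, OF C(3) uC[OF i] fin order_refl])
    then have "\<xi> i (u i) = \<xi> i (\<Sum>c\<in>C. s (?r (u i) c) c)" by simp
    then show "\<xi> i (u i) = (\<Sum>c\<in>C. ?r (u i) c * \<xi> i c)"
      using sumV[OF i fin CV] by simp
  qed
  also have "\<dots> = (\<Sum>c\<in>C. \<Sum>i\<in>I. ?r (u i) c * \<xi> i c)" by (rule sum.swap)
  also have "\<dots> = (\<Sum>c\<in>C. ?r (A c) c)"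
  proof (rule sum.cong[OF refl])
    fix c assume "c \<in> C"
    then have "c \<in> V" using CV by auto
    then show "(\<Sum>i\<in>I. ?r (u i) c * \<xi> i c) = ?r (A c) c"
      using uC by (simp add: A representation_sum[OF C(3)] representation_scale[OF C(3)]
        span_scale mult.commute)
  qed
  also have "\<dots> = (\<Sum>c\<in>C. representation B (A c) c)"
  proof (rule sum.cong[OF refl])
    fix c assume "c \<in> C"
    then have "A c \<in> span B" using B(2) CV by auto
    then show "?r (A c) c = representation B (A c) c"
      using representation_extend[OF C(3) _ C(1)] by simp
  qed
  also have "\<dots> = (\<Sum>b\<in>B. representation B (A b) b)"
    by (rule sum.mono_neutral_right[OF fin C(1)]) (use representation_ne_zero in blast)
  finally show ?thesis using trace by simp
qed

text \<open>Integrals can be computed on any partition finer than the level sets. Pieces may be empty: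
  their volume is \<open>0\<close>, so the value attached to them does not matter.\<close>

lemma simple_integral_partition:
  assumes vs: "vector_space s" and I: "finite I" and disj: "disjoint_family_on B I"
    and B: "\<And>i. i \<in> I \<Longrightarrow> B i \<in> fmeasurable M"
    and F: "\<And>i x. \<lbrakk>i \<in> I; x \<in> B i\<rbrakk> \<Longrightarrow> F x = v i"
    and out: "\<And>x. \<lbrakk>x \<in> space M; x \<notin> (\<Union>i\<in>I. B i)\<rbrakk> \<Longrightarrow> F x = 0"
  shows "simple_integral s M F = (\<Sum>i\<in>I. s (complex_of_real (measure M (B i))) (v i))"
proof -
  interpret vector_space s by (rule vs)
  have Bs: "B i \<subseteq> space M" if "i \<in> I" for i
    using B[OF that] by (meson fmeasurableD sets.sets_into_space)
  define I' where "I' = {i\<in>I. v i \<in> F ` space M - {0}}"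
  have finI': "finite I'" using I by (simp add: I'_def)
  have "F ` space M \<subseteq> insert 0 (v ` I)"
    using F out by fastforce
  then have finF: "finite (F ` space M - {0})"
    using I by (meson finite.insertI finite_Diff finite_imageI finite_subset)
  have level: "measure M {x\<in>space M. F x = w} = (\<Sum>i\<in>{i\<in>I'. v i = w}. measure M (B i))"
    if w: "w \<in> F ` space M - {0}" for w
  proof -
    have eq: "{x\<in>space M. F x = w} = (\<Union>i\<in>{i\<in>I'. v i = w}. B i)"
    proof (intro equalityI subsetI)
      fix x assume x: "x \<in> {x\<in>space M. F x = w}"
      then have "F x \<noteq> 0" using w by auto
      then obtain i where i: "i \<in> I" "x \<in> B i" using out x by blast
      then show "x \<in> (\<Union>i\<in>{i\<in>I'. v i = w}. B i)"
        using F[OF i] x w by (auto simp: I'_def)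
    next
      fix x assume "x \<in> (\<Union>i\<in>{i\<in>I'. v i = w}. B i)"
      then obtain i where i: "i \<in> I" "v i = w" "x \<in> B i" by (auto simp: I'_def)
      then show "x \<in> {x\<in>space M. F x = w}" using F[OF i(1,3)] Bs by auto
    qed
    show ?thesis unfolding eq
      by (rule measure_finite_Union)
        (use I disj B in \<open>auto simp: I'_def disjoint_family_on_def fmeasurable_def top.not_eq_extremum\<close>)
  qed
  have "simple_integral s M F =
      (\<Sum>w\<in>F ` space M - {0}. s (\<Sum>i\<in>{i\<in>I'. v i = w}. complex_of_real (measure M (B i))) w)"
    unfolding simple_integral_def by (rule sum.cong) (simp_all add: level)
  also have "\<dots> = (\<Sum>w\<in>F ` space M - {0}. \<Sum>i\<in>{i\<in>I'. v i = w}. s (complex_of_real (measure M (B i))) (v i))"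
    by (rule sum.cong) (auto simp: scale_sum_left intro!: sum.cong)
  also have "\<dots> = (\<Sum>i\<in>I'. s (complex_of_real (measure M (B i))) (v i))"
    by (rule sum.group[OF finI' finF]) (auto simp: I'_def)
  also have "\<dots> = (\<Sum>i\<in>I. s (complex_of_real (measure M (B i))) (v i))"
  proof (rule sum.mono_neutral_left[OF I])
    show "I' \<subseteq> I" by (auto simp: I'_def)
    show "\<forall>i\<in>I - I'. s (complex_of_real (measure M (B i))) (v i) = 0"
    proof
      fix i assume i: "i \<in> I - I'"
      show "s (complex_of_real (measure M (B i))) (v i) = 0"
      proof (cases "v i = 0")
        case False
        have "x \<notin> B i" for x
        proof
          assume x: "x \<in> B i"
          then have "x \<in> space M" "F x = v i" using i Bs F by auto
          then have "v i \<in> F ` space M" by (metis imageI)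
          then show False using i False by (simp add: I'_def)
        qed
        then have "B i = {}" by auto
        then show ?thesis by simp
      qed simp
    qed
  qed
  finally show ?thesis .
qed

text \<open>The condition ranges over all subsets because the level sets of \<open>F\<close> can be arbitrary; a set
  that is not measurable has \<open>measure\<close> equal to \<open>0\<close>.\<close>

lemma simple_integral_bij:
  assumes t: "bij_betw t (space M) (space N)"
    and m: "\<And>A. A \<subseteq> space N \<Longrightarrow> measure M (t -` A \<inter> space M) = measure N A"
  shows "simple_integral s N F = simple_integral s M (\<lambda>x. F (t x))"
proof -
  have im: "F ` space N = (\<lambda>x. F (t x)) ` space M"
    using t by (metis bij_betw_imp_surj_on image_image)
  have lev: "measure N {y\<in>space N. F y = w} = measure M {x\<in>space M. F (t x) = w}" for w
  proof -
    have "{x\<in>space M. F (t x) = w} = t -` {y\<in>space N. F y = w} \<inter> space M"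
      using t by (auto simp: bij_betw_def)
    then show ?thesis using m[of "{y\<in>space N. F y = w}"] by auto
  qed
  show ?thesis unfolding simple_integral_def im lev ..
qed

lemma simple_integral_cong:
  assumes "\<And>x. x \<in> space M \<Longrightarrow> F x = F' x"
  shows "simple_integral s M F = simple_integral s M F'"
proof -
  have "F ` space M = F' ` space M" using assms by auto
  moreover have "{x\<in>space M. F x = w} = {x\<in>space M. F' x = w}" for w using assms by auto
  ultimately show ?thesis unfolding simple_integral_def by simp
qed

section \<open>Open compact subgroups and their cosets\<close>

context locally_profinite_group
begin

lemma openin_carrier: "openin T U \<Longrightarrow> U \<subseteq> carrier G"
  using openin_subset topspace_eq by blast

lemma compactin_carrier: "compactin T C \<Longrightarrow> C \<subseteq> carrier G"
  using compactin_subset_topspace topspace_eq by blast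

lemma continuous_map_mult:
  assumes "continuous_map Z T f" "continuous_map Z T g"
  shows "continuous_map Z T (\<lambda>z. f z \<otimes> g z)"
proof -
  have "continuous_map Z (prod_topology T T) (\<lambda>z. (f z, g z))"
    using assms by (simp add: continuous_map_pairedI)
  from continuous_map_compose[OF this continuous_mult] show ?thesis by (simp add: o_def)
qed

lemma translation_homeomorphic:
  assumes "a \<in> carrier G" "b \<in> carrier G"
  shows "homeomorphic_map T T (\<lambda>x. a \<otimes> x \<otimes> b)"
proof -
  have c: "continuous_map T T (\<lambda>x. u \<otimes> x \<otimes> v)" if "u \<in> carrier G" "v \<in> carrier G" for u v
    using that topspace_eq by (intro continuous_map_mult) auto
  have "homeomorphic_maps T T (\<lambda>x. a \<otimes> x \<otimes> b) (\<lambda>x. inv a \<otimes> x \<otimes> inv b)"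
    unfolding homeomorphic_maps_def using assms c topspace_eq
    by (auto simp: m_assoc inv_solve_left' intro!: c) (simp_all add: m_assoc[symmetric])
  then show ?thesis using homeomorphic_maps_map by blast
qed

lemma
  assumes "a \<in> carrier G" "b \<in> carrier G"
  shows openin_translation: "openin T U \<Longrightarrow> openin T ((\<lambda>x. a \<otimes> x \<otimes> b) ` U)"
    and compactin_translation: "compactin T C \<Longrightarrow> compactin T ((\<lambda>x. a \<otimes> x \<otimes> b) ` C)"
proof -
  note h = translation_homeomorphic[OF assms]
  show "openin T U \<Longrightarrow> openin T ((\<lambda>x. a \<otimes> x \<otimes> b) ` U)"
    using homeomorphic_imp_open_map[OF h] unfolding open_map_def by blast
  show "compactin T C \<Longrightarrow> compactin T ((\<lambda>x. a \<otimes> x \<otimes> b) ` C)"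
    using image_compactin[OF _ homeomorphic_imp_continuous_map[OF h]] by blast
qed

lemma l_coset_image: "U \<subseteq> carrier G \<Longrightarrow> g \<in> carrier G \<Longrightarrow> g <# U = (\<lambda>x. g \<otimes> x \<otimes> \<one>) ` U"
  unfolding l_coset_def by (auto simp: image_iff subset_iff)

lemma r_coset_image: "U \<subseteq> carrier G \<Longrightarrow> g \<in> carrier G \<Longrightarrow> U #> g = (\<lambda>x. \<one> \<otimes> x \<otimes> g) ` U"
  unfolding r_coset_def by (auto simp: image_iff subset_iff)

lemma
  assumes "g \<in> carrier G"
  shows openin_l_coset: "openin T U \<Longrightarrow> openin T (g <# U)"
    and compactin_l_coset: "compactin T C \<Longrightarrow> compactin T (g <# C)"
    and openin_r_coset: "openin T U \<Longrightarrow> openin T (U #> g)"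
    and compactin_r_coset: "compactin T C \<Longrightarrow> compactin T (C #> g)"
  using assms openin_carrier compactin_carrier openin_translation compactin_translation
  by (simp_all add: l_coset_image r_coset_image)

lemma ocsD:
  assumes "open_compact_subgroup G T M"
  shows "subgroup M G" "openin T M" "compactin T M" "M \<subseteq> carrier G" "\<one> \<in> M"
    "\<And>a b. \<lbrakk>a \<in> M; b \<in> M\<rbrakk> \<Longrightarrow> a \<otimes> b \<in> M" "\<And>a. a \<in> M \<Longrightarrow> inv a \<in> M" "closedin T M"
  using assms subgroup.subset subgroup.one_closed subgroup.m_closed subgroup.m_inv_closed
    compactin_imp_closedin[OF Hausdorff]
  unfolding open_compact_subgroup_def by metis+

lemma ocs_Int:
  assumes "open_compact_subgroup G T M" "open_compact_subgroup G T M'"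
  shows "open_compact_subgroup G T (M \<inter> M')"
  unfolding open_compact_subgroup_def
  using assms ocsD[OF assms(1)] ocsD[OF assms(2)]
  by (auto intro: subgroups_Inter_pair closed_Int_compactin)

lemma ocs_finite_below:
  assumes "finite I" "\<And>i. i \<in> I \<Longrightarrow> open_compact_subgroup G T (M i)"
  shows "\<exists>M'. open_compact_subgroup G T M' \<and> (\<forall>i\<in>I. M' \<subseteq> M i)"
  using assms
proof (induction I rule: finite_induct)
  case empty
  have "openin T (carrier G)" using topspace_eq openin_topspace by metis
  then show ?case using basis_at_one[of "carrier G"] by auto
next
  case (insert i I)
  then obtain M' where "open_compact_subgroup G T M'" "\<forall>i\<in>I. M' \<subseteq> M i" by auto
  then show ?case
    using ocs_Int[of M' "M i"] insert.prems by (intro exI[of _ "M' \<inter> M i"]) auto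
qed

lemma ocs_conjugate:
  assumes M: "open_compact_subgroup G T M" and g: "g \<in> carrier G"
  shows "open_compact_subgroup G T ((\<lambda>x. g \<otimes> x \<otimes> inv g) ` M)"
proof -
  have "subgroup ((\<lambda>x. g \<otimes> x \<otimes> inv g) ` M) G"
  proof (rule subgroupI)
    show "(\<lambda>x. g \<otimes> x \<otimes> inv g) ` M \<subseteq> carrier G" "(\<lambda>x. g \<otimes> x \<otimes> inv g) ` M \<noteq> {}"
      using ocsD(4,5)[OF M] g by auto
    show "inv a \<in> (\<lambda>x. g \<otimes> x \<otimes> inv g) ` M" if a: "a \<in> (\<lambda>x. g \<otimes> x \<otimes> inv g) ` M" for a
    proof -
      obtain m where "m \<in> M" "a = g \<otimes> m \<otimes> inv g" using a by auto
      moreover from this have "inv a = g \<otimes> inv m \<otimes> inv g"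
        using g ocsD(4)[OF M] by (auto simp: inv_mult_group m_assoc)
      ultimately show ?thesis using ocsD(7)[OF M] by auto
    qed
    show "a \<otimes> b \<in> (\<lambda>x. g \<otimes> x \<otimes> inv g) ` M"
      if ab: "a \<in> (\<lambda>x. g \<otimes> x \<otimes> inv g) ` M" "b \<in> (\<lambda>x. g \<otimes> x \<otimes> inv g) ` M" for a b
    proof -
      obtain m n where mn: "m \<in> M" "a = g \<otimes> m \<otimes> inv g" "n \<in> M" "b = g \<otimes> n \<otimes> inv g"
        using ab by auto
      have c: "m \<in> carrier G" "n \<in> carrier G" using mn ocsD(4)[OF M] by auto
      have "inv g \<otimes> (g \<otimes> (n \<otimes> inv g)) = n \<otimes> inv g"
        using g c by (simp add: m_assoc[symmetric])
      then have "a \<otimes> b = g \<otimes> (m \<otimes> n) \<otimes> inv g"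
        using g c mn by (simp add: m_assoc)
      then show ?thesis using ocsD(6)[OF M mn(1,3)] by auto
    qed
  qed
  then show ?thesis
    unfolding open_compact_subgroup_def
    using openin_translation[OF g inv_closed[OF g] ocsD(2)[OF M]]
      compactin_translation[OF g inv_closed[OF g] ocsD(3)[OF M]] by blast
qed

lemma mem_l_coset:
  assumes "r \<in> carrier G" "M \<subseteq> carrier G"
  shows "g \<in> r <# M \<longleftrightarrow> g \<in> carrier G \<and> inv r \<otimes> g \<in> M"
proof
  assume "g \<in> r <# M"
  then obtain m where "m \<in> M" "g = r \<otimes> m" unfolding l_coset_def by auto
  then show "g \<in> carrier G \<and> inv r \<otimes> g \<in> M"
    using assms by (auto simp: m_assoc[symmetric] subset_iff)
next
  assume g: "g \<in> carrier G \<and> inv r \<otimes> g \<in> M"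
  then have "g = r \<otimes> (inv r \<otimes> g)" using assms by (simp add: m_assoc[symmetric])
  then show "g \<in> r <# M" unfolding l_coset_def using g by blast
qed

lemma mem_r_coset:
  assumes "r \<in> carrier G" "M \<subseteq> carrier G"
  shows "g \<in> M #> r \<longleftrightarrow> g \<in> carrier G \<and> g \<otimes> inv r \<in> M"
proof
  assume "g \<in> M #> r"
  then obtain m where "m \<in> M" "g = m \<otimes> r" unfolding r_coset_def by auto
  then show "g \<in> carrier G \<and> g \<otimes> inv r \<in> M"
    using assms by (auto simp: m_assoc subset_iff)
next
  assume g: "g \<in> carrier G \<and> g \<otimes> inv r \<in> M"
  then have "g = (g \<otimes> inv r) \<otimes> r" using assms by (simp add: m_assoc)
  then show "g \<in> M #> r" unfolding r_coset_def using g by blast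
qed

lemma coset_transversal:
  assumes M: "open_compact_subgroup G T M" and C: "compactin T C"
  shows "\<exists>R. finite R \<and> R \<subseteq> C \<and> disjoint_family_on (\<lambda>r. r <# M) R \<and> C \<subseteq> (\<Union>r\<in>R. r <# M)"
proof -
  note CG = compactin_carrier[OF C]
  have "\<And>U. U \<in> (\<lambda>g. g <# M) ` C \<Longrightarrow> openin T U"
    using CG openin_l_coset ocsD(2)[OF M] by auto
  moreover have "x \<in> x <# M" if "x \<in> C" for x
    using that CG ocsD(4,5)[OF M] by (auto simp: mem_l_coset)
  then have "C \<subseteq> \<Union>((\<lambda>g. g <# M) ` C)" by blast
  ultimately obtain F where F: "finite F" "F \<subseteq> (\<lambda>g. g <# M) ` C" "C \<subseteq> \<Union>F"
    using C unfolding compactin_def by metis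
  have "\<forall>U\<in>F. \<exists>r\<in>C. U = r <# M" using F(2) by auto
  then obtain r where r: "\<And>U. U \<in> F \<Longrightarrow> r U \<in> C \<and> U = r U <# M" by metis
  have "disjoint_family_on (\<lambda>r. r <# M) (r ` F)"
    unfolding disjoint_family_on_def
  proof (intro ballI impI)
    fix a b assume ab: "a \<in> r ` F" "b \<in> r ` F" "a \<noteq> b"
    then obtain U V where UV: "U \<in> F" "V \<in> F" "a = r U" "b = r V" by auto
    show "(a <# M) \<inter> (b <# M) = {}"
    proof (rule ccontr)
      assume "(a <# M) \<inter> (b <# M) \<noteq> {}"
      then obtain y where "y \<in> a <# M" "y \<in> b <# M" by auto
      then have "a <# M = b <# M"
        using l_repr_independence[OF _ _ ocsD(1)[OF M]] UV r CG by (metis subsetD)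
      then have "U = V" using UV r by metis
      then show False using ab UV by simp
    qed
  qed
  moreover have "C \<subseteq> (\<Union>a\<in>r ` F. a <# M)"
    using F(3) r by fastforce
  ultimately show ?thesis using F(1) r by (intro exI[of _ "r ` F"]) auto
qed

text \<open>The compactness of the support upgrades local constancy to invariance under one subgroup.
  The map \<open>f\<close> stands for left or right translation.\<close>

lemma uniform_invariance:
  assumes \<psi>: "test_function T \<psi>"
    and cont: "continuous_map (prod_topology T T) T (\<lambda>(m, x). f m x)"
    and one: "\<And>x. x \<in> carrier G \<Longrightarrow> f \<one> x = x"
    and inverse: "\<And>m x. \<lbrakk>m \<in> carrier G; x \<in> carrier G\<rbrakk> \<Longrightarrow> f (inv m) (f m x) = x"
  shows "\<exists>M. open_compact_subgroup G T M \<and> (\<forall>m\<in>M. \<forall>x\<in>carrier G. \<psi> (f m x) = \<psi> x)"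
proof -
  define C where "C = T closure_of {x\<in>topspace T. \<psi> x \<noteq> 0}"
  have C: "compactin T C" using \<psi> unfolding test_function_def C_def by blast
  note CG = compactin_carrier[OF C]
  have out: "\<psi> x = 0" if "x \<in> carrier G" "x \<notin> C" for x
    using that closure_of_subset[of "{x\<in>topspace T. \<psi> x \<noteq> 0}" T] topspace_eq
    unfolding C_def by blast
  have fG: "f m x \<in> carrier G" if "m \<in> carrier G" "x \<in> carrier G" for m x
    using that continuous_map_image_subset_topspace[OF cont] topspace_eq by fastforce
  have "\<exists>V M. openin T V \<and> p \<in> V \<and> open_compact_subgroup G T M \<and>
      (\<forall>v\<in>V. \<forall>m\<in>M. \<psi> (f m v) = \<psi> v)" if p: "p \<in> C" for p
  proof -
    have pG: "p \<in> topspace T" using p CG topspace_eq by auto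
    then obtain U where U: "openin T U" "p \<in> U" "\<forall>y\<in>U. \<psi> y = \<psi> p"
      using \<psi> unfolding test_function_def by metis
    have "openin (prod_topology T T) {z\<in>topspace (prod_topology T T). (case z of (m, x) \<Rightarrow> f m x) \<in> U}"
      by (rule openin_continuous_map_preimage[OF cont U(1)])
    moreover have "(\<one>, p) \<in> {z\<in>topspace (prod_topology T T). (case z of (m, x) \<Rightarrow> f m x) \<in> U}"
      using pG U topspace_eq one by auto
    ultimately obtain A V where AV: "openin T A" "openin T V" "\<one> \<in> A" "p \<in> V"
        "A \<times> V \<subseteq> {z\<in>topspace (prod_topology T T). (case z of (m, x) \<Rightarrow> f m x) \<in> U}"
      unfolding openin_prod_topology_alt by meson
    obtain M where M: "open_compact_subgroup G T M" "M \<subseteq> A" using basis_at_one AV by blast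
    have fU: "f m v \<in> U" if "m \<in> M" "v \<in> V" for m v
    proof -
      have "(m, v) \<in> A \<times> V" using that M(2) by auto
      then show ?thesis using AV(5) by auto
    qed
    moreover have "v \<in> U" if "v \<in> V" for v
      using fU[OF ocsD(5)[OF M(1)] that] one that openin_carrier[OF AV(2)] by auto
    ultimately have "\<forall>v\<in>V. \<forall>m\<in>M. \<psi> (f m v) = \<psi> v" using U(3) by simp
    then show ?thesis using AV M by blast
  qed
  then obtain V M where VM: "\<And>p. p \<in> C \<Longrightarrow> openin T (V p) \<and> p \<in> V p \<and>
      open_compact_subgroup G T (M p) \<and> (\<forall>v\<in>V p. \<forall>m\<in>M p. \<psi> (f m v) = \<psi> v)"
    by metis
  have "\<And>U. U \<in> V ` C \<Longrightarrow> openin T U" "C \<subseteq> \<Union>(V ` C)" using VM by auto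
  then obtain F where "finite F" "F \<subseteq> V ` C" "C \<subseteq> \<Union>F"
    using C unfolding compactin_def by metis
  then obtain P where P: "finite P" "P \<subseteq> C" "C \<subseteq> (\<Union>p\<in>P. V p)"
    by (metis finite_subset_image)
  obtain M' where M': "open_compact_subgroup G T M'" "\<forall>p\<in>P. M' \<subseteq> M p"
    using ocs_finite_below[OF P(1), of M] VM P(2) by blast
  have inC: "\<psi> (f m x) = \<psi> x" if x: "x \<in> C" and m: "m \<in> M'" for x m
  proof -
    obtain p where p: "p \<in> P" "x \<in> V p" using P(3) x by blast
    then have "m \<in> M p" "p \<in> C" using M'(2) m P(2) by auto
    then show ?thesis using VM p(2) by blast
  qed
  have "\<psi> (f m x) = \<psi> x" if x: "x \<in> carrier G" and m: "m \<in> M'" for x m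
  proof (cases "x \<in> C \<or> f m x \<notin> C")
    case True
    have mG: "m \<in> carrier G" using m ocsD(4)[OF M'(1)] by auto
    show ?thesis
    proof (cases "x \<in> C")
      case False
      then show ?thesis using True out[OF x] out[OF fG[OF mG x]] by simp
    qed (rule inC[OF _ m])
  next
    case False
    have mG: "m \<in> carrier G" using m ocsD(4)[OF M'(1)] by auto
    show ?thesis
      using inC[of "f m x" "inv m"] False ocsD(7)[OF M'(1) m] inverse[OF mG x] by simp
  qed
  then show ?thesis using M'(1) by blast
qed

lemma test_function_invariance:
  assumes \<psi>: "test_function T \<psi>"
  shows "\<exists>M. open_compact_subgroup G T M \<and>
    (\<forall>m\<in>M. \<forall>x\<in>carrier G. \<psi> (x \<otimes> m) = \<psi> x \<and> \<psi> (m \<otimes> x) = \<psi> x)"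
proof -
  have "continuous_map (prod_topology T T) T (\<lambda>(m, x). m \<otimes> x)" by (rule continuous_mult)
  then have "\<exists>M. open_compact_subgroup G T M \<and> (\<forall>m\<in>M. \<forall>x\<in>carrier G. \<psi> (m \<otimes> x) = \<psi> x)"
    by (rule uniform_invariance[OF \<psi>]) (simp_all add: m_assoc[symmetric])
  then obtain M1 where M1: "open_compact_subgroup G T M1" "\<forall>m\<in>M1. \<forall>x\<in>carrier G. \<psi> (m \<otimes> x) = \<psi> x"
    by blast
  have "continuous_map (prod_topology T T) T (\<lambda>(m, x). x \<otimes> m)"
    unfolding case_prod_beta
    by (intro continuous_map_mult continuous_map_fst continuous_map_snd)
  then have "\<exists>M. open_compact_subgroup G T M \<and> (\<forall>m\<in>M. \<forall>x\<in>carrier G. \<psi> (x \<otimes> m) = \<psi> x)"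
    by (rule uniform_invariance[OF \<psi>]) (simp_all add: m_assoc)
  then obtain M2 where M2: "open_compact_subgroup G T M2" "\<forall>m\<in>M2. \<forall>x\<in>carrier G. \<psi> (x \<otimes> m) = \<psi> x"
    by blast
  show ?thesis using M1 M2 ocs_Int[OF M1(1) M2(1)] by (intro exI[of _ "M1 \<inter> M2"]) auto
qed

end

text \<open>Squaring multiplies the distance to \<open>1\<close> by the distance to \<open>- 1\<close>, which is at least \<open>3/2\<close>
  near \<open>1\<close>. Hence iterated squares of some \<open>z \<noteq> 1\<close> cannot all stay near \<open>1\<close>.\<close>

lemma complex_no_small_subgroups:
  fixes z :: complex
  assumes "\<And>n. norm (z ^ n - 1) < 1/2"
  shows "z = 1"
proof -
  have "norm (z ^ (2 ^ k) - 1) \<ge> (3/2) ^ k * norm (z - 1)" for k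
  proof (induction k)
    case (Suc k)
    define w where "w = z ^ (2 ^ k)"
    have "norm (w + 1) \<ge> 3/2"
    proof -
      have "norm (2::complex) \<le> norm (w + 1) + norm (w - 1)"
        using norm_triangle_ineq4[of "w + 1" "w - 1"] by simp
      then show ?thesis using assms[of "2 ^ k"] unfolding w_def by simp
    qed
    then have "(3/2) * norm (w - 1) \<le> norm (w + 1) * norm (w - 1)"
      by (intro mult_right_mono) auto
    also have "\<dots> = norm (z ^ (2 ^ Suc k) - 1)"
    proof -
      have "z ^ (2 ^ Suc k) = w\<^sup>2"
        unfolding w_def by (metis power_Suc power_mult mult.commute)
      then show ?thesis by (simp add: norm_mult[symmetric] algebra_simps power2_eq_square)
    qed
    finally show ?case using Suc unfolding w_def by simp
  qed simp
  then have bound: "(3/2) ^ k * norm (z - 1) < 1/2" for k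
    using assms le_less_trans by blast
  show ?thesis
  proof (rule ccontr)
    assume "z \<noteq> 1"
    then have pos: "norm (z - 1) > 0" by simp
    obtain k where "1 / norm (z - 1) < (3/2::real) ^ k"
      using real_arch_pow[of "3/2"] by auto
    then have "1 < (3/2) ^ k * norm (z - 1)" using pos by (simp add: field_simps)
    then show False using bound[of k] by simp
  qed
qed

lemma (in locally_profinite_group) character_trivial_near_one:
  assumes \<omega>: "group_character G T \<omega>"
  shows "\<exists>M. open_compact_subgroup G T M \<and> (\<forall>m\<in>M. \<omega> m = 1)"
proof -
  have mult: "\<omega> (x \<otimes> y) = \<omega> x * \<omega> y" if "x \<in> carrier G" "y \<in> carrier G" for x y
    using \<omega> that unfolding group_character_def by blast
  have one: "\<omega> \<one> = 1"
    using mult[of \<one> \<one>] \<omega> unfolding group_character_def by auto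
  have "openin T {x\<in>topspace T. \<omega> x \<in> ball 1 (1/2)}"
    using \<omega> unfolding group_character_def
    by (intro openin_continuous_map_preimage[where Y = euclidean]) auto
  moreover have "\<one> \<in> {x\<in>topspace T. \<omega> x \<in> ball 1 (1/2)}"
    using one topspace_eq by simp
  ultimately obtain M where M: "open_compact_subgroup G T M"
      "M \<subseteq> {x\<in>topspace T. \<omega> x \<in> ball 1 (1/2)}"
    using basis_at_one by blast
  have "\<omega> m = 1" if m: "m \<in> M" for m
  proof (rule complex_no_small_subgroups)
    fix n :: nat
    have mG: "m \<in> carrier G" using m ocsD(4)[OF M(1)] by auto
    have "m [^] n \<in> M" by (induction n) (simp_all add: ocsD(5,6)[OF M(1)] m)
    moreover have "\<omega> (m [^] n) = \<omega> m ^ n"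
      by (induction n) (simp_all add: one mult mG)
    ultimately show "norm (\<omega> m ^ n - 1) < 1/2"
      using M(2) by (auto simp: dist_norm norm_minus_commute)
  qed
  then show ?thesis using M(1) by blast
qed

section \<open>Integration of step functions against Haar measure\<close>

lemma has_bochner_integral_partition:
  fixes F :: "'a \<Rightarrow> 'b::{banach, second_countable_topology}"
  assumes I: "finite I" and disj: "disjoint_family_on B I"
    and B: "\<And>i. i \<in> I \<Longrightarrow> B i \<in> fmeasurable M"
    and F: "\<And>i x. \<lbrakk>i \<in> I; x \<in> B i\<rbrakk> \<Longrightarrow> F x = v i"
    and out: "\<And>x. \<lbrakk>x \<in> space M; x \<notin> (\<Union>i\<in>I. B i)\<rbrakk> \<Longrightarrow> F x = 0"
  shows "has_bochner_integral M F (\<Sum>i\<in>I. measure M (B i) *\<^sub>R v i)"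
proof -
  have "has_bochner_integral M (\<lambda>x. \<Sum>i\<in>I. indicator (B i) x *\<^sub>R v i)
      (\<Sum>i\<in>I. measure M (B i) *\<^sub>R v i)"
    using B by (intro has_bochner_integral_sum has_bochner_integral_scaleR_left
      has_bochner_integral_real_indicator) (auto simp: fmeasurable_def)
  moreover have "F x = (\<Sum>i\<in>I. indicator (B i) x *\<^sub>R v i)" if x: "x \<in> space M" for x
  proof (cases "x \<in> (\<Union>i\<in>I. B i)")
    case True
    then obtain j where j: "j \<in> I" "x \<in> B j" by blast
    then have "indicator (B i) x *\<^sub>R v i = (if i = j then v j else 0)" if "i \<in> I" for i
      using disj that unfolding disjoint_family_on_def by (cases "i = j") (auto simp: indicator_def)
    then have "(\<Sum>i\<in>I. indicator (B i) x *\<^sub>R v i) = (\<Sum>i\<in>I. if i = j then v j else 0)"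
      by (intro sum.cong) auto
    then show ?thesis using F[OF j] I j by simp
  next
    case False
    then have "(\<Sum>i\<in>I. indicator (B i) x *\<^sub>R v i) = 0"
      by (intro sum.neutral) (auto simp: indicator_def)
    then show ?thesis using out[OF x False] by simp
  qed
  ultimately show ?thesis by (subst has_bochner_integral_cong) (auto)
qed

locale haar_group = locally_profinite_group G T for G (structure) and T +
  fixes \<mu> :: "'a measure"
  assumes haar: "left_haar_measure G T \<mu>"
begin

lemma space_haar: "space \<mu> = carrier G"
  and sets_haar: "sets \<mu> = sets (borel_sigma T)"
  and emeasure_l_coset: "\<And>g A. \<lbrakk>g \<in> carrier G; A \<in> sets \<mu>\<rbrakk> \<Longrightarrow> emeasure \<mu> (g <# A) = emeasure \<mu> A"
  and emeasure_compactin: "\<And>C. compactin T C \<Longrightarrow> emeasure \<mu> C < \<infinity>"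
  and emeasure_openin: "\<And>U. \<lbrakk>openin T U; U \<noteq> {}\<rbrakk> \<Longrightarrow> emeasure \<mu> U > 0"
proof -
  note 1 = haar[unfolded left_haar_measure_def]
  note 2 = conjunct2[OF 1] note 3 = conjunct2[OF 2] note 4 = conjunct2[OF 3] note 5 = conjunct2[OF 4]
  show "space \<mu> = carrier G" by (rule conjunct1[OF 1])
  show "sets \<mu> = sets (borel_sigma T)" by (rule conjunct1[OF 2])
  show "emeasure \<mu> (g <# A) = emeasure \<mu> A" if "g \<in> carrier G" "A \<in> sets \<mu>" for g A
    by (rule conjunct1[OF 3, rule_format, OF that])
  show "emeasure \<mu> C < \<infinity>" if "compactin T C" for C
    by (rule conjunct1[OF 4, rule_format, OF that])
  show "emeasure \<mu> U > 0" if "openin T U" "U \<noteq> {}" for U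
    by (rule conjunct1[OF 5, rule_format]) (use that in blast)
qed

lemma openin_sets: "openin T U \<Longrightarrow> U \<in> sets \<mu>"
proof -
  assume "openin T U"
  moreover have "sets \<mu> = sigma_sets (topspace T) {U. openin T U}"
    unfolding sets_haar borel_sigma_def by (rule sets_measure_of) (use openin_subset in auto)
  ultimately show ?thesis by auto
qed

lemma openin_compactin_fmeasurable: "openin T U \<Longrightarrow> compactin T U \<Longrightarrow> U \<in> fmeasurable \<mu>"
  by (rule fmeasurableI[OF openin_sets emeasure_compactin])

lemma ocs_fmeasurable: "open_compact_subgroup G T M \<Longrightarrow> M \<in> fmeasurable \<mu>"
  by (rule openin_compactin_fmeasurable[OF ocsD(2,3)])

lemma l_coset_fmeasurable:
  "open_compact_subgroup G T M \<Longrightarrow> g \<in> carrier G \<Longrightarrow> g <# M \<in> fmeasurable \<mu>"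
  by (rule openin_compactin_fmeasurable[OF openin_l_coset compactin_l_coset])
    (rule ocsD(2,3) | assumption)+

lemma ocs_measure_pos:
  assumes "open_compact_subgroup G T M"
  shows "measure \<mu> M > 0"
proof -
  have "emeasure \<mu> M > 0"
    using emeasure_openin[OF ocsD(2)[OF assms]] ocsD(5)[OF assms] by auto
  then show ?thesis
    using ocs_fmeasurable[OF assms] by (simp add: emeasure_eq_measure2)
qed

text \<open>Left invariance extends to all subsets, because translates of sets that are not measurable are
  not measurable.\<close>

lemma measure_l_coset:
  assumes g: "g \<in> carrier G" and A: "A \<subseteq> carrier G"
  shows "measure \<mu> (g <# A) = measure \<mu> A"
proof -
  have sets_mult: "h <# B \<in> sets \<mu>" if h: "h \<in> carrier G" and B: "B \<in> sets \<mu>" for h B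
  proof -
    have "(\<lambda>x. inv h \<otimes> x) -` B \<inter> space \<mu> \<in> sets \<mu>"
    proof (rule measurable_sets[OF _ B])
      have "(\<lambda>x. inv h \<otimes> x) \<in> measurable \<mu> (sigma (topspace T) {U. openin T U})"
      proof (rule measurable_measure_of)
        show "{U. openin T U} \<subseteq> Pow (topspace T)" using openin_subset by auto
        show "(\<lambda>x. inv h \<otimes> x) \<in> space \<mu> \<rightarrow> topspace T" using h by (simp add: space_haar topspace_eq)
        fix U assume "U \<in> {U. openin T U}"
        then have "openin T {x\<in>topspace T. inv h \<otimes> x \<in> U}"
          using h topspace_eq
          by (intro openin_continuous_map_preimage[where Y = T] continuous_map_mult) auto
        moreover have "(\<lambda>x. inv h \<otimes> x) -` U \<inter> space \<mu> = {x\<in>topspace T. inv h \<otimes> x \<in> U}"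
          using topspace_eq space_haar by auto
        ultimately show "(\<lambda>x. inv h \<otimes> x) -` U \<inter> space \<mu> \<in> sets \<mu>" using openin_sets by simp
      qed
      moreover have "sets \<mu> = sets (sigma (topspace T) {U. openin T U})"
        using sets_haar unfolding borel_sigma_def .
      ultimately show "(\<lambda>x. inv h \<otimes> x) \<in> measurable \<mu> \<mu>"
        using measurable_cong_sets[of \<mu> \<mu> \<mu> "sigma (topspace T) {U. openin T U}"] by simp
    qed
    moreover have "(\<lambda>x. inv h \<otimes> x) -` B \<inter> space \<mu> = h <# B"
      using h sets.sets_into_space[OF B] space_haar by (auto simp: mem_l_coset)
    ultimately show ?thesis by simp
  qed
  show ?thesis
  proof (cases "A \<in> sets \<mu>")
    case True
    then show ?thesis using emeasure_l_coset[OF g] by (simp add: measure_def)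
  next
    case False
    have "inv g <# (g <# A) = A"
      using g A by (simp add: lcos_m_assoc lcos_mult_one)
    then have "g <# A \<notin> sets \<mu>" using False sets_mult[of "inv g" "g <# A"] g by auto
    then show ?thesis using False by (simp add: measure_notin_sets)
  qed
qed

lemma simple_integral_translate:
  assumes a: "a \<in> carrier G"
  shows "simple_integral s \<mu> (\<lambda>x. F (a \<otimes> x)) = simple_integral s \<mu> F"
proof (rule simple_integral_bij[symmetric])
  show "bij_betw (\<lambda>x. a \<otimes> x) (space \<mu>) (space \<mu>)"
    unfolding space_haar using a
    by (intro bij_betwI[where g = "\<lambda>x. inv a \<otimes> x"]) (auto simp: m_assoc[symmetric])
  fix A assume A: "A \<subseteq> space \<mu>"
  then have "(\<lambda>x. a \<otimes> x) -` A \<inter> space \<mu> = inv a <# A"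
    using a unfolding space_haar by (auto simp: mem_l_coset)
  then show "measure \<mu> ((\<lambda>x. a \<otimes> x) -` A \<inter> space \<mu>) = measure \<mu> A"
    using measure_l_coset[of "inv a" A] a A space_haar by simp
qed

end

text \<open>For functions of compact support, invariance under one open compact subgroup is the same as
  local constancy, but it directly yields a partition into cosets.\<close>

definition (in topological_group) step_function :: "('a \<Rightarrow> 'v::zero) \<Rightarrow> bool" where
  "step_function F \<longleftrightarrow> (\<exists>M C. open_compact_subgroup G T M \<and> compactin T C \<and>
    (\<forall>x\<in>carrier G. \<forall>m\<in>M. F (x \<otimes> m) = F x) \<and> (\<forall>x\<in>carrier G. F x \<noteq> 0 \<longrightarrow> x \<in> C))"

context locally_profinite_group
begin

lemma step_functionI:
  assumes "open_compact_subgroup G T M" "compactin T C"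
    "\<And>x m. \<lbrakk>x \<in> carrier G; m \<in> M\<rbrakk> \<Longrightarrow> F (x \<otimes> m) = F x"
    "\<And>x. \<lbrakk>x \<in> carrier G; F x \<noteq> 0\<rbrakk> \<Longrightarrow> x \<in> C"
  shows "step_function F"
  using assms unfolding step_function_def by blast

text \<open>The invariance subgroups have an open compact intersection and the supports have a compact
  union. The common partition makes integration additive.\<close>

lemma step_functions_partition:
  assumes I: "finite I" and F: "\<forall>i\<in>I. step_function (F i)"
  shows "\<exists>M R. open_compact_subgroup G T M \<and> finite R \<and> R \<subseteq> carrier G \<and>
    disjoint_family_on (\<lambda>r. r <# M) R \<and>
    (\<forall>i\<in>I. \<forall>x\<in>carrier G. \<forall>m\<in>M. F i (x \<otimes> m) = F i x) \<and>
    (\<forall>i\<in>I. \<forall>x\<in>carrier G. x \<notin> (\<Union>r\<in>R. r <# M) \<longrightarrow> F i x = 0)"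
proof -
  from F obtain M C where MC: "\<And>i. i \<in> I \<Longrightarrow> open_compact_subgroup G T (M i) \<and> compactin T (C i) \<and>
      (\<forall>x\<in>carrier G. \<forall>m\<in>M i. F i (x \<otimes> m) = F i x) \<and> (\<forall>x\<in>carrier G. F i x \<noteq> 0 \<longrightarrow> x \<in> C i)"
    unfolding step_function_def by metis
  have M: "open_compact_subgroup G T (M i)" and C: "compactin T (C i)" if "i \<in> I" for i
    using MC[OF that] by (rule conjunct1, elim conjE)
  have inv: "F i (x \<otimes> m) = F i x" if "i \<in> I" "x \<in> carrier G" "m \<in> M i" for i x m
    using MC[OF that(1)] that(2,3) by (elim conjE) simp
  have supp: "x \<in> C i" if "i \<in> I" "x \<in> carrier G" "F i x \<noteq> 0" for i x
    using MC[OF that(1)] that(2,3) by (elim conjE) simp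
  obtain M' where M': "open_compact_subgroup G T M'" "\<forall>i\<in>I. M' \<subseteq> M i"
    using ocs_finite_below[OF I, of M] M by blast
  have comp: "compactin T (\<Union>(C ` I))" using C by (intro compactin_Union) (auto simp: I)
  obtain R where R: "finite R" "R \<subseteq> \<Union>(C ` I)" "disjoint_family_on (\<lambda>r. r <# M') R"
      "\<Union>(C ` I) \<subseteq> (\<Union>r\<in>R. r <# M')"
    using coset_transversal[OF M'(1) comp] by blast
  have "R \<subseteq> carrier G" using R(2) compactin_carrier[OF comp] by (rule order_trans)
  moreover have "\<forall>i\<in>I. \<forall>x\<in>carrier G. \<forall>m\<in>M'. F i (x \<otimes> m) = F i x"
    using inv M'(2) by blast
  moreover have "\<forall>i\<in>I. \<forall>x\<in>carrier G. x \<notin> (\<Union>r\<in>R. r <# M') \<longrightarrow> F i x = 0"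
    using supp R(4) by blast
  ultimately show ?thesis using M'(1) R(1,3) by blast
qed

lemma step_function_sum:
  fixes F :: "'i \<Rightarrow> 'a \<Rightarrow> 'v::comm_monoid_add"
  assumes I: "finite I" and F: "\<forall>i\<in>I. step_function (F i)"
  shows "step_function (\<lambda>x. \<Sum>i\<in>I. F i x)"
proof -
  obtain M R where MR: "open_compact_subgroup G T M" "finite R" "R \<subseteq> carrier G"
    "disjoint_family_on (\<lambda>r. r <# M) R"
    "\<forall>i\<in>I. \<forall>x\<in>carrier G. \<forall>m\<in>M. F i (x \<otimes> m) = F i x"
    "\<forall>i\<in>I. \<forall>x\<in>carrier G. x \<notin> (\<Union>r\<in>R. r <# M) \<longrightarrow> F i x = 0"
    using step_functions_partition[OF I F] by (elim exE conjE) (rule that)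
  show ?thesis
  proof (rule step_functionI[OF MR(1)])
    show "compactin T (\<Union>((\<lambda>r. r <# M) ` R))"
      using MR(2,3) compactin_l_coset ocsD(3)[OF MR(1)] by (intro compactin_Union) auto
    show "(\<Sum>i\<in>I. F i (x \<otimes> m)) = (\<Sum>i\<in>I. F i x)" if "x \<in> carrier G" "m \<in> M" for x m
      using that MR(5) by (intro sum.cong) auto
    show "x \<in> \<Union>((\<lambda>r. r <# M) ` R)" if "x \<in> carrier G" "(\<Sum>i\<in>I. F i x) \<noteq> 0" for x
      using that MR(6) sum.neutral[of I "\<lambda>i. F i x"] by blast
  qed
qed

end

context haar_group
begin

lemma l_coset_representative:
  assumes "\<And>m. m \<in> M \<Longrightarrow> F (r \<otimes> m) = F r" "x \<in> r <# M"
  shows "F x = F r"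
  using assms unfolding l_coset_def by auto

lemma simple_integral_cosets:
  assumes "vector_space s" and M: "open_compact_subgroup G T M"
    and R: "finite R" "R \<subseteq> carrier G" "disjoint_family_on (\<lambda>r. r <# M) R"
    and F: "\<And>r m. \<lbrakk>r \<in> R; m \<in> M\<rbrakk> \<Longrightarrow> F (r \<otimes> m) = F r"
    and out: "\<And>x. \<lbrakk>x \<in> carrier G; x \<notin> (\<Union>r\<in>R. r <# M)\<rbrakk> \<Longrightarrow> F x = 0"
  shows "simple_integral s \<mu> F = (\<Sum>r\<in>R. s (complex_of_real (measure \<mu> M)) (F r))"
proof -
  have "simple_integral s \<mu> F = (\<Sum>r\<in>R. s (complex_of_real (measure \<mu> (r <# M))) (F r))"
  proof (rule simple_integral_partition[OF assms(1) R(1,3)])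
    show "r <# M \<in> fmeasurable \<mu>" if "r \<in> R" for r
      using l_coset_fmeasurable[OF M] R(2) that by blast
    show "F x = F r" if "r \<in> R" "x \<in> r <# M" for r x
      by (rule l_coset_representative[OF F[OF that(1)] that(2)])
    show "F x = 0" if "x \<in> space \<mu>" "x \<notin> (\<Union>r\<in>R. r <# M)" for x
      using out that space_haar by simp
  qed
  also have "\<dots> = (\<Sum>r\<in>R. s (complex_of_real (measure \<mu> M)) (F r))"
    using R ocsD(4)[OF M] by (intro sum.cong) (auto simp: measure_l_coset)
  finally show ?thesis .
qed

lemma simple_integral_sum:
  assumes s: "vector_space s" and I: "finite I" and F: "\<forall>i\<in>I. step_function (F i)"
  shows "simple_integral s \<mu> (\<lambda>x. \<Sum>i\<in>I. F i x) = (\<Sum>i\<in>I. simple_integral s \<mu> (F i))"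
proof -
  interpret vector_space s by (rule s)
  obtain M R where MR: "open_compact_subgroup G T M" "finite R" "R \<subseteq> carrier G"
    "disjoint_family_on (\<lambda>r. r <# M) R"
    "\<forall>i\<in>I. \<forall>x\<in>carrier G. \<forall>m\<in>M. F i (x \<otimes> m) = F i x"
    "\<forall>i\<in>I. \<forall>x\<in>carrier G. x \<notin> (\<Union>r\<in>R. r <# M) \<longrightarrow> F i x = 0"
    using step_functions_partition[OF I F] by (elim exE conjE) (rule that)
  have each: "simple_integral s \<mu> (F i) = (\<Sum>r\<in>R. s (complex_of_real (measure \<mu> M)) (F i r))"
    if "i \<in> I" for i
    using MR that by (intro simple_integral_cosets[OF s MR(1-4)]) auto
  have "simple_integral s \<mu> (\<lambda>x. \<Sum>i\<in>I. F i x) =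
      (\<Sum>r\<in>R. s (complex_of_real (measure \<mu> M)) (\<Sum>i\<in>I. F i r))"
    using MR by (intro simple_integral_cosets[OF s MR(1-4)]) (auto intro!: sum.cong sum.neutral)
  also have "\<dots> = (\<Sum>r\<in>R. \<Sum>i\<in>I. s (complex_of_real (measure \<mu> M)) (F i r))"
    by (simp add: scale_sum_right)
  also have "\<dots> = (\<Sum>i\<in>I. simple_integral s \<mu> (F i))"
    by (subst sum.swap) (simp add: each)
  finally show ?thesis .
qed

text \<open>Two vector spaces are involved because functions with values in the induced space are
  integrated and the result is then evaluated at a point.\<close>

lemma simple_integral_linear:
  assumes s: "vector_space s" and s': "vector_space s'" and V: "module.subspace s V"
    and F: "step_function F" and FV: "\<And>x. x \<in> carrier G \<Longrightarrow> F x \<in> V"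
    and add: "\<And>v w. \<lbrakk>v \<in> V; w \<in> V\<rbrakk> \<Longrightarrow> \<Phi> (v + w) = \<Phi> v + \<Phi> w"
    and scale: "\<And>c v. v \<in> V \<Longrightarrow> \<Phi> (s c v) = s' c (\<Phi> v)"
  shows "simple_integral s' \<mu> (\<lambda>x. \<Phi> (F x)) = \<Phi> (simple_integral s \<mu> F)"
    and "simple_integral s \<mu> F \<in> V"
proof -
  interpret vector_space s by (rule s)
  interpret s': vector_space s' by (rule s')
  have subV: "subspace V" by (rule V)
  obtain M R where MR: "open_compact_subgroup G T M" "finite R" "R \<subseteq> carrier G"
    "disjoint_family_on (\<lambda>r. r <# M) R"
    "\<forall>i\<in>{()}. \<forall>x\<in>carrier G. \<forall>m\<in>M. F (x \<otimes> m) = F x"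
    "\<forall>i\<in>{()}. \<forall>x\<in>carrier G. x \<notin> (\<Union>r\<in>R. r <# M) \<longrightarrow> F x = 0"
    using step_functions_partition[of "{()}" "\<lambda>_. F"] F by auto
  let ?c = "complex_of_real (measure \<mu> M)"
  have zero: "\<Phi> 0 = 0" using scale[OF subspace_0[OF subV], of 0] by simp
  have eq: "simple_integral s \<mu> F = (\<Sum>r\<in>R. s ?c (F r))"
    using MR by (intro simple_integral_cosets[OF s MR(1-4)]) auto
  then show "simple_integral s \<mu> F \<in> V"
    using MR(3) FV by (auto intro!: subspace_sum[OF subV] subspace_scale[OF subV])
  have "simple_integral s' \<mu> (\<lambda>x. \<Phi> (F x)) = (\<Sum>r\<in>R. s' ?c (\<Phi> (F r)))"
    using MR zero by (intro simple_integral_cosets[OF s' MR(1-4)]) auto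
  also have "\<dots> = (\<Sum>r\<in>R. \<Phi> (s ?c (F r)))"
    using MR(3) FV scale by (intro sum.cong) auto
  also have "\<dots> = \<Phi> (\<Sum>r\<in>R. s ?c (F r))"
    using MR(2,3)
  proof (induction R rule: finite_induct)
    case (insert r R)
    then have "(\<Sum>r\<in>R. s ?c (F r)) \<in> V"
      using FV by (auto intro!: subspace_sum[OF subV] subspace_scale[OF subV])
    then show ?case using insert FV by (simp add: add subspace_scale[OF subV])
  qed (simp add: zero)
  finally show "simple_integral s' \<mu> (\<lambda>x. \<Phi> (F x)) = \<Phi> (simple_integral s \<mu> F)"
    using eq by simp
qed

section \<open>The modulus\<close>

text \<open>Both sides are decomposed into left cosets of a common smaller subgroup, so the ratio
  \<open>vol (M x) / vol M\<close> does not depend on the open compact subgroup \<open>M\<close>.\<close>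

lemma measure_r_coset_ratio:
  assumes M: "open_compact_subgroup G T M" and N: "open_compact_subgroup G T N"
    and x: "x \<in> carrier G"
  shows "measure \<mu> (M #> x) * measure \<mu> N = measure \<mu> (N #> x) * measure \<mu> M"
proof -
  have index: "\<exists>k::real. \<forall>x\<in>carrier G. measure \<mu> (N #> x) = k * measure \<mu> (M #> x)"
    if M: "open_compact_subgroup G T M" and N: "open_compact_subgroup G T N" and MN: "M \<subseteq> N"
    for M N
  proof -
    obtain R where R: "finite R" "R \<subseteq> N" "disjoint_family_on (\<lambda>r. r <# M) R"
        "N \<subseteq> (\<Union>r\<in>R. r <# M)"
      using coset_transversal[OF M ocsD(3)[OF N]] by blast
    have RG: "R \<subseteq> carrier G" using R(2) ocsD(4)[OF N] by auto
    have "r <# M \<subseteq> N" if "r \<in> R" for r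
      using R(2) MN that ocsD(6)[OF N] unfolding l_coset_def by auto
    then have N_eq: "N = (\<Union>r\<in>R. r <# M)" using R(4) by auto
    have "measure \<mu> (N #> x) = card R * measure \<mu> (M #> x)" if x: "x \<in> carrier G" for x
    proof -
      have "N #> x = (\<Union>r\<in>R. (r <# M) #> x)" unfolding N_eq r_coset_def by auto
      then have N_x: "N #> x = (\<Union>r\<in>R. r <# (M #> x))"
        using RG x ocsD(4)[OF M] by (simp add: coset_assoc subset_iff)
      have "disjoint_family_on (\<lambda>r. r <# (M #> x)) R"
        unfolding disjoint_family_on_def
      proof (intro ballI impI)
        fix a b assume ab: "a \<in> R" "b \<in> R" "a \<noteq> b"
        have "(a <# M) \<inter> (b <# M) = {}" using R(3) ab unfolding disjoint_family_on_def by blast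
        moreover have "y \<otimes> inv x \<in> r <# M" if "y \<in> r <# (M #> x)" "r \<in> R" for y r
        proof -
          have r: "r \<in> carrier G" using RG that by auto
          have "M #> x \<subseteq> carrier G" using x ocsD(4)[OF M] by (simp add: r_coset_subset_G)
          then have "y \<in> carrier G" "(inv r \<otimes> y) \<otimes> inv x \<in> M"
            using that(1) r x ocsD(4)[OF M] by (auto simp: mem_l_coset mem_r_coset)
          then show ?thesis using r x ocsD(4)[OF M] by (simp add: mem_l_coset m_assoc)
        qed
        ultimately show "(a <# (M #> x)) \<inter> (b <# (M #> x)) = {}" using ab by blast
      qed
      moreover have Mx: "openin T (M #> x)" "compactin T (M #> x)"
        using x openin_r_coset compactin_r_coset ocsD[OF M] by auto
      have "r <# (M #> x) \<in> fmeasurable \<mu>" if "r \<in> R" for r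
        using RG that openin_l_coset[OF _ Mx(1)] compactin_l_coset[OF _ Mx(2)]
        by (intro openin_compactin_fmeasurable) auto
      ultimately have "measure \<mu> (N #> x) = (\<Sum>r\<in>R. measure \<mu> (r <# (M #> x)))"
        unfolding N_x using R(1)
        by (intro measure_finite_Union) (auto simp: fmeasurable_def top.not_eq_extremum)
      also have "\<dots> = (\<Sum>r\<in>R. measure \<mu> (M #> x))"
        using RG x ocsD(4)[OF M] by (intro sum.cong) (auto simp: measure_l_coset r_coset_subset_G)
      finally show ?thesis by simp
    qed
    then show ?thesis by blast
  qed
  have MN: "open_compact_subgroup G T (M \<inter> N)" by (rule ocs_Int[OF M N])
  obtain k where k: "\<forall>x\<in>carrier G. measure \<mu> (M #> x) = k * measure \<mu> ((M \<inter> N) #> x)"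
    using index[OF MN M] by auto
  obtain l where l: "\<forall>x\<in>carrier G. measure \<mu> (N #> x) = l * measure \<mu> ((M \<inter> N) #> x)"
    using index[OF MN N] by auto
  show ?thesis
    using k[rule_format, OF x] l[rule_format, OF x] k[rule_format, OF one_closed]
      l[rule_format, OF one_closed] ocsD(4)[OF M] ocsD(4)[OF N] ocsD(4)[OF MN]
    by (simp add: algebra_simps)
qed

text \<open>A test function is a finite combination of indicator functions of left cosets of a small
  subgroup, so the ratio of volumes has the defining property of the modulus. The indicator function
  of \<open>M\<close> shows that no other number has it.\<close>

lemma group_modulus_eq:
  assumes M: "open_compact_subgroup G T M" and x: "x \<in> carrier G"
  shows "group_modulus G T \<mu> x = measure \<mu> (M #> x) / measure \<mu> M"
proof -
  let ?c = "measure \<mu> (M #> x) / measure \<mu> M"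
  have Mx: "openin T (M #> x)" "compactin T (M #> x)"
    using x openin_r_coset compactin_r_coset ocsD[OF M] by auto
  have integral: "(LINT h|\<mu>. f (h \<otimes> inv x)) = complex_of_real ?c * (LINT h|\<mu>. f h)"
    if f: "test_function T f" for f
  proof -
    define C where "C = T closure_of {x\<in>topspace T. f x \<noteq> 0}"
    have C: "compactin T C" using f unfolding test_function_def C_def by blast
    have out: "f h = 0" if "h \<in> carrier G" "h \<notin> C" for h
      using that closure_of_subset[of "{x\<in>topspace T. f x \<noteq> 0}" T] topspace_eq
      unfolding C_def by blast
    obtain N where N: "open_compact_subgroup G T N"
        "\<And>m h. \<lbrakk>m \<in> N; h \<in> carrier G\<rbrakk> \<Longrightarrow> f (h \<otimes> m) = f h"
      using test_function_invariance[OF f] by blast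
    obtain R where R: "finite R" "R \<subseteq> C" "disjoint_family_on (\<lambda>r. r <# N) R"
        "C \<subseteq> (\<Union>r\<in>R. r <# N)"
      using coset_transversal[OF N(1) C] by blast
    have RG: "R \<subseteq> carrier G" using R(2) compactin_carrier[OF C] by auto
    have val: "f h = f r" if "r \<in> R" "h \<in> r <# N" for r h
      using that N(2) RG unfolding l_coset_def by auto
    have "has_bochner_integral \<mu> f (\<Sum>r\<in>R. measure \<mu> (r <# N) *\<^sub>R f r)"
      using R(1,3,4) RG out val l_coset_fmeasurable[OF N(1)] space_haar
      by (intro has_bochner_integral_partition) blast+
    then have i1: "(LINT h|\<mu>. f h) = (\<Sum>r\<in>R. measure \<mu> N *\<^sub>R f r)"
      unfolding has_bochner_integral_integral_eq[OF \<open>has_bochner_integral \<mu> f _\<close>]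
      using RG ocsD(4)[OF N(1)] by (intro sum.cong) (auto simp: measure_l_coset)
    have Nx: "openin T (N #> x)" "compactin T (N #> x)" "N #> x \<subseteq> carrier G"
      using x openin_r_coset compactin_r_coset ocsD[OF N(1)] by (auto simp: r_coset_subset_G)
    have shift: "h \<in> r <# (N #> x) \<longleftrightarrow> h \<in> carrier G \<and> h \<otimes> inv x \<in> r <# N"
      if "r \<in> R" for h r
      using that RG x ocsD(4)[OF N(1)] Nx(3)
      by (auto simp: mem_l_coset mem_r_coset m_assoc subset_iff)
    have "has_bochner_integral \<mu> (\<lambda>h. f (h \<otimes> inv x)) (\<Sum>r\<in>R. measure \<mu> (r <# (N #> x)) *\<^sub>R f r)"
    proof (rule has_bochner_integral_partition[OF R(1)])
      show "disjoint_family_on (\<lambda>r. r <# (N #> x)) R"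
        using R(3) shift unfolding disjoint_family_on_def by blast
      show "r <# (N #> x) \<in> fmeasurable \<mu>" if "r \<in> R" for r
        using RG that openin_l_coset[OF _ Nx(1)] compactin_l_coset[OF _ Nx(2)]
        by (intro openin_compactin_fmeasurable) auto
      show "f (h \<otimes> inv x) = f r" if "r \<in> R" "h \<in> r <# (N #> x)" for r h
        using that shift val by blast
      show "f (h \<otimes> inv x) = 0" if "h \<in> space \<mu>" "h \<notin> (\<Union>r\<in>R. r <# (N #> x))" for h
      proof (rule out)
        show "h \<otimes> inv x \<in> carrier G" using that(1) x space_haar by simp
        show "h \<otimes> inv x \<notin> C" using that shift R(4) space_haar by blast
      qed
    qed
    then have i2: "(LINT h|\<mu>. f (h \<otimes> inv x)) = (\<Sum>r\<in>R. measure \<mu> (N #> x) *\<^sub>R f r)"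
      unfolding has_bochner_integral_integral_eq[OF \<open>has_bochner_integral \<mu> (\<lambda>h. f (h \<otimes> inv x)) _\<close>]
      using RG Nx(3) by (intro sum.cong) (auto simp: measure_l_coset)
    have "measure \<mu> (N #> x) = ?c * measure \<mu> N"
      using measure_r_coset_ratio[OF N(1) M x] ocs_measure_pos[OF M] by (simp add: field_simps)
    then show ?thesis unfolding i1 i2 by (simp add: sum_distrib_left scaleR_conv_of_real mult.assoc)
  qed
  have pos: "?c > 0"
  proof -
    have "emeasure \<mu> (M #> x) > 0"
      using emeasure_openin[OF Mx(1)] rcos_self[OF x ocsD(1)[OF M]] by auto
    then have "measure \<mu> (M #> x) > 0"
      using openin_compactin_fmeasurable[OF Mx] by (simp add: emeasure_eq_measure2)
    then show ?thesis using ocs_measure_pos[OF M] by simp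
  qed
  have test: "test_function T (\<lambda>h. if h \<in> M then 1 else 0)"
    unfolding test_function_def
  proof
    show "\<forall>h\<in>topspace T. \<exists>U. openin T U \<and> h \<in> U \<and>
        (\<forall>y\<in>U. (if y \<in> M then 1 else 0 :: complex) = (if h \<in> M then 1 else 0))"
    proof
      fix h assume h: "h \<in> topspace T"
      show "\<exists>U. openin T U \<and> h \<in> U \<and>
        (\<forall>y\<in>U. (if y \<in> M then 1 else 0 :: complex) = (if h \<in> M then 1 else 0))"
        using h ocsD(2,8)[OF M]
        by (cases "h \<in> M") (auto intro: exI[of _ M] exI[of _ "topspace T - M"])
    qed
    have "{h\<in>topspace T. (if h \<in> M then 1 else 0 :: complex) \<noteq> 0} = M"
      using ocsD(4)[OF M] topspace_eq by auto
    then show "compactin T (T closure_of {h\<in>topspace T. (if h \<in> M then 1 else 0 :: complex) \<noteq> 0})"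
      using ocsD(3,8)[OF M] by (simp add: closure_of_closedin)
  qed
  show ?thesis
    unfolding group_modulus_def
  proof (rule the_equality)
    show "?c > 0 \<and> (\<forall>f. test_function T f \<longrightarrow>
        (LINT h|\<mu>. f (h \<otimes> inv x)) = complex_of_real ?c * (LINT h|\<mu>. f h))"
      using pos integral by blast
    fix c assume c: "c > 0 \<and> (\<forall>f. test_function T f \<longrightarrow>
        (LINT h|\<mu>. f (h \<otimes> inv x)) = complex_of_real c * (LINT h|\<mu>. f h))"
    have "has_bochner_integral \<mu> (\<lambda>h. if h \<in> M then 1 else 0 :: complex) (\<Sum>i\<in>{()}. measure \<mu> M *\<^sub>R 1)"
      by (rule has_bochner_integral_partition)
        (simp_all add: disjoint_family_on_def ocs_fmeasurable[OF M])
    from has_bochner_integral_integral_eq[OF this]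
    have "(LINT h|\<mu>. (if h \<in> M then 1 else 0 :: complex)) = measure \<mu> M"
      by (simp add: scaleR_conv_of_real)
    moreover have "complex_of_real c * (LINT h|\<mu>. (if h \<in> M then 1 else 0))
        = complex_of_real ?c * (LINT h|\<mu>. (if h \<in> M then 1 else 0))"
      unfolding integral[OF test, symmetric] using conjunct2[OF c, rule_format, OF test] by (rule sym)
    ultimately have "complex_of_real c = complex_of_real ?c" using ocs_measure_pos[OF M] by (simp add: field_simps)
    then show "c = ?c" using of_real_eq_iff by blast
  qed
qed

text \<open>The density is \<open>1\<close> on \<open>M\<close>. Since \<open>density\<close> gives a meaningful measure only for a measurable
  density, the modulus has to be shown to be locally constant on the whole group first.\<close>

lemma measure_right_haar_ocs:
  assumes M: "open_compact_subgroup G T M"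
  shows "measure (right_haar_measure G T \<mu>) M = measure \<mu> M"
proof -
  let ?m = "\<lambda>h. group_modulus G T \<mu> (inv h)"
  have inv: "?m (h \<otimes> m) = ?m h" if h: "h \<in> carrier G" and m: "m \<in> M" for h m
  proof -
    have mG: "m \<in> carrier G" "inv m \<in> M" using m ocsD(4,7)[OF M] by auto
    have "M #> inv (h \<otimes> m) = M #> inv m #> inv h"
      using h mG ocsD(4)[OF M] by (simp add: inv_mult_group coset_mult_assoc)
    also have "M #> inv m = M"
      using mG coset_join2[OF _ ocsD(1)[OF M]] by simp
    finally show ?thesis using h mG by (simp add: group_modulus_eq[OF M])
  qed
  have one: "?m m = 1" if m: "m \<in> M" for m
    using inv[OF one_closed m] m ocsD(4)[OF M] ocs_measure_pos[OF M]
    by (simp add: group_modulus_eq[OF M] subset_iff)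
  have "(\<lambda>h. ennreal (?m h)) \<in> borel_measurable \<mu>"
  proof (rule measurableI)
    fix A :: "ennreal set" assume "A \<in> sets borel"
    let ?B = "(\<lambda>h. ennreal (?m h)) -` A \<inter> space \<mu>"
    have "openin T ?B"
    proof (subst openin_subopen, intro ballI)
      fix h assume h: "h \<in> ?B"
      then have hG: "h \<in> carrier G" using space_haar by auto
      have "h <# M \<subseteq> ?B"
        using h hG inv ocsD(4)[OF M] unfolding l_coset_def space_haar by auto
      moreover have "h \<in> h <# M" using hG ocsD(4,5)[OF M] by (simp add: mem_l_coset)
      ultimately show "\<exists>U. openin T U \<and> h \<in> U \<and> U \<subseteq> ?B"
        using openin_l_coset[OF hG ocsD(2)[OF M]] by blast
    qed
    then show "?B \<in> sets \<mu>" by (rule openin_sets)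
  qed simp
  then have "emeasure (right_haar_measure G T \<mu>) M = (\<integral>\<^sup>+h. ennreal (?m h) * indicator M h \<partial>\<mu>)"
    unfolding right_haar_measure_def using ocs_fmeasurable[OF M] by (intro emeasure_density) auto
  also have "\<dots> = (\<integral>\<^sup>+h. indicator M h \<partial>\<mu>)"
    by (rule nn_integral_cong) (simp add: indicator_def one)
  also have "\<dots> = emeasure \<mu> M" using ocs_fmeasurable[OF M] by simp
  finally show ?thesis by (simp add: measure_def)
qed

end

section \<open>Closed subgroups\<close>

lemma (in locally_profinite_group) ocs_restrict:
  assumes H: "subgroup H G" "closedin T H" and M: "open_compact_subgroup G T M"
  shows "open_compact_subgroup (G\<lparr>carrier := H\<rparr>) (subtopology T H) (H \<inter> M)"
proof -
  have "subgroup (H \<inter> M) (G\<lparr>carrier := H\<rparr>)"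
    using subgroups_Inter_pair[OF H(1) ocsD(1)[OF M]] H(1)
    by (metis inf_le1 subgroup_incl)
  moreover have "openin (subtopology T H) (H \<inter> M)"
    using ocsD(2)[OF M] by (simp add: openin_subtopology_Int2)
  moreover have "compactin (subtopology T H) (H \<inter> M)"
    using closed_Int_compactin[OF H(2) ocsD(3)[OF M]] by (simp add: compactin_subtopology)
  ultimately show ?thesis unfolding open_compact_subgroup_def by blast
qed

lemma (in locally_profinite_group) closed_subgroup_locally_profinite:
  assumes H: "subgroup H G" "closedin T H"
  shows "locally_profinite_group (G\<lparr>carrier := H\<rparr>) (subtopology T H)"
proof -
  let ?H = "G\<lparr>carrier := H\<rparr>"
  have HG: "H \<subseteq> carrier G" by (rule subgroup.subset[OF H(1)])
  interpret H: group ?H by (rule subgroup.subgroup_is_group[OF H(1) is_group])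
  have top_H: "topspace (subtopology T H) = H" using HG topspace_eq by auto
  have inv_H: "inv\<^bsub>?H\<^esub> h = inv h" if "h \<in> H" for h
    by (rule m_inv_consistent[OF H(1) that])
  have mult: "continuous_map (prod_topology (subtopology T H) (subtopology T H)) (subtopology T H)
      (\<lambda>(x, y). x \<otimes> y)"
    using continuous_map_from_subtopology[OF continuous_mult, of "H \<times> H"] HG topspace_eq
      subgroup.m_closed[OF H(1)]
    by (auto simp: continuous_map_in_subtopology subtopology_Times)
  have inv: "continuous_map (subtopology T H) (subtopology T H) (\<lambda>x. inv x)"
    using continuous_map_from_subtopology[OF continuous_inv, of H] subgroup.m_inv_closed[OF H(1)]
    by (auto simp: continuous_map_in_subtopology)
  show ?thesis
  proof (unfold_locales, goal_cases)
    case 1 show ?case using top_H by simp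
  next
    case 2 show ?case using mult by simp
  next
    case 3 show ?case by (rule continuous_map_eq[OF inv]) (use top_H inv_H in auto)
  next
    case 4 show ?case by (rule Hausdorff_space_subtopology[OF Hausdorff])
  next
    case (5 U)
    then obtain U' where U': "openin T U'" "U = U' \<inter> H" unfolding openin_subtopology by blast
    have "\<one> \<in> U'" using 5(2) U'(2) by simp
    then obtain M where "open_compact_subgroup G T M" "M \<subseteq> U'" using basis_at_one[OF U'(1)] by blast
    then show ?case using ocs_restrict[OF H, of M] U'(2) by blast
  qed
qed

section \<open>The trace of an integral operator on the induced space\<close>

text \<open>A base point of the twisted space identifies it with the group. There \<open>\<psi>\<close> is the test
  function, \<open>D\<close> the operator attached to the base point and \<open>\<theta>\<close> the inverse of its
  automorphism. The subgroup \<open>L\<close> is so small that all data are invariant under it, \<open>J\<close> represents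
  the cosets of \<open>L\<close> in a compact fundamental domain, and \<open>N\<close> describes the overlap of the fundamental
  domain with its translates under \<open>H\<close>.\<close>

locale twisted_induction = haar_group G T \<mu> + Hh: haar_group "G\<lparr>carrier := H\<rparr>" "subtopology T H" \<nu>
  for G (structure) and T \<mu> H \<nu> +
  fixes \<theta> :: "'a \<Rightarrow> 'a"
    and \<omega> \<psi> :: "'a \<Rightarrow> complex"
    and s :: "complex \<Rightarrow> 'w::ab_group_add \<Rightarrow> 'w"
    and W :: "'w set"
    and \<sigma> :: "'a \<Rightarrow> 'w \<Rightarrow> 'w"
    and D :: "'w \<Rightarrow> 'w"
    and C L N :: "'a set"
    and J :: "'a set"
  assumes H: "subgroup H G" "closedin T H"
    and compact_mod: "compact_modulo G T H (carrier G)"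
    and \<theta>_closed: "\<And>g. g \<in> carrier G \<Longrightarrow> \<theta> g \<in> carrier G"
    and \<theta>_mult: "\<And>g h. \<lbrakk>g \<in> carrier G; h \<in> carrier G\<rbrakk> \<Longrightarrow> \<theta> (g \<otimes> h) = \<theta> g \<otimes> \<theta> h"
    and \<theta>_H: "\<And>h. h \<in> H \<Longrightarrow> \<theta> h \<in> H"
    and \<omega>: "group_character G T \<omega>"
    and admissible: "admissible_rep (G\<lparr>carrier := H\<rparr>) (subtopology T H) s W \<sigma>"
    and D_linear: "linear_on s W D"
    and D_closed: "\<And>w. w \<in> W \<Longrightarrow> D w \<in> W"
    and D_twist: "\<And>h w. \<lbrakk>h \<in> H; w \<in> W\<rbrakk> \<Longrightarrow> \<sigma> h (D w) = s (\<omega> (\<theta> h)) (D (\<sigma> (\<theta> h) w))"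
    and C: "compactin T C"
    and support: "\<And>x. \<lbrakk>x \<in> carrier G; \<psi> x \<noteq> 0\<rbrakk> \<Longrightarrow> x \<in> C"
    and L: "open_compact_subgroup G T L"
    and \<psi>_right: "\<And>x l. \<lbrakk>x \<in> carrier G; l \<in> L\<rbrakk> \<Longrightarrow> \<psi> (x \<otimes> l) = \<psi> x"
    and \<psi>_left: "\<And>x l. \<lbrakk>x \<in> carrier G; l \<in> L\<rbrakk> \<Longrightarrow> \<psi> (\<theta> l \<otimes> x) = \<psi> x"
    and \<omega>_L: "\<And>l. l \<in> L \<Longrightarrow> \<omega> l = 1"
    and J: "finite J" "J \<subseteq> carrier G" "disjoint_family_on (\<lambda>y. y <# L) J"
    and N: "open_compact_subgroup (G\<lparr>carrier := H\<rparr>) (subtopology T H) N"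
    and orbits: "\<And>x. x \<in> carrier G \<Longrightarrow>
      \<exists>h\<^sub>0\<in>H. {h\<in>H. inv h \<otimes> x \<in> (\<Union>y\<in>J. y <# L)} = h\<^sub>0 <# N"
begin

lemma HG: "H \<subseteq> carrier G" by (rule subgroup.subset[OF H(1)])

lemma H_simps [simp]:
  "h \<in> H \<Longrightarrow> h \<in> carrier G" "h \<in> H \<Longrightarrow> k \<in> H \<Longrightarrow> h \<otimes> k \<in> H" "h \<in> H \<Longrightarrow> inv h \<in> H"
  using HG subgroup.m_closed[OF H(1)] subgroup.m_inv_closed[OF H(1)] by auto

lemma LG: "l \<in> L \<Longrightarrow> l \<in> carrier G" using ocsD(4)[OF L] by blast

lemma smooth: "smooth_rep (G\<lparr>carrier := H\<rparr>) (subtopology T H) s W \<sigma>"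
  using admissible unfolding admissible_rep_def by (rule conjunct1)

lemma vs: "vector_space s" and subW: "module.subspace s W"
  and \<sigma>_auto: "\<And>h. h \<in> H \<Longrightarrow> linear_automorphism s W (\<sigma> h)"
  and \<sigma>_mult: "\<And>h k w. \<lbrakk>h \<in> H; k \<in> H; w \<in> W\<rbrakk> \<Longrightarrow> \<sigma> (h \<otimes> k) w = \<sigma> h (\<sigma> k w)"
  and stabilizer_open: "\<And>w. w \<in> W \<Longrightarrow> openin (subtopology T H) {h\<in>H. \<sigma> h w = w}"
  using smooth unfolding smooth_rep_def by simp_all

end

sublocale twisted_induction \<subseteq> s: vector_space s by (rule vs)

context twisted_induction
begin

lemma \<sigma>_add: "\<lbrakk>h \<in> H; v \<in> W; w \<in> W\<rbrakk> \<Longrightarrow> \<sigma> h (v + w) = \<sigma> h v + \<sigma> h w"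
  and \<sigma>_scale: "\<lbrakk>h \<in> H; v \<in> W\<rbrakk> \<Longrightarrow> \<sigma> h (s c v) = s c (\<sigma> h v)"
  and \<sigma>_closed: "\<lbrakk>h \<in> H; v \<in> W\<rbrakk> \<Longrightarrow> \<sigma> h v \<in> W"
  and \<sigma>_inj: "h \<in> H \<Longrightarrow> inj_on (\<sigma> h) W"
  using \<sigma>_auto[of h] unfolding linear_automorphism_def linear_on_def bij_betw_def by auto

lemma W_simps: "0 \<in> W" "v \<in> W \<Longrightarrow> w \<in> W \<Longrightarrow> v + w \<in> W" "w \<in> W \<Longrightarrow> s c w \<in> W"
  using s.subspace_0[OF subW] s.subspace_add[OF subW] s.subspace_scale[OF subW] by auto

lemma W_sum: "(\<And>i. i \<in> I \<Longrightarrow> f i \<in> W) \<Longrightarrow> sum f I \<in> W"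
  by (rule s.subspace_sum[OF subW])

lemma \<sigma>_zero: "h \<in> H \<Longrightarrow> \<sigma> h 0 = 0"
  using \<sigma>_scale[of h 0 0] W_simps(1) by simp

lemma D_add: "\<lbrakk>v \<in> W; w \<in> W\<rbrakk> \<Longrightarrow> D (v + w) = D v + D w"
  and D_scale: "v \<in> W \<Longrightarrow> D (s c v) = s c (D v)"
  using D_linear unfolding linear_on_def by auto

lemma D_zero: "D 0 = 0" using D_scale[OF W_simps(1), of 0] by simp

lemma \<omega>_mult: "\<lbrakk>x \<in> carrier G; y \<in> carrier G\<rbrakk> \<Longrightarrow> \<omega> (x \<otimes> y) = \<omega> x * \<omega> y"
  and \<omega>_nonzero: "x \<in> carrier G \<Longrightarrow> \<omega> x \<noteq> 0"
  using \<omega> unfolding group_character_def by auto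

lemma \<omega>_one: "\<omega> \<one> = 1"
  using \<omega>_mult[of \<one> \<one>] \<omega>_nonzero[of \<one>] by simp

lemma \<theta>_one: "\<theta> \<one> = \<one>"
  using \<theta>_mult[of \<one> \<one>] \<theta>_closed[of \<one>] by (metis l_cancel_one one_closed r_one)

lemma \<theta>_inv: "g \<in> carrier G \<Longrightarrow> \<theta> (inv g) = inv (\<theta> g)"
  using \<theta>_mult[of "inv g" g] \<theta>_one \<theta>_closed by (metis inv_equality inv_closed l_inv)

abbreviation V where "V \<equiv> ind_space G T H W \<sigma>"

text \<open>The subspace of vectors fixed by \<open>L\<close>; by admissibility it has finite dimension.\<close>

definition V\<^sub>L where "V\<^sub>L = {f\<in>V. \<forall>g\<in>carrier G. \<forall>l\<in>L. f (g \<otimes> l) = f g}"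

text \<open>The operator defined by the test function, after the substitution that moves the translation
  from \<open>f\<close> to \<open>\<psi>\<close>.\<close>

definition A where "A f = (\<lambda>g. if g \<in> carrier G
  then simple_integral s \<mu> (\<lambda>x. s (\<psi> (inv (\<theta> g) \<otimes> x) * \<omega> x) (D (f x))) else 0)"

definition kernel where "kernel g y w =
  simple_integral s \<nu> (\<lambda>h. s (\<omega> y * \<psi> (inv (\<theta> g) \<otimes> h \<otimes> y) * \<omega> h) (D (\<sigma> h w)))"

text \<open>The support condition is automatic because \<open>G\<close> is compact modulo \<open>H\<close>.\<close>

lemma V\<^sub>L_iff:
  "f \<in> V\<^sub>L \<longleftrightarrow> (\<forall>g\<in>carrier G. f g \<in> W) \<and> (\<forall>g. g \<notin> carrier G \<longrightarrow> f g = 0) \<and>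
    (\<forall>h\<in>H. \<forall>g\<in>carrier G. f (h \<otimes> g) = \<sigma> h (f g)) \<and> (\<forall>g\<in>carrier G. \<forall>l\<in>L. f (g \<otimes> l) = f g)"
  (is "_ \<longleftrightarrow> ?R")
proof
  show "f \<in> V\<^sub>L \<Longrightarrow> ?R" unfolding V\<^sub>L_def ind_space_def by simp
  assume R: ?R
  then have W: "f g \<in> W" and cov: "h \<in> H \<Longrightarrow> f (h \<otimes> g) = \<sigma> h (f g)"
    and inv: "l \<in> L \<Longrightarrow> f (g \<otimes> l) = f g" if "g \<in> carrier G" for g h l
    using that by auto
  obtain B where B: "compactin T B" "carrier G = H <#> B"
    using compact_mod unfolding compact_modulo_def by blast
  note BG = compactin_carrier[OF B(1)]
  define Z where "Z = {g\<in>carrier G. f g \<noteq> 0}"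
  have "openin T (carrier G - Z)"
  proof (subst openin_subopen, intro ballI)
    fix g assume "g \<in> carrier G - Z"
    then have g: "g \<in> carrier G" "f g = 0" by (auto simp: Z_def)
    have "g <# L \<subseteq> carrier G - Z"
      using g inv LG unfolding l_coset_def Z_def by auto
    moreover have "g \<in> g <# L" using g ocsD(4,5)[OF L] by (simp add: mem_l_coset)
    ultimately show "\<exists>U. openin T U \<and> g \<in> U \<and> U \<subseteq> carrier G - Z"
      using openin_l_coset[OF g(1) ocsD(2)[OF L]] by blast
  qed
  moreover have "Z \<subseteq> carrier G" by (auto simp: Z_def)
  ultimately have "closedin T Z" unfolding closedin_def topspace_eq by simp
  then have "compactin T (Z \<inter> B)" using B(1) by (rule closed_Int_compactin)
  moreover have "Z = H <#> (Z \<inter> B)"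
  proof (intro equalityI subsetI)
    fix g assume g: "g \<in> Z"
    then obtain h b where hb: "h \<in> H" "b \<in> B" "g = h \<otimes> b"
      using B(2) unfolding Z_def set_mult_def by auto
    have bG: "b \<in> carrier G" using hb BG by auto
    have "f b \<noteq> 0" using g hb cov[OF bG hb(1)] \<sigma>_zero[OF hb(1)] unfolding Z_def by auto
    then show "g \<in> H <#> (Z \<inter> B)" using hb bG unfolding Z_def set_mult_def by auto
  next
    fix g assume "g \<in> H <#> (Z \<inter> B)"
    then obtain h b where hb: "h \<in> H" "b \<in> B" "f b \<noteq> 0" "b \<in> carrier G" "g = h \<otimes> b"
      unfolding Z_def set_mult_def by auto
    have "\<sigma> h (f b) \<noteq> 0"
      using hb(3) inj_onD[OF \<sigma>_inj[OF hb(1)], of "f b" 0] \<sigma>_zero[OF hb(1)] W[OF hb(4)] W_simps(1)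
      by auto
    then show "g \<in> Z" using hb cov unfolding Z_def by auto
  qed
  ultimately have "compact_modulo G T H {g\<in>carrier G. f g \<noteq> 0}"
    unfolding compact_modulo_def Z_def by blast
  then show "f \<in> V\<^sub>L" using R L unfolding V\<^sub>L_def ind_space_def by blast
qed

lemma kernel_step:
  assumes g: "g \<in> carrier G" and y: "y \<in> carrier G" and w: "w \<in> W"
  shows "Hh.step_function (\<lambda>h. s (\<omega> y * \<psi> (inv (\<theta> g) \<otimes> h \<otimes> y) * \<omega> h) (D (\<sigma> h w)))"
    (is "Hh.step_function ?F")
proof -
  have "\<one> \<in> {h\<in>H. \<sigma> h w = w}"
  proof -
    have "\<one> \<in> H" using subgroup.one_closed[OF H(1)] .
    moreover have "\<sigma> \<one> (\<sigma> \<one> w) = \<sigma> \<one> w" using \<sigma>_mult[of \<one> \<one> w] calculation w by simp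
    ultimately show ?thesis
      using inj_onD[OF \<sigma>_inj, of \<one> "\<sigma> \<one> w" w] \<sigma>_closed w by auto
  qed
  then obtain M where M: "open_compact_subgroup (G\<lparr>carrier := H\<rparr>) (subtopology T H) M"
      "M \<subseteq> {h\<in>H. \<sigma> h w = w}"
    using Hh.basis_at_one[OF stabilizer_open[OF w]] by auto
  define M' where "M' = M \<inter> (H \<inter> (\<lambda>x. y \<otimes> x \<otimes> inv y) ` L)"
  have M': "open_compact_subgroup (G\<lparr>carrier := H\<rparr>) (subtopology T H) M'"
    unfolding M'_def by (intro Hh.ocs_Int M(1) ocs_restrict H ocs_conjugate L y)
  let ?a = "inv (\<theta> g)"
  have a: "?a \<in> carrier G" "\<theta> g \<in> carrier G" using g \<theta>_closed by auto
  define C' where "C' = H \<inter> (\<lambda>x. \<theta> g \<otimes> x \<otimes> inv y) ` C"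
  have "compactin T ((\<lambda>x. \<theta> g \<otimes> x \<otimes> inv y) ` C)"
    by (rule compactin_translation[OF a(2) inv_closed[OF y] C])
  then have C': "compactin (subtopology T H) C'"
    unfolding C'_def using closed_Int_compactin[OF H(2)] by (simp add: compactin_subtopology)
  show ?thesis
  proof (rule Hh.step_functionI[OF M' C'])
    fix h m assume "h \<in> carrier (G\<lparr>carrier := H\<rparr>)" "m \<in> M'"
    then obtain l where hm: "h \<in> H" "m \<in> H" "\<sigma> m w = w" "l \<in> L" "m = y \<otimes> l \<otimes> inv y"
      using M(2) unfolding M'_def by auto
    note G = y a LG[OF hm(4)] H_simps(1)[OF hm(1)] H_simps(1)[OF hm(2)]
    have "m \<otimes> y = y \<otimes> l" unfolding hm(5) using G by (simp add: m_assoc)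
    then have "?a \<otimes> (h \<otimes> m) \<otimes> y = (?a \<otimes> h \<otimes> y) \<otimes> l" using G by (simp add: m_assoc)
    then have 1: "\<psi> (?a \<otimes> (h \<otimes> m) \<otimes> y) = \<psi> (?a \<otimes> h \<otimes> y)"
      using \<psi>_right[OF _ hm(4)] G by simp
    have "\<omega> m = \<omega> y * \<omega> l * \<omega> (inv y)" unfolding hm(5) using G by (simp add: \<omega>_mult)
    also have "\<dots> = \<omega> (y \<otimes> inv y)" using \<omega>_L[OF hm(4)] G by (subst \<omega>_mult) auto
    finally have "\<omega> m = 1" using G \<omega>_one by simp
    then have 2: "\<omega> (h \<otimes> m) = \<omega> h" using \<omega>_mult G by simp
    have 3: "\<sigma> (h \<otimes> m) w = \<sigma> h w" using \<sigma>_mult[OF hm(1,2) w] hm(3) by simp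
    show "?F (h \<otimes>\<^bsub>G\<lparr>carrier := H\<rparr>\<^esub> m) = ?F h" using 1 2 3 by simp
  next
    fix h assume h: "h \<in> carrier (G\<lparr>carrier := H\<rparr>)" "?F h \<noteq> 0"
    have hG: "h \<in> carrier G" "h \<in> H" using h(1) by auto
    have "\<psi> (?a \<otimes> h \<otimes> y) \<noteq> 0"
    proof
      assume "\<psi> (?a \<otimes> h \<otimes> y) = 0"
      then have "?F h = 0" by simp
      then show False using h(2) by contradiction
    qed
    then have "?a \<otimes> h \<otimes> y \<in> C" using support a y hG by simp
    moreover have "\<theta> g \<otimes> (?a \<otimes> h \<otimes> y) \<otimes> inv y = h"
    proof -
      have "\<theta> g \<otimes> (?a \<otimes> h \<otimes> y) = h \<otimes> y" using a y hG by (simp add: m_assoc[symmetric])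
      then show ?thesis using y hG by (simp add: m_assoc)
    qed
    ultimately show "h \<in> C'" using hG unfolding C'_def by (metis IntI imageI)
  qed
qed

lemma kernel_integrand_closed:
  "\<lbrakk>w \<in> W; h \<in> H\<rbrakk> \<Longrightarrow> s c (D (\<sigma> h w)) \<in> W"
  by (intro W_simps D_closed \<sigma>_closed)

lemma kernel_closed:
  assumes "g \<in> carrier G" "y \<in> carrier G" "w \<in> W"
  shows "kernel g y w \<in> W"
  unfolding kernel_def
  by (rule Hh.simple_integral_linear(2)[OF vs vs subW kernel_step[OF assms], where \<Phi> = "\<lambda>v. v"])
    (use assms kernel_integrand_closed in auto)

lemma kernel_sum:
  assumes g: "g \<in> carrier G" and y: "y \<in> carrier G" and B: "finite B" "B \<subseteq> W"
  shows "kernel g y (\<Sum>b\<in>B. s (a b) b) = (\<Sum>b\<in>B. s (a b) (kernel g y b))"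
proof -
  let ?q = "\<lambda>h. \<omega> y * \<psi> (inv (\<theta> g) \<otimes> h \<otimes> y) * \<omega> h"
  have scaled: "D (\<sigma> h (s c b)) = s c (D (\<sigma> h b))" if "h \<in> H" "b \<in> W" for h b c
    using that by (simp add: \<sigma>_scale D_scale \<sigma>_closed)
  have eq: "D (\<sigma> h (\<Sum>b\<in>B. s (a b) b)) = (\<Sum>b\<in>B. s (a b) (D (\<sigma> h b)))" if h: "h \<in> H" for h
    using B
  proof (induction B rule: finite_induct)
    case empty
    then show ?case using h by (simp add: \<sigma>_zero D_zero)
  next
    case (insert b B)
    have "(\<Sum>b\<in>B. s (a b) b) \<in> W" using insert.prems by (intro W_sum W_simps) auto
    then show ?case
      using insert h by (simp add: \<sigma>_add D_add \<sigma>_closed W_simps scaled)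
  qed
  have step: "Hh.step_function (\<lambda>h. s (?q h) (D (\<sigma> h (s (a b) b))))" if "b \<in> B" for b
    using that B(2) by (intro kernel_step[OF g y] W_simps) auto
  have "kernel g y (\<Sum>b\<in>B. s (a b) b) =
      simple_integral s \<nu> (\<lambda>h. \<Sum>b\<in>B. s (?q h) (D (\<sigma> h (s (a b) b))))"
    unfolding kernel_def
  proof (rule simple_integral_cong)
    fix h assume "h \<in> space \<nu>"
    then have h: "h \<in> H" using Hh.space_haar by simp
    show "s (?q h) (D (\<sigma> h (\<Sum>b\<in>B. s (a b) b))) = (\<Sum>b\<in>B. s (?q h) (D (\<sigma> h (s (a b) b))))"
      unfolding eq[OF h] s.scale_sum_right using h B(2) by (intro sum.cong) (auto simp: scaled)
  qed
  also have "\<dots> = (\<Sum>b\<in>B. kernel g y (s (a b) b))"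
    unfolding kernel_def by (rule Hh.simple_integral_sum[OF vs B(1)]) (use step in blast)
  also have "\<dots> = (\<Sum>b\<in>B. s (a b) (kernel g y b))"
  proof (rule sum.cong[OF refl])
    fix b assume "b \<in> B"
    then have b: "b \<in> W" using B by auto
    have "kernel g y (s (a b) b) = simple_integral s \<nu> (\<lambda>h. s (a b) (s (?q h) (D (\<sigma> h b))))"
      unfolding kernel_def
      by (rule simple_integral_cong) (use b Hh.space_haar in \<open>simp add: scaled mult.commute\<close>)
    also have "\<dots> = s (a b) (kernel g y b)"
      unfolding kernel_def
      by (rule Hh.simple_integral_linear(1)[OF vs vs subW kernel_step[OF g y b]])
        (use b kernel_integrand_closed in \<open>auto simp: s.scale_right_distrib mult.commute\<close>)
    finally show "kernel g y (s (a b) b) = s (a b) (kernel g y b)" .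
  qed
  finally show ?thesis .
qed

text \<open>Substitution of \<open>\<theta> h \<otimes> k\<close> for the variable \<open>k\<close> cancels \<open>h\<close> in the argument of \<open>\<psi>\<close>; the
  twisting relation of \<open>D\<close> then moves \<open>\<sigma> (\<theta> h)\<close> out of the integral as \<open>\<sigma> h\<close>.\<close>

lemma kernel_covariant:
  assumes h: "h \<in> H" and g: "g \<in> carrier G" and y: "y \<in> carrier G" and w: "w \<in> W"
  shows "kernel (h \<otimes> g) y w = \<sigma> h (kernel g y w)"
proof -
  let ?q = "\<lambda>k. \<omega> y * \<psi> (inv (\<theta> g) \<otimes> k \<otimes> y) * \<omega> k"
  let ?F = "\<lambda>k. s (\<omega> y * \<psi> (inv (\<theta> (h \<otimes> g)) \<otimes> k \<otimes> y) * \<omega> k) (D (\<sigma> k w))"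
  have t: "\<theta> h \<in> H" "\<theta> h \<in> carrier G" "\<theta> g \<in> carrier G" using h g \<theta>_H \<theta>_closed by auto
  have "kernel (h \<otimes> g) y w = simple_integral s \<nu> (\<lambda>k. ?F (\<theta> h \<otimes> k))"
    unfolding kernel_def using Hh.simple_integral_translate[of "\<theta> h" s ?F] t(1) by simp
  also have "\<dots> = simple_integral s \<nu> (\<lambda>k. \<sigma> h (s (?q k) (D (\<sigma> k w))))"
  proof (rule simple_integral_cong)
    fix k assume "k \<in> space \<nu>"
    then have k: "k \<in> H" using Hh.space_haar by simp
    have "inv (\<theta> h) \<otimes> (\<theta> h \<otimes> k) = k" using t k by (simp add: m_assoc[symmetric])
    then have 1: "inv (\<theta> (h \<otimes> g)) \<otimes> (\<theta> h \<otimes> k) = inv (\<theta> g) \<otimes> k"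
      using h g t k by (simp add: \<theta>_mult inv_mult_group m_assoc)
    have "D (\<sigma> (\<theta> h \<otimes> k) w) = D (\<sigma> (\<theta> h) (\<sigma> k w))" using \<sigma>_mult[OF t(1) k w] by simp
    moreover have "\<omega> (\<theta> h \<otimes> k) = \<omega> (\<theta> h) * \<omega> k" using t k by (simp add: \<omega>_mult)
    ultimately have "?F (\<theta> h \<otimes> k) = s (?q k) (s (\<omega> (\<theta> h)) (D (\<sigma> (\<theta> h) (\<sigma> k w))))"
      unfolding 1 by (simp add: mult_ac)
    also have "\<dots> = s (?q k) (\<sigma> h (D (\<sigma> k w)))" using D_twist[OF h \<sigma>_closed[OF k w]] by simp
    also have "\<dots> = \<sigma> h (s (?q k) (D (\<sigma> k w)))"
      using h k w by (simp add: \<sigma>_scale D_closed \<sigma>_closed)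
    finally show "?F (\<theta> h \<otimes> k) = \<sigma> h (s (?q k) (D (\<sigma> k w)))" .
  qed
  also have "\<dots> = \<sigma> h (kernel g y w)"
    unfolding kernel_def
    by (rule Hh.simple_integral_linear(1)[OF vs vs subW kernel_step[OF g y w]])
      (use h w kernel_integrand_closed \<sigma>_add \<sigma>_scale in auto)
  finally show ?thesis .
qed

lemma kernel_invariant:
  assumes l: "l \<in> L" and g: "g \<in> carrier G" and y: "y \<in> carrier G"
  shows "kernel (g \<otimes> l) y w = kernel g y w"
  unfolding kernel_def
proof (rule simple_integral_cong)
  fix h assume "h \<in> space \<nu>"
  then have h: "h \<in> carrier G" using Hh.space_haar by simp
  have l': "inv l \<in> L" using ocsD(7)[OF L l] .
  have "inv (\<theta> (g \<otimes> l)) \<otimes> h \<otimes> y = \<theta> (inv l) \<otimes> (inv (\<theta> g) \<otimes> h \<otimes> y)"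
    using g h y LG[OF l] \<theta>_closed by (simp add: \<theta>_mult \<theta>_inv inv_mult_group m_assoc)
  then have "\<psi> (inv (\<theta> (g \<otimes> l)) \<otimes> h \<otimes> y) = \<psi> (inv (\<theta> g) \<otimes> h \<otimes> y)"
    using \<psi>_left[OF _ l'] g h y \<theta>_closed by simp
  then show "s (\<omega> y * \<psi> (inv (\<theta> (g \<otimes> l)) \<otimes> h \<otimes> y) * \<omega> h) (D (\<sigma> h w)) =
      s (\<omega> y * \<psi> (inv (\<theta> g) \<otimes> h \<otimes> y) * \<omega> h) (D (\<sigma> h w))" by simp
qed


text \<open>The projection of the induced space onto the vectors fixed by \<open>L\<close>.\<close>

definition average where "average f = (\<lambda>g. if g \<in> carrier G
  then s (inverse (complex_of_real (measure \<mu> L)))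
    (simple_integral s \<mu> (\<lambda>x. if x \<in> g <# L then f x else 0)) else 0)"

lemma L_cancel:
  assumes "a \<in> carrier G" "l \<in> L"
  shows "a \<otimes> l \<in> L \<longleftrightarrow> a \<in> L"
proof
  assume "a \<otimes> l \<in> L"
  then have "(a \<otimes> l) \<otimes> inv l \<in> L" using assms(2) ocsD(6,7)[OF L] by blast
  then show "a \<in> L" using assms LG by (simp add: m_assoc)
qed (use assms(2) ocsD(6)[OF L] in blast)

lemma L_coset_right:
  assumes "g \<in> carrier G" "x \<in> carrier G" "l \<in> L"
  shows "x \<otimes> l \<in> g <# L \<longleftrightarrow> x \<in> g <# L"
  using L_cancel[of "inv g \<otimes> x" l] assms LG ocsD(4)[OF L] by (simp add: mem_l_coset m_assoc)

lemma coset_restriction_step: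
  assumes f: "f \<in> V" and g: "g \<in> carrier G"
  shows "step_function (\<lambda>x. if x \<in> g <# L then f x else 0)"
proof -
  obtain M where M: "open_compact_subgroup G T M" "\<forall>x\<in>carrier G. \<forall>m\<in>M. f (x \<otimes> m) = f x"
    using f unfolding ind_space_def by blast
  show ?thesis
  proof (rule step_functionI[OF ocs_Int[OF M(1) L] compactin_l_coset[OF g ocsD(3)[OF L]]])
    fix x m assume x: "x \<in> carrier G" and m: "m \<in> M \<inter> L"
    then show "(if x \<otimes> m \<in> g <# L then f (x \<otimes> m) else 0) = (if x \<in> g <# L then f x else 0)"
      using L_coset_right[OF g x] M(2) by auto
  qed (simp split: if_splits)
qed

lemma V_closed: "f \<in> V \<Longrightarrow> g \<in> carrier G \<Longrightarrow> f g \<in> W"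
  and V_covariant: "f \<in> V \<Longrightarrow> h \<in> H \<Longrightarrow> g \<in> carrier G \<Longrightarrow> f (h \<otimes> g) = \<sigma> h (f g)"
  unfolding ind_space_def by auto

lemma average_in_V\<^sub>L:
  assumes f: "f \<in> V"
  shows "average f \<in> V\<^sub>L"
proof -
  let ?F = "\<lambda>g x. if x \<in> g <# L then f x else 0"
  have FW: "?F g x \<in> W" if "x \<in> carrier G" for g x
    using V_closed[OF f that] W_simps(1) by simp
  have int: "simple_integral s \<mu> (?F g) \<in> W" if g: "g \<in> carrier G" for g
    by (rule simple_integral_linear(2)[OF vs vs subW coset_restriction_step[OF f g], where \<Phi> = "\<lambda>v. v"])
      (use FW in auto)
  have cov: "simple_integral s \<mu> (?F (h \<otimes> g)) = \<sigma> h (simple_integral s \<mu> (?F g))"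
    if h: "h \<in> H" and g: "g \<in> carrier G" for h g
  proof -
    have hG: "h \<in> carrier G" using h by simp
    have "simple_integral s \<mu> (?F (h \<otimes> g)) = simple_integral s \<mu> (\<lambda>x. ?F (h \<otimes> g) (h \<otimes> x))"
      by (rule simple_integral_translate[OF hG, symmetric])
    also have "\<dots> = simple_integral s \<mu> (\<lambda>x. \<sigma> h (?F g x))"
    proof (rule simple_integral_cong)
      fix x assume "x \<in> space \<mu>"
      then have x: "x \<in> carrier G" using space_haar by simp
      have "inv (h \<otimes> g) \<otimes> (h \<otimes> x) = inv g \<otimes> (inv h \<otimes> (h \<otimes> x))"
        using hG g x by (simp add: inv_mult_group m_assoc)
      also have "inv h \<otimes> (h \<otimes> x) = x" using hG x by (simp add: m_assoc[symmetric])
      finally have "h \<otimes> x \<in> (h \<otimes> g) <# L \<longleftrightarrow> x \<in> g <# L"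
        using hG g x ocsD(4)[OF L] by (simp add: mem_l_coset)
      then show "?F (h \<otimes> g) (h \<otimes> x) = \<sigma> h (?F g x)"
        using V_covariant[OF f h x] \<sigma>_zero[OF h] by simp
    qed
    also have "\<dots> = \<sigma> h (simple_integral s \<mu> (?F g))"
      by (rule simple_integral_linear(1)[OF vs vs subW coset_restriction_step[OF f g]])
        (use FW \<sigma>_add[OF h] \<sigma>_scale[OF h] in auto)
    finally show ?thesis .
  qed
  have inv: "(g \<otimes> l) <# L = g <# L" if "g \<in> carrier G" "l \<in> L" for g l
    using l_repr_independence[OF _ that(1) ocsD(1)[OF L], of "g \<otimes> l"] that
    unfolding l_coset_def by auto
  show ?thesis
    unfolding V\<^sub>L_iff average_def using int cov inv LG by (simp add: W_simps \<sigma>_scale)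
qed

definition weight where "weight g x = \<psi> (inv (\<theta> g) \<otimes> x) * \<omega> x"

lemma weight_right:
  assumes "g \<in> carrier G" "x \<in> carrier G" "l \<in> L"
  shows "weight g (x \<otimes> l) = weight g x"
proof -
  have "\<psi> (inv (\<theta> g) \<otimes> (x \<otimes> l)) = \<psi> (inv (\<theta> g) \<otimes> x)"
    using \<psi>_right[of "inv (\<theta> g) \<otimes> x" l] assms \<theta>_closed LG by (simp add: m_assoc)
  then show ?thesis unfolding weight_def using \<omega>_mult[OF assms(2) LG] \<omega>_L assms(3) by simp
qed

lemma weight_cosets:
  assumes g: "g \<in> carrier G"
  obtains R where "finite R" "R \<subseteq> carrier G" "disjoint_family_on (\<lambda>r. r <# L) R"
    "\<forall>x\<in>carrier G. x \<notin> (\<Union>r\<in>R. r <# L) \<longrightarrow> weight g x = 0"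
proof -
  have t: "\<theta> g \<in> carrier G" using \<theta>_closed[OF g] .
  have C': "compactin T (\<theta> g <# C)" by (rule compactin_l_coset[OF t C])
  obtain R where R: "finite R" "R \<subseteq> \<theta> g <# C" "disjoint_family_on (\<lambda>r. r <# L) R"
      "\<theta> g <# C \<subseteq> (\<Union>r\<in>R. r <# L)"
    using coset_transversal[OF L C'] by blast
  have "x \<in> \<theta> g <# C" if x: "x \<in> carrier G" "weight g x \<noteq> 0" for x
  proof -
    have "inv (\<theta> g) \<otimes> x \<in> C"
      using support[of "inv (\<theta> g) \<otimes> x"] x t unfolding weight_def by auto
    then show ?thesis using x(1) t compactin_carrier[OF C] by (simp add: mem_l_coset)
  qed
  then have "\<forall>x\<in>carrier G. x \<notin> (\<Union>r\<in>R. r <# L) \<longrightarrow> weight g x = 0"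
    using R(4) by blast
  then show ?thesis
    using that[OF R(1) order_trans[OF R(2) compactin_carrier[OF C']] R(3)] by blast
qed

lemma A_weight:
  "g \<in> carrier G \<Longrightarrow> A f g = simple_integral s \<mu> (\<lambda>x. s (weight g x) (D (f x)))"
  unfolding A_def weight_def by simp

text \<open>The weight of \<open>A\<close> is constant on the cosets of \<open>L\<close>, so \<open>A\<close> depends only on the integrals of
  \<open>f\<close> over these cosets. This reduces the trace to \<open>V\<^sub>L\<close>.\<close>

lemma A_average:
  assumes f: "f \<in> V"
  shows "A (average f) = A f"
proof (rule ext)
  fix g
  show "A (average f) g = A f g"
  proof (cases "g \<in> carrier G")
    case g: True
    obtain R where R: "finite R" "R \<subseteq> carrier G" "disjoint_family_on (\<lambda>r. r <# L) R"
        "\<forall>x\<in>carrier G. x \<notin> (\<Union>r\<in>R. r <# L) \<longrightarrow> weight g x = 0"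
      using weight_cosets[OF g] by blast
    let ?v = "complex_of_real (measure \<mu> L)"
    let ?F = "\<lambda>r x. if x \<in> r <# L then f x else 0"
    have v: "?v \<noteq> 0" using ocs_measure_pos[OF L] by simp
    have av: "average f \<in> V" "\<forall>x\<in>carrier G. \<forall>l\<in>L. average f (x \<otimes> l) = average f x"
      using average_in_V\<^sub>L[OF f] unfolding V\<^sub>L_def by auto
    have FW: "?F r x \<in> W" if "x \<in> carrier G" for r x
      using V_closed[OF f that] W_simps(1) by simp
    have rW: "simple_integral s \<mu> (?F r) \<in> W" if "r \<in> R" for r
      by (rule simple_integral_linear(2)[OF vs vs subW coset_restriction_step[OF f], where \<Phi> = "\<lambda>v. v"])
        (use FW R(2) that in auto)
    have "A (average f) g = (\<Sum>r\<in>R. s ?v (s (weight g r) (D (average f r))))"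
      unfolding A_weight[OF g]
    proof (rule simple_integral_cosets[OF vs L R(1-3)])
      show "s (weight g (r \<otimes> m)) (D (average f (r \<otimes> m))) = s (weight g r) (D (average f r))"
        if "r \<in> R" "m \<in> L" for r m
      proof -
        have "r \<in> carrier G" using that R(2) by auto
        then show ?thesis using av(2) that weight_right[OF g] by simp
      qed
      show "s (weight g x) (D (average f x)) = 0" if "x \<in> carrier G" "x \<notin> (\<Union>r\<in>R. r <# L)" for x
        using R(4) that by simp
    qed
    also have "\<dots> = (\<Sum>r\<in>R. s (weight g r) (D (simple_integral s \<mu> (?F r))))"
    proof (rule sum.cong[OF refl])
      fix r assume r: "r \<in> R"
      then have "D (average f r) = s (inverse ?v) (D (simple_integral s \<mu> (?F r)))"
        using R(2) rW[OF r] unfolding average_def by (auto simp: D_scale)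
      then show "s ?v (s (weight g r) (D (average f r))) = s (weight g r) (D (simple_integral s \<mu> (?F r)))"
        using v by (simp add: field_simps)
    qed
    also have "\<dots> = (\<Sum>r\<in>R. simple_integral s \<mu> (\<lambda>x. s (weight g r) (D (?F r x))))"
    proof (rule sum.cong[OF refl])
      fix r assume r: "r \<in> R"
      then have rG: "r \<in> carrier G" using R(2) by auto
      show "s (weight g r) (D (simple_integral s \<mu> (?F r))) =
          simple_integral s \<mu> (\<lambda>x. s (weight g r) (D (?F r x)))"
        by (rule simple_integral_linear(1)[OF vs vs subW coset_restriction_step[OF f rG], symmetric])
          (use FW in \<open>auto simp: D_add D_scale s.scale_right_distrib mult.commute\<close>)
    qed
    also have "\<dots> = simple_integral s \<mu> (\<lambda>x. \<Sum>r\<in>R. s (weight g r) (D (?F r x)))"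
    proof (rule simple_integral_sum[OF vs R(1), symmetric], intro ballI)
      fix r assume r: "r \<in> R"
      then have "step_function (?F r)" using R(2) coset_restriction_step[OF f] by blast
      then obtain M B where MB: "open_compact_subgroup G T M" "compactin T B"
          "\<forall>x\<in>carrier G. \<forall>m\<in>M. ?F r (x \<otimes> m) = ?F r x" "\<forall>x\<in>carrier G. ?F r x \<noteq> 0 \<longrightarrow> x \<in> B"
        unfolding step_function_def by blast
      show "step_function (\<lambda>x. s (weight g r) (D (?F r x)))"
      proof (rule step_functionI[OF MB(1,2)])
        show "s (weight g r) (D (?F r (x \<otimes> m))) = s (weight g r) (D (?F r x))"
          if "x \<in> carrier G" "m \<in> M" for x m
          unfolding MB(3)[rule_format, OF that] ..
        fix x assume x: "x \<in> carrier G" "s (weight g r) (D (?F r x)) \<noteq> 0"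
        have "?F r x \<noteq> 0"
        proof
          assume "?F r x = 0"
          then have "s (weight g r) (D (?F r x)) = 0" by (simp only: D_zero s.scale_zero_right)
          then show False using x(2) by contradiction
        qed
        then show "x \<in> B" using MB(4) x(1) by blast
      qed
    qed
    also have "\<dots> = A f g"
      unfolding A_weight[OF g]
    proof (rule simple_integral_cong)
      fix x assume "x \<in> space \<mu>"
      then have x: "x \<in> carrier G" using space_haar by simp
      show "(\<Sum>r\<in>R. s (weight g r) (D (?F r x))) = s (weight g x) (D (f x))"
      proof (cases "x \<in> (\<Union>r\<in>R. r <# L)")
        case True
        then obtain p where p: "p \<in> R" "x \<in> p <# L" by blast
        have "s (weight g r) (D (?F r x)) = (if r = p then s (weight g p) (D (f x)) else 0)"
          if "r \<in> R" for r
        proof (cases "r = p")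
          case False
          then have "x \<notin> r <# L"
            using R(3) p that unfolding disjoint_family_on_def by blast
          then show ?thesis using False by (simp add: D_zero)
        qed (use p in simp)
        then have "(\<Sum>r\<in>R. s (weight g r) (D (?F r x))) =
            (\<Sum>r\<in>R. if r = p then s (weight g p) (D (f x)) else 0)"
          by (rule sum.cong[OF refl])
        also have "\<dots> = s (weight g p) (D (f x))" using R(1) p(1) by simp
        also have "weight g p = weight g x"
        proof -
          have "p \<in> carrier G" using p(1) R(2) by blast
          then show ?thesis
            using p(2) weight_right[OF g] unfolding l_coset_def by auto
        qed
        finally show ?thesis .
      next
        case False
        then have "(\<Sum>r\<in>R. s (weight g r) (D (?F r x))) = 0"
          by (intro sum.neutral) (auto simp: D_zero)
        then show ?thesis using False R(4) x by simp
      qed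
    qed
    finally show ?thesis .
  qed (simp add: A_def)
qed

text \<open>For \<open>x\<close> in \<open>G\<close>, the \<open>h\<close> in \<open>H\<close> with \<open>inv h \<otimes> x\<close> in the fundamental domain form a left coset
  of \<open>N\<close>, and \<open>h \<otimes> y\<close> lies in \<open>x <# L\<close> exactly when \<open>inv h \<otimes> x\<close> lies in \<open>y <# L\<close>. Only left
  invariance enters, so no modulus appears.\<close>

lemma orbit_volume:
  assumes r: "r \<in> carrier G"
  shows "(\<Sum>y\<in>J. measure \<nu> {h\<in>H. h \<otimes> y \<in> r <# L}) = measure \<nu> N"
    and "\<And>y. y \<in> carrier G \<Longrightarrow> {h\<in>H. h \<otimes> y \<in> r <# L} \<in> fmeasurable \<nu>"
proof -
  show fm: "{h\<in>H. h \<otimes> y \<in> r <# L} \<in> fmeasurable \<nu>" if y: "y \<in> carrier G" for y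
  proof -
    let ?E = "(r <# L) #> inv y"
    have rL: "r <# L \<subseteq> carrier G" using r ocsD(4)[OF L] by (rule l_coset_subset_G[rotated])
    have eq: "{h\<in>H. h \<otimes> y \<in> r <# L} = H \<inter> ?E"
      using y rL by (auto simp: mem_r_coset)
    have "openin T ?E" "compactin T ?E"
      using r y openin_r_coset openin_l_coset compactin_r_coset compactin_l_coset ocsD(2,3)[OF L]
      by auto
    then have "openin (subtopology T H) (H \<inter> ?E)" "compactin (subtopology T H) (H \<inter> ?E)"
      using closed_Int_compactin[OF H(2)] by (auto simp: openin_subtopology_Int2 compactin_subtopology)
    then show ?thesis unfolding eq by (rule Hh.openin_compactin_fmeasurable)
  qed
  have swap: "{h\<in>H. h \<otimes> y \<in> r <# L} = {h\<in>H. inv h \<otimes> r \<in> y <# L}" if "y \<in> J" for y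
  proof -
    have y: "y \<in> carrier G" using that J(2) by auto
    have "inv r \<otimes> (h \<otimes> y) \<in> L \<longleftrightarrow> inv y \<otimes> (inv h \<otimes> r) \<in> L" if "h \<in> H" for h
    proof -
      have "inv (inv r \<otimes> (h \<otimes> y)) = inv y \<otimes> (inv h \<otimes> r)"
        using r y that by (simp add: inv_mult_group m_assoc)
      then show ?thesis
        using ocsD(7)[OF L] r y that by (metis H_simps(1) inv_closed inv_inv m_closed)
    qed
    then show ?thesis using r y ocsD(4)[OF L] by (auto simp: mem_l_coset)
  qed
  obtain h\<^sub>0 where h0: "h\<^sub>0 \<in> H" "{h\<in>H. inv h \<otimes> r \<in> (\<Union>y\<in>J. y <# L)} = h\<^sub>0 <# N"
    using orbits[OF r] by blast
  have "(\<Sum>y\<in>J. measure \<nu> {h\<in>H. h \<otimes> y \<in> r <# L}) = measure \<nu> (\<Union>y\<in>J. {h\<in>H. h \<otimes> y \<in> r <# L})"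
  proof (rule measure_finite_Union[symmetric, OF J(1)])
    show "disjoint_family_on (\<lambda>y. {h \<in> H. h \<otimes> y \<in> r <# L}) J"
      using J(3) swap unfolding disjoint_family_on_def by fastforce
    show "(\<lambda>y. {h \<in> H. h \<otimes> y \<in> r <# L}) ` J \<subseteq> sets \<nu>" using fm J(2) by blast
    show "emeasure \<nu> {h \<in> H. h \<otimes> y \<in> r <# L} \<noteq> \<infinity>" if "y \<in> J" for y
      using fm[of y] J(2) that by (auto simp: fmeasurable_def)
  qed
  also have "(\<Union>y\<in>J. {h\<in>H. h \<otimes> y \<in> r <# L}) = {h\<in>H. inv h \<otimes> r \<in> (\<Union>y\<in>J. y <# L)}"
    using swap by auto
  also have "measure \<nu> \<dots> = measure \<nu> N"
    unfolding h0(2) using Hh.measure_l_coset[of h\<^sub>0 N] h0(1) Hh.ocsD(4)[OF N] by simp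
  finally show "(\<Sum>y\<in>J. measure \<nu> {h\<in>H. h \<otimes> y \<in> r <# L}) = measure \<nu> N" .
qed

definition \<kappa> where "\<kappa> = complex_of_real (measure \<mu> L / measure \<nu> N)"

text \<open>An integral over \<open>G\<close> is unfolded to one over \<open>H\<close> and the fundamental domain: each coset
  \<open>r <# L\<close> is counted with total weight \<open>measure \<nu> N\<close> by \<open>orbit_volume\<close>.\<close>

lemma A_kernel:
  assumes f: "f \<in> V\<^sub>L" and g: "g \<in> carrier G"
  shows "A f g = (\<Sum>y\<in>J. s \<kappa> (kernel g y (f y)))"
proof -
  have fL: "f (x \<otimes> l) = f x" if "x \<in> carrier G" "l \<in> L" for x l
    using f that unfolding V\<^sub>L_def by auto
  have fV: "f \<in> V" using f unfolding V\<^sub>L_def by auto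
  define F where "F = (\<lambda>x. s (weight g x) (D (f x)))"
  have FL: "F (x \<otimes> l) = F x" if "x \<in> carrier G" "l \<in> L" for x l
    unfolding F_def using fL weight_right[OF g] that by simp
  obtain R where R: "finite R" "R \<subseteq> carrier G" "disjoint_family_on (\<lambda>r. r <# L) R"
      "\<forall>x\<in>carrier G. x \<notin> (\<Union>r\<in>R. r <# L) \<longrightarrow> weight g x = 0"
    using weight_cosets[OF g] by blast
  let ?vol = "\<lambda>y r. complex_of_real (measure \<nu> {h\<in>H. h \<otimes> y \<in> r <# L})"
  have Fr: "F x = F r" if "r \<in> R" "x \<in> r <# L" for x r
    using that FL R(2) unfolding l_coset_def by auto
  have F0: "F x = 0" if "x \<in> carrier G" "x \<notin> (\<Union>r\<in>R. r <# L)" for x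
    using R(4) that unfolding F_def by simp
  have k: "kernel g y (f y) = (\<Sum>r\<in>R. s (?vol y r) (F r))" if "y \<in> J" for y
  proof -
    have y: "y \<in> carrier G" using that J(2) by auto
    have "kernel g y (f y) = simple_integral s \<nu> (\<lambda>h. F (h \<otimes> y))"
      unfolding kernel_def
    proof (rule simple_integral_cong)
      fix h assume "h \<in> space \<nu>"
      then have h: "h \<in> H" using Hh.space_haar by simp
      have "inv (\<theta> g) \<otimes> h \<otimes> y = inv (\<theta> g) \<otimes> (h \<otimes> y)" using g y h \<theta>_closed by (simp add: m_assoc)
      then show "s (\<omega> y * \<psi> (inv (\<theta> g) \<otimes> h \<otimes> y) * \<omega> h) (D (\<sigma> h (f y))) = F (h \<otimes> y)"
        unfolding F_def weight_def using V_covariant[OF fV h y] h y by (simp add: \<omega>_mult mult_ac)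
    qed
    also have "\<dots> = (\<Sum>r\<in>R. s (?vol y r) (F r))"
    proof (rule simple_integral_partition[OF vs R(1)])
      show "disjoint_family_on (\<lambda>r. {h\<in>H. h \<otimes> y \<in> r <# L}) R"
        using R(3) unfolding disjoint_family_on_def by blast
      show "{h\<in>H. h \<otimes> y \<in> r <# L} \<in> fmeasurable \<nu>" if "r \<in> R" for r
        using orbit_volume(2)[OF _ y] that R(2) by blast
      show "F (h \<otimes> y) = F r" if "r \<in> R" "h \<in> {h\<in>H. h \<otimes> y \<in> r <# L}" for r h
        using Fr that by blast
      show "F (h \<otimes> y) = 0" if "h \<in> space \<nu>" "h \<notin> (\<Union>r\<in>R. {h\<in>H. h \<otimes> y \<in> r <# L})" for h
        using that Hh.space_haar y by (intro F0) auto
    qed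
    finally show ?thesis .
  qed
  have vN: "complex_of_real (measure \<nu> N) \<noteq> 0" using Hh.ocs_measure_pos[OF N] by simp
  have "(\<Sum>y\<in>J. s \<kappa> (kernel g y (f y))) = (\<Sum>y\<in>J. \<Sum>r\<in>R. s (\<kappa> * ?vol y r) (F r))"
    by (rule sum.cong[OF refl]) (simp add: k s.scale_sum_right)
  also have "\<dots> = (\<Sum>r\<in>R. \<Sum>y\<in>J. s (\<kappa> * ?vol y r) (F r))" by (rule sum.swap)
  also have "\<dots> = (\<Sum>r\<in>R. s (complex_of_real (measure \<mu> L)) (F r))"
  proof (rule sum.cong[OF refl])
    fix r assume "r \<in> R"
    then have r: "r \<in> carrier G" using R(2) by auto
    have "(\<Sum>y\<in>J. s (\<kappa> * ?vol y r) (F r)) = s (\<kappa> * (\<Sum>y\<in>J. ?vol y r)) (F r)"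
      by (simp add: s.scale_sum_left sum_distrib_left)
    also have "(\<Sum>y\<in>J. ?vol y r) = complex_of_real (measure \<nu> N)"
      using orbit_volume(1)[OF r] by (simp only: of_real_sum[symmetric])
    finally show "(\<Sum>y\<in>J. s (\<kappa> * ?vol y r) (F r)) = s (complex_of_real (measure \<mu> L)) (F r)"
      using vN by (simp add: \<kappa>_def)
  qed
  also have "\<dots> = simple_integral s \<mu> F"
  proof (rule simple_integral_cosets[OF vs L R(1-3), symmetric])
    show "F (r \<otimes> m) = F r" if "r \<in> R" "m \<in> L" for r m using FL that R(2) by blast
  qed (rule F0)
  finally show ?thesis unfolding F_def A_weight[OF g] by simp
qed

text \<open>The possible values at \<open>y\<close> of functions in \<open>V\<^sub>L\<close>.\<close>

definition W\<^sub>L where "W\<^sub>L y = {w\<in>W. \<forall>k\<in>H \<inter> (\<lambda>x. y \<otimes> x \<otimes> inv y) ` L. \<sigma> k w = w}"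

lemma W\<^sub>L_basis:
  assumes y: "y \<in> carrier G"
  shows "\<exists>B. finite B \<and> B \<subseteq> W\<^sub>L y \<and> s.independent B \<and> W\<^sub>L y \<subseteq> s.span B"
proof -
  have "open_compact_subgroup (G\<lparr>carrier := H\<rparr>) (subtopology T H) (H \<inter> (\<lambda>x. y \<otimes> x \<otimes> inv y) ` L)"
    by (rule ocs_restrict[OF H ocs_conjugate[OF L y]])
  then obtain E where E: "finite E" "W\<^sub>L y \<subseteq> s.span E"
    using admissible unfolding admissible_rep_def W\<^sub>L_def by blast
  obtain B where B: "B \<subseteq> W\<^sub>L y" "s.independent B" "W\<^sub>L y \<subseteq> s.span B"
    using s.maximal_independent_subset by blast
  then have "finite B" using s.independent_span_bound[OF E(1) B(2)] E(2) by blast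
  then show ?thesis using B by blast
qed

lemma covariant_in_W\<^sub>L:
  assumes "y \<in> carrier G" "f y \<in> W" "\<And>h. h \<in> H \<Longrightarrow> f (h \<otimes> y) = \<sigma> h (f y)"
    "\<And>l. l \<in> L \<Longrightarrow> f (y \<otimes> l) = f y"
  shows "f y \<in> W\<^sub>L y"
proof -
  have "\<sigma> k (f y) = f y" if "k \<in> H" "l \<in> L" "k = y \<otimes> l \<otimes> inv y" for k l
  proof -
    have "k \<otimes> y = y \<otimes> l" using that assms(1) LG by (simp add: m_assoc)
    then show ?thesis using assms(3)[OF that(1)] assms(4)[OF that(2)] by simp
  qed
  then show ?thesis using assms(2) unfolding W\<^sub>L_def by auto
qed

text \<open>Choose a basis of \<open>W\<^sub>L y\<close> for every \<open>y\<close> in \<open>J\<close>. A function in \<open>V\<^sub>L\<close> has its value at \<open>y\<close> in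
  \<open>W\<^sub>L y\<close>, so \<open>A_kernel\<close> writes \<open>A\<close> as a finite sum of operators of rank at most one whose images are
  spanned by the functions \<open>kernel _ y b\<close>. By \<open>finite_rank_trace_eq\<close> the trace is the sum of the diagonal
  coefficients of \<open>kernel y y b\<close>, and the operator \<open>R\<close> has the same sum as its trace. The operators
  are arbitrary outside the representation spaces, as the values of a representation are.\<close>

lemma trace_induced:
  assumes A': "\<And>f. f \<in> V \<Longrightarrow> A' f = A f"
    and R: "\<And>w. w \<in> W \<Longrightarrow> R w = (\<Sum>y\<in>J. s \<kappa> (kernel y y w))"
  shows "finite_rank_trace (scale_fun s) V A' = finite_rank_trace s W R"
proof -
  \<comment> \<open>The bases may depend on \<open>y\<close>, so admissibility is used for one subgroup at a time.\<close>
  have "\<forall>y\<in>carrier G. \<exists>B. finite B \<and> B \<subseteq> W\<^sub>L y \<and> s.independent B \<and> W\<^sub>L y \<subseteq> s.span B"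
    using W\<^sub>L_basis by blast
  then obtain B where B: "\<forall>y\<in>carrier G. finite (B y) \<and> B y \<subseteq> W\<^sub>L y \<and> s.independent (B y) \<and>
      W\<^sub>L y \<subseteq> s.span (B y)"
    by (rule bchoice[elim_format]) blast
  have finB: "finite (B y)" and BW: "B y \<subseteq> W\<^sub>L y" and ind: "s.independent (B y)"
    and spanB: "W\<^sub>L y \<subseteq> s.span (B y)" if "y \<in> J" for y
    using B that J(2) by auto
  have W\<^sub>L_W: "W\<^sub>L y \<subseteq> W" for y unfolding W\<^sub>L_def by auto
  define I where "I = Sigma J B"
  have I: "finite I" unfolding I_def using J(1) finB by blast
  let ?r = "\<lambda>y. s.representation (B y)"
  define u where "u = (\<lambda>(y, b) g. if g \<in> carrier G then s \<kappa> (kernel g y b) else 0)"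
  define \<xi> where "\<xi> = (\<lambda>(y, b) f. ?r y (f y) b)"
  have yG: "y \<in> carrier G" if "y \<in> J" for y using that J(2) by auto
  have u_in: "u i \<in> V\<^sub>L" if "i \<in> I" for i
  proof -
    obtain y b where i: "i = (y, b)" "y \<in> J" "b \<in> B y" using \<open>i \<in> I\<close> unfolding I_def by auto
    have b: "b \<in> W" using i BW W\<^sub>L_W by blast
    show ?thesis
      unfolding V\<^sub>L_iff u_def i
      using kernel_closed[OF _ yG[OF i(2)] b] kernel_covariant[OF _ _ yG[OF i(2)] b]
        kernel_invariant[OF _ _ yG[OF i(2)]] LG
      by (simp add: W_simps \<sigma>_scale)
  qed
  have val: "f y \<in> W\<^sub>L y" if "f \<in> V\<^sub>L" "y \<in> J" for f y
    using that(1) yG[OF that(2)] unfolding V\<^sub>L_iff by (intro covariant_in_W\<^sub>L) auto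
  have span: "f y \<in> s.span (B y)" if "f \<in> V\<^sub>L" "y \<in> J" for f y
    using val[OF that] spanB[OF that(2)] by blast
  have expand: "w = (\<Sum>b\<in>B y. s (?r y w b) b)" if "w \<in> W\<^sub>L y" "y \<in> J" for w y
    using s.sum_representation_eq[OF ind _ finB order_refl] that spanB by (metis subsetD)
  have vsf: "vector_space (scale_fun s :: complex \<Rightarrow> ('a \<Rightarrow> 'w) \<Rightarrow> _)"
    by unfold_locales
      (auto simp: scale_fun_def fun_eq_iff s.scale_right_distrib s.scale_left_distrib)
  interpret F: vector_space "scale_fun s :: complex \<Rightarrow> ('a \<Rightarrow> 'w) \<Rightarrow> _" by (rule vsf)
  have sub: "F.subspace V\<^sub>L"
    by (rule F.subspaceI) (auto simp: V\<^sub>L_iff scale_fun_def W_simps \<sigma>_zero \<sigma>_add \<sigma>_scale)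
  have eval_sum: "(\<Sum>i\<in>I'. F' i) g = (\<Sum>i\<in>I'. F' i g)" for F' :: "'a \<times> 'w \<Rightarrow> 'a \<Rightarrow> 'w" and I' g
    by (induction I' rule: infinite_finite_induct) auto
  have A_expand: "A f = (\<Sum>i\<in>I. scale_fun s (\<xi> i f) (u i))" if f: "f \<in> V\<^sub>L" for f
  proof (rule ext)
    fix g
    show "A f g = (\<Sum>i\<in>I. scale_fun s (\<xi> i f) (u i)) g"
    proof (cases "g \<in> carrier G")
      case g: True
      have "A f g = (\<Sum>y\<in>J. s \<kappa> (kernel g y (f y)))" by (rule A_kernel[OF f g])
      also have "\<dots> = (\<Sum>y\<in>J. \<Sum>b\<in>B y. s (?r y (f y) b) (s \<kappa> (kernel g y b)))"
      proof (rule sum.cong[OF refl])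
        fix y assume y: "y \<in> J"
        have "kernel g y (f y) = kernel g y (\<Sum>b\<in>B y. s (?r y (f y) b) b)"
          using expand[OF val[OF f y] y] by simp
        also have "\<dots> = (\<Sum>b\<in>B y. s (?r y (f y) b) (kernel g y b))"
          by (rule kernel_sum[OF g yG[OF y] finB[OF y]]) (use BW[OF y] W\<^sub>L_W in blast)
        finally show "s \<kappa> (kernel g y (f y)) = (\<Sum>b\<in>B y. s (?r y (f y) b) (s \<kappa> (kernel g y b)))"
          by (simp add: s.scale_sum_right mult.commute)
      qed
      also have "\<dots> = (\<Sum>i\<in>I. scale_fun s (\<xi> i f) (u i) g)"
        unfolding I_def using g finB
        by (subst sum.Sigma[OF J(1)]) (auto simp: \<xi>_def u_def scale_fun_def intro!: sum.cong)
      finally show ?thesis by (simp add: eval_sum)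
    next
      case False
      then show ?thesis by (simp add: eval_sum A_def u_def scale_fun_def case_prod_beta)
    qed
  qed
  have V\<^sub>L_V: "f \<in> V" if "f \<in> V\<^sub>L" for f using that unfolding V\<^sub>L_def by blast
  have A_V: "A' ` V = A' ` V\<^sub>L"
  proof (intro equalityI subsetI)
    fix a assume "a \<in> A' ` V"
    then obtain f where f: "f \<in> V" "a = A' f" by blast
    have "a = A' (average f)"
      using f A'[OF f(1)] A'[OF V\<^sub>L_V[OF average_in_V\<^sub>L[OF f(1)]]] A_average[OF f(1)] by simp
    then show "a \<in> A' ` V\<^sub>L" using average_in_V\<^sub>L[OF f(1)] by blast
  qed (use V\<^sub>L_V in blast)
  have "finite_rank_trace (scale_fun s) V A' = finite_rank_trace (scale_fun s) V\<^sub>L A'"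
    unfolding finite_rank_trace_def A_V ..
  also have "\<dots> = (\<Sum>i\<in>I. \<xi> i (u i))"
  proof (rule finite_rank_trace_eq[OF vsf sub I])
    fix i f f' c assume i: "i \<in> I"
    then obtain y b where i': "i = (y, b)" "y \<in> J" unfolding I_def by auto
    assume f: "f \<in> V\<^sub>L"
    show "\<xi> i (scale_fun s c f) = c * \<xi> i f"
      unfolding \<xi>_def i' scale_fun_def
      using s.representation_scale[OF ind span[OF f]] i' by simp
    assume f': "f' \<in> V\<^sub>L"
    show "\<xi> i (f + f') = \<xi> i f + \<xi> i f'"
      unfolding \<xi>_def i' using s.representation_add[OF ind span[OF f'] span[OF f]] i' by simp
  qed (use u_in A_expand A'[OF V\<^sub>L_V] in auto)
  also have "\<dots> = (\<Sum>(y, b)\<in>I. ?r y (s \<kappa> (kernel y y b)) b)"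
    by (rule sum.cong[OF refl]) (auto simp: \<xi>_def u_def I_def yG)
  also have "\<dots> = finite_rank_trace s W R"
  proof -
    define \<eta> where "\<eta> = (\<lambda>(y, b) w. ?r y (s \<kappa> (kernel y y w)) b)"
    have kW: "s \<kappa> (kernel y y w) \<in> W\<^sub>L y" if "y \<in> J" "w \<in> W" for y w
    proof -
      note y = yG[OF that(1)]
      show ?thesis
        using covariant_in_W\<^sub>L[of y "\<lambda>g. s \<kappa> (kernel g y w)"] kernel_closed[OF y y that(2)]
          kernel_covariant[OF _ y y that(2)] kernel_invariant[OF _ y y] y
        by (simp add: W_simps \<sigma>_scale)
    qed
    have k_add: "kernel y y (v + w) = kernel y y v + kernel y y w"
      and k_scale: "kernel y y (s c v) = s c (kernel y y v)"
      if "y \<in> J" "v \<in> W" "w \<in> W" for y v w c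
    proof -
      note y = yG[OF that(1)]
      show sc: "kernel y y (s c v) = s c (kernel y y v)" for c
        using kernel_sum[OF y y, of "{v}" "\<lambda>_. c"] that by simp
      show "kernel y y (v + w) = kernel y y v + kernel y y w"
      proof (cases "v = w")
        case True
        then show ?thesis using sc[of 2] by (simp add: s.scale_left_distrib[of 1 1, simplified])
      next
        case False
        then show ?thesis using kernel_sum[OF y y, of "{v, w}" "\<lambda>_. 1"] that by simp
      qed
    qed
    have "finite_rank_trace s W R = (\<Sum>i\<in>I. \<eta> i (snd i))"
    proof (rule finite_rank_trace_eq[OF vs subW I])
      show "snd i \<in> W" if "i \<in> I" for i
        using that BW W\<^sub>L_W unfolding I_def by (elim SigmaE) (simp, blast)
      fix i v w c assume i: "i \<in> I" and v: "v \<in> W"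
      then obtain y b where i': "i = (y, b)" "y \<in> J" unfolding I_def by auto
      have sp: "s \<kappa> (kernel y y w) \<in> s.span (B y)" if "w \<in> W" for w
        using kW[OF i'(2) that] spanB[OF i'(2)] by blast
      show "\<eta> i (s c v) = c * \<eta> i v"
        using s.representation_scale[OF ind[OF i'(2)] sp[OF v], of c] i' k_scale[OF i'(2) v v]
        unfolding \<eta>_def by (simp add: mult.commute)
      assume w: "w \<in> W"
      show "\<eta> i (v + w) = \<eta> i v + \<eta> i w"
        using s.representation_add[OF ind[OF i'(2)] sp[OF w] sp[OF v]] i' k_add[OF i'(2) v w]
        unfolding \<eta>_def by (simp add: s.scale_right_distrib)
    next
      fix w assume w: "w \<in> W"
      have "(\<Sum>y\<in>J. s \<kappa> (kernel y y w)) = (\<Sum>y\<in>J. \<Sum>b\<in>B y. s (?r y (s \<kappa> (kernel y y w)) b) b)"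
        by (rule sum.cong[OF refl]) (rule expand[OF kW[OF _ w]])
      also have "\<dots> = (\<Sum>i\<in>I. s (\<eta> i w) (snd i))"
        unfolding I_def using finB
        by (subst sum.Sigma[OF J(1)]) (auto simp: \<eta>_def intro!: sum.cong)
      finally show "R w = (\<Sum>i\<in>I. s (\<eta> i w) (snd i))" using R[OF w] by simp
    qed
    also have "\<dots> = (\<Sum>(y, b)\<in>I. ?r y (s \<kappa> (kernel y y b)) b)"
      by (rule sum.cong[OF refl]) (auto simp: \<eta>_def)
    finally show ?thesis by simp
  qed
  finally show ?thesis .
qed


text \<open>The integrand is constant on the cosets of \<open>L\<close>: its two-sided change under \<open>L\<close> is absorbed by
  the invariance of \<open>\<psi>\<close>.\<close>

lemma descent_integral:
  assumes h: "h \<in> H"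
  shows "(LINT g:(\<Union>y\<in>J. y <# L)|\<mu>. \<omega> g * \<psi> (inv (\<theta> g) \<otimes> h \<otimes> g)) =
    complex_of_real (measure \<mu> L) * (\<Sum>y\<in>J. \<omega> y * \<psi> (inv (\<theta> y) \<otimes> h \<otimes> y))"
proof -
  let ?q = "\<lambda>g. \<omega> g * \<psi> (inv (\<theta> g) \<otimes> h \<otimes> g)"
  have hG: "h \<in> carrier G" using h by simp
  have q: "?q (y \<otimes> l) = ?q y" if y: "y \<in> carrier G" and l: "l \<in> L" for y l
  proof -
    note c = y hG LG[OF l] \<theta>_closed[OF y] \<theta>_closed[OF LG[OF l]]
    have "inv (\<theta> (y \<otimes> l)) \<otimes> h \<otimes> (y \<otimes> l) = \<theta> (inv l) \<otimes> ((inv (\<theta> y) \<otimes> h \<otimes> y) \<otimes> l)"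
      using c by (simp add: \<theta>_mult \<theta>_inv inv_mult_group m_assoc)
    then have "\<psi> (inv (\<theta> (y \<otimes> l)) \<otimes> h \<otimes> (y \<otimes> l)) = \<psi> (inv (\<theta> y) \<otimes> h \<otimes> y)"
      using \<psi>_left[OF _ ocsD(7)[OF L l]] \<psi>_right[OF _ l] c by simp
    then show ?thesis using \<omega>_mult \<omega>_L[OF l] c by simp
  qed
  have "has_bochner_integral \<mu> (\<lambda>g. indicat_real (\<Union>y\<in>J. y <# L) g *\<^sub>R ?q g)
      (\<Sum>y\<in>J. measure \<mu> (y <# L) *\<^sub>R ?q y)"
  proof (rule has_bochner_integral_partition[OF J(1,3)])
    show "y <# L \<in> fmeasurable \<mu>" if "y \<in> J" for y using l_coset_fmeasurable[OF L] J(2) that by blast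
    show "indicat_real (\<Union>y\<in>J. y <# L) g *\<^sub>R ?q g = ?q y" if y: "y \<in> J" and gy: "g \<in> y <# L" for y g
    proof -
      obtain l where l: "l \<in> L" "g = y \<otimes> l" using gy unfolding l_coset_def by auto
      have "y \<in> carrier G" using y J(2) by auto
      then have "?q g = ?q y" using q[OF _ l(1)] l(2) by simp
      moreover have "g \<in> (\<Union>y\<in>J. y <# L)" using y gy by blast
      ultimately show ?thesis by simp
    qed
  qed simp
  then have "(LINT g:(\<Union>y\<in>J. y <# L)|\<mu>. ?q g) = (\<Sum>y\<in>J. measure \<mu> (y <# L) *\<^sub>R ?q y)"
    unfolding set_lebesgue_integral_def by (rule has_bochner_integral_integral_eq)
  also have "\<dots> = (\<Sum>y\<in>J. complex_of_real (measure \<mu> L) * ?q y)"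
    using J(2) ocsD(4)[OF L] by (intro sum.cong) (auto simp: measure_l_coset scaleR_conv_of_real)
  finally show ?thesis by (simp add: sum_distrib_left)
qed

lemma kernel_diagonal_sum:
  assumes w: "w \<in> W"
  shows "simple_integral s \<nu> (\<lambda>h. s (\<kappa> * (\<Sum>y\<in>J. \<omega> y * \<psi> (inv (\<theta> y) \<otimes> h \<otimes> y))) (s (\<omega> h) (D (\<sigma> h w))))
    = (\<Sum>y\<in>J. s \<kappa> (kernel y y w))"
proof -
  let ?F = "\<lambda>y h. s (\<omega> y * \<psi> (inv (\<theta> y) \<otimes> h \<otimes> y) * \<omega> h) (D (\<sigma> h w))"
  have step: "\<forall>y\<in>J. Hh.step_function (?F y)" using kernel_step[OF _ _ w] J(2) by blast
  have "simple_integral s \<nu> (\<lambda>h. s (\<kappa> * (\<Sum>y\<in>J. \<omega> y * \<psi> (inv (\<theta> y) \<otimes> h \<otimes> y))) (s (\<omega> h) (D (\<sigma> h w))))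
      = simple_integral s \<nu> (\<lambda>h. s \<kappa> (\<Sum>y\<in>J. ?F y h))"
    by (rule simple_integral_cong) (simp add: s.scale_sum_left[symmetric] sum_distrib_right mult.assoc)
  also have "\<dots> = s \<kappa> (simple_integral s \<nu> (\<lambda>h. \<Sum>y\<in>J. ?F y h))"
    by (rule Hh.simple_integral_linear(1)[OF vs vs subW Hh.step_function_sum[OF J(1) step]])
      (use w in \<open>auto intro!: W_sum kernel_integrand_closed simp: s.scale_right_distrib mult.commute\<close>)
  also have "\<dots> = s \<kappa> (\<Sum>y\<in>J. kernel y y w)"
    unfolding kernel_def Hh.simple_integral_sum[OF vs J(1) step] ..
  finally show ?thesis by (simp add: s.scale_sum_right)
qed

end

section \<open>The base point of a twisted space\<close>

lemma test_function_homeomorphic: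
  assumes p: "homeomorphic_map T X p" and \<phi>: "test_function X \<phi>"
  shows "test_function T (\<lambda>x. \<phi> (p x))"
proof -
  have im: "p ` topspace T = topspace X" by (rule homeomorphic_imp_surjective_map[OF p])
  have cont: "continuous_map T X p" by (rule homeomorphic_imp_continuous_map[OF p])
  have "\<exists>U. openin T U \<and> x \<in> U \<and> (\<forall>y\<in>U. \<phi> (p y) = \<phi> (p x))" if x: "x \<in> topspace T" for x
  proof -
    have "p x \<in> topspace X" using x im by blast
    then obtain U where U: "openin X U" "p x \<in> U" "\<forall>y\<in>U. \<phi> y = \<phi> (p x)"
      using conjunct1[OF \<phi>[unfolded test_function_def]] by blast
    have "x \<in> {y \<in> topspace T. p y \<in> U}" using x U(2) by simp
    moreover have "\<forall>y\<in>{y \<in> topspace T. p y \<in> U}. \<phi> (p y) = \<phi> (p x)" using U(3) by simp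
    ultimately show ?thesis using openin_continuous_map_preimage[OF cont U(1)] by blast
  qed
  moreover have "compactin T (T closure_of {x\<in>topspace T. \<phi> (p x) \<noteq> 0})"
  proof -
    have "p ` {x\<in>topspace T. \<phi> (p x) \<noteq> 0} = {y\<in>topspace X. \<phi> y \<noteq> 0}" using im by auto
    then have "p ` (T closure_of {x\<in>topspace T. \<phi> (p x) \<noteq> 0}) = X closure_of {y\<in>topspace X. \<phi> y \<noteq> 0}"
      using homeomorphic_map_closure_of[OF p, of "{x\<in>topspace T. \<phi> (p x) \<noteq> 0}"] by auto
    then have "compactin X (p ` (T closure_of {x\<in>topspace T. \<phi> (p x) \<noteq> 0}))"
      using \<phi> unfolding test_function_def by simp
    then show ?thesis
      using homeomorphic_map_compactness[OF p closure_of_subset_topspace] by blast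
  qed
  ultimately show ?thesis unfolding test_function_def by blast
qed

text \<open>Sets that are not measurable have measure \<open>0\<close> on both sides.\<close>

lemma measure_distr_homeomorphic:
  assumes p: "homeomorphic_map T X p"
    and sp: "space \<mu> = topspace T" and se: "sets \<mu> = sets (borel_sigma T)"
    and A: "A \<subseteq> topspace X"
  shows "measure \<mu> (p -` A \<inter> space \<mu>) = measure (distr \<mu> (borel_sigma X) p) A"
proof -
  obtain q where q: "homeomorphic_maps T X p q" using p homeomorphic_map_maps by blast
  have borel: "f \<in> measurable (borel_sigma P) (borel_sigma Q)" if f: "continuous_map P Q f"
    for f and P :: "'z topology" and Q :: "'y topology"
    unfolding borel_sigma_def
  proof (rule measurable_measure_of)
    show "{U. openin Q U} \<subseteq> Pow (topspace Q)" using openin_subset by auto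
    have sP: "{U. openin P U} \<subseteq> Pow (topspace P)" using openin_subset by auto
    show "f \<in> space (sigma (topspace P) {U. openin P U}) \<rightarrow> topspace Q"
      using continuous_map_funspace[OF f] by (simp add: space_measure_of[OF sP])
    fix U assume "U \<in> {U. openin Q U}"
    then have "openin P {x\<in>topspace P. f x \<in> U}"
      using openin_continuous_map_preimage[OF f] by simp
    moreover have "f -` U \<inter> space (sigma (topspace P) {U. openin P U}) = {x\<in>topspace P. f x \<in> U}"
      by (auto simp: space_measure_of[OF sP])
    ultimately show "f -` U \<inter> space (sigma (topspace P) {U. openin P U})
        \<in> sets (sigma (topspace P) {U. openin P U})"
      by (simp add: sets_measure_of[OF sP] sigma_sets.Basic)
  qed
  have space_b: "space (borel_sigma P) = topspace P" for P :: "'z topology"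
    unfolding borel_sigma_def by (rule space_measure_of) (use openin_subset in auto)
  have pm: "p \<in> measurable \<mu> (borel_sigma X)"
    using borel[of T X p] q measurable_cong_sets[OF se refl, of "borel_sigma X"]
    unfolding homeomorphic_maps_def by auto
  show ?thesis
  proof (cases "A \<in> sets (borel_sigma X)")
    case True
    then show ?thesis using measure_distr[OF pm] by simp
  next
    case False
    have "p -` A \<inter> space \<mu> \<notin> sets \<mu>"
    proof
      assume "p -` A \<inter> space \<mu> \<in> sets \<mu>"
      then have "q -` (p -` A \<inter> space \<mu>) \<inter> space (borel_sigma X) \<in> sets (borel_sigma X)"
        using measurable_sets[OF borel[of X T q], of "p -` A \<inter> space \<mu>"] q se
        unfolding homeomorphic_maps_def by metis
      moreover have "q y \<in> topspace T" if "y \<in> topspace X" for y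
        using q that continuous_map_funspace[of X T q] unfolding homeomorphic_maps_def by blast
      then have "q -` (p -` A \<inter> space \<mu>) \<inter> space (borel_sigma X) = A"
        using q A unfolding homeomorphic_maps_def sp space_b
        by auto
      ultimately show False using False by simp
    qed
    then show ?thesis using False by (simp add: measure_notin_sets)
  qed
qed

context twisted_space
begin

lemma base_point_homeomorphic:
  assumes \<delta>: "\<delta> \<in> topspace X"
  shows "homeomorphic_map T X (\<lambda>g. right_act act \<iota> \<delta> g)"
  using homeomorphic_map_compose[OF conjunct2[OF Int_automorphism[OF \<delta>]] orbit_homeomorphism[OF \<delta>]]
  unfolding right_act_def by (simp add: o_def)

lemma simple_integral_twisted_measure:
  assumes \<delta>: "\<delta> \<in> topspace X"
    and \<mu>: "space \<mu> = carrier G" "sets \<mu> = sets (borel_sigma T)"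
  shows "simple_integral s (twisted_measure X act \<iota> \<mu> \<delta>) F =
    simple_integral s \<mu> (\<lambda>x. F (right_act act \<iota> \<delta> x))"
  unfolding twisted_measure_def
proof (rule simple_integral_bij)
  note p = base_point_homeomorphic[OF \<delta>]
  have sp: "space \<mu> = topspace T" using \<mu>(1) topspace_eq by simp
  have spX: "space (distr \<mu> (borel_sigma X) (\<lambda>g. right_act act \<iota> \<delta> g)) = topspace X"
    unfolding space_distr borel_sigma_def by (rule space_measure_of) (use openin_subset in auto)
  show "bij_betw (\<lambda>x. right_act act \<iota> \<delta> x) (space \<mu>)
      (space (distr \<mu> (borel_sigma X) (\<lambda>g. right_act act \<iota> \<delta> g)))"
    unfolding spX sp bij_betw_def
    using homeomorphic_imp_injective_map[OF p] homeomorphic_imp_surjective_map[OF p] by blast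
  show "measure \<mu> ((\<lambda>x. right_act act \<iota> \<delta> x) -` A \<inter> space \<mu>) =
      measure (distr \<mu> (borel_sigma X) (\<lambda>g. right_act act \<iota> \<delta> g)) A"
    if "A \<subseteq> space (distr \<mu> (borel_sigma X) (\<lambda>g. right_act act \<iota> \<delta> g))" for A
    by (rule measure_distr_homeomorphic[OF p sp \<mu>(2)]) (use that spX in simp)
qed

lemma Int_mult:
  assumes "\<delta> \<in> topspace X" "x \<in> carrier G" "y \<in> carrier G"
  shows "\<iota> \<delta> (x \<otimes> y) = \<iota> \<delta> x \<otimes> \<iota> \<delta> y" "\<iota> \<delta> x \<in> carrier G"
  using Int_automorphism[OF assms(1)] assms(2,3) unfolding iso_def hom_def by auto

lemma right_act_base_point:
  assumes \<delta>: "\<delta> \<in> topspace X" and x: "x \<in> carrier G" and y: "y \<in> carrier G"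
  shows "right_act act \<iota> (right_act act \<iota> \<delta> x) y = right_act act \<iota> \<delta> (x \<otimes> y)"
proof -
  have c: "\<iota> \<delta> x \<in> carrier G" "\<iota> \<delta> y \<in> carrier G" using Int_mult[OF \<delta>] x y by auto
  have "right_act act \<iota> (right_act act \<iota> \<delta> x) y
      = act ((\<iota> \<delta> x \<otimes> \<iota> \<delta> y \<otimes> inv (\<iota> \<delta> x)) \<otimes> \<iota> \<delta> x) \<delta>"
    unfolding right_act_def using c y \<delta> by (simp add: Int_act act_mult)
  also have "(\<iota> \<delta> x \<otimes> \<iota> \<delta> y \<otimes> inv (\<iota> \<delta> x)) \<otimes> \<iota> \<delta> x = \<iota> \<delta> (x \<otimes> y)"
    using c Int_mult(1)[OF \<delta> x y] by (simp add: m_assoc)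
  finally show ?thesis unfolding right_act_def .
qed

lemma act_base_point:
  assumes \<delta>: "\<delta> \<in> topspace X" and x: "x \<in> carrier G" and g: "g' \<in> carrier G" "\<iota> \<delta> g' = g"
  shows "act g (right_act act \<iota> \<delta> x) = right_act act \<iota> \<delta> (g' \<otimes> x)"
  unfolding right_act_def using assms Int_mult[OF \<delta>] by (auto simp: act_mult)

end

section \<open>The fundamental domain\<close>

text \<open>Since \<open>H <#> K\<close> is a subgroup, each \<open>g\<close> lies in exactly one of the cosets
  \<open>(H <#> K) #> x i\<close>. If \<open>g = h\<^sub>0 \<otimes> k\<^sub>0 \<otimes> x i\<close>, then \<open>inv h \<otimes> g\<close> lies in \<open>\<Omega>\<close> exactly when \<open>inv h \<otimes> h\<^sub>0\<close>
  lies in \<open>K\<close>, which is the third claim. The second one uses the normalization \<open>x 1 = \<one>\<close>.\<close>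

lemma (in locally_profinite_group) fundamental_domain:
  fixes n :: nat and x :: "nat \<Rightarrow> 'a"
  assumes H: "subgroup H G" and K: "open_compact_subgroup G T K" and HK: "H <#> K = K <#> H"
    and x: "x ` {1..n} \<subseteq> carrier G" "x 1 = \<one>"
      "bij_betw (\<lambda>i. (H <#> K) #> x i) {1..n} (rcosets (H <#> K))"
    and \<Omega>: "\<Omega> = (\<Union>i\<in>{1..n}. K #> x i)"
  shows "compactin T \<Omega>" and "H \<inter> \<Omega> = H \<inter> K"
    and "\<And>g. g \<in> carrier G \<Longrightarrow> \<exists>h\<^sub>0\<in>H. {h\<in>H. inv h \<otimes> g \<in> \<Omega>} = h\<^sub>0 <# (H \<inter> K)"
    and "\<exists>L. open_compact_subgroup G T L \<and> (\<forall>y\<in>\<Omega>. \<forall>l\<in>L. y \<otimes> l \<in> \<Omega>)"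
proof -
  note HG = subgroup.subset[OF H] and KG = ocsD(4)[OF K]
  have Hc: "h \<in> carrier G" if "h \<in> H" for h using that HG by blast
  have Kc: "k \<in> carrier G" if "k \<in> K" for k using that KG by blast
  have xc: "x i \<in> carrier G" if "i \<in> {1..n}" for i using that x(1) by blast
  define P where "P = H <#> K"
  have PI: "h \<otimes> k \<in> P" if "h \<in> H" "k \<in> K" for h k
    unfolding P_def set_mult_def using that by (intro UN_I[of h] UN_I[of k]) simp_all
  have PE: "\<exists>h\<in>H. \<exists>k\<in>K. p = h \<otimes> k" if "p \<in> P" for p
    using that unfolding P_def set_mult_def by auto
  have swap: "k \<otimes> h \<in> P" if "h \<in> H" "k \<in> K" for h k
  proof -
    have "k \<otimes> h \<in> K <#> H" unfolding set_mult_def using that by (intro UN_I[of k] UN_I[of h]) simp_all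
    then show ?thesis unfolding P_def using HK by metis
  qed
  have sub: "subgroup P G"
  proof (rule subgroupI)
    show "P \<subseteq> carrier G" using set_mult_closed[OF HG KG] unfolding P_def .
    show "P \<noteq> {}" using PI subgroup.one_closed[OF H] ocsD(5)[OF K] by blast
    show "inv p \<in> P" if p: "p \<in> P" for p
    proof -
      obtain h k where hk: "h \<in> H" "k \<in> K" "p = h \<otimes> k" using PE[OF p] by blast
      then have "inv p = inv k \<otimes> inv h" using Hc Kc by (simp add: inv_mult_group)
      then show ?thesis
        using swap[OF subgroup.m_inv_closed[OF H hk(1)] ocsD(7)[OF K hk(2)]] by simp
    qed
    show "p \<otimes> q \<in> P" if p: "p \<in> P" and q: "q \<in> P" for p q
    proof -
      obtain h k where hk: "h \<in> H" "k \<in> K" "p = h \<otimes> k" using PE[OF p] by blast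
      obtain h' k' where hk': "h' \<in> H" "k' \<in> K" "q = h' \<otimes> k'" using PE[OF q] by blast
      obtain h2 k2 where hk2: "h2 \<in> H" "k2 \<in> K" "k \<otimes> h' = h2 \<otimes> k2"
        using PE[OF swap[OF hk'(1) hk(2)]] by blast
      have "p \<otimes> q = h \<otimes> (k \<otimes> h') \<otimes> k'" using hk hk' Hc Kc by (simp add: m_assoc)
      also have "\<dots> = (h \<otimes> h2) \<otimes> (k2 \<otimes> k')" unfolding hk2(3) using hk hk' hk2 Hc Kc by (simp add: m_assoc)
      finally show ?thesis
        using PI[OF subgroup.m_closed[OF H hk(1) hk2(1)] ocsD(6)[OF K hk2(2) hk'(2)]] by simp
    qed
  qed
  note PG = subgroup.subset[OF sub]
  have cover: "\<exists>i\<in>{1..n}. g \<in> P #> x i" if g: "g \<in> carrier G" for g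
  proof -
    have "P #> g \<in> rcosets P" using rcosetsI[OF PG g] .
    then obtain i where "i \<in> {1..n}" "P #> g = P #> x i"
      using x(3) unfolding P_def[symmetric] bij_betw_def by (metis (no_types, lifting) imageE)
    then show ?thesis using rcos_self[OF g sub] by auto
  qed
  have uniq: "i = j" if ij: "i \<in> {1..n}" "j \<in> {1..n}" "g \<in> P #> x i" "g \<in> P #> x j" for i j g
  proof -
    have "P #> x i = P #> x j"
      using repr_independence[OF ij(3) xc[OF ij(1)] sub] repr_independence[OF ij(4) xc[OF ij(2)] sub]
      by simp
    then show ?thesis using x(3) ij unfolding P_def[symmetric] bij_betw_def inj_on_def by blast
  qed
  have one: "1 \<in> {1..n}" using cover[OF one_closed] by auto
  have \<Omega>I: "k \<otimes> x i \<in> \<Omega>" if "i \<in> {1..n}" "k \<in> K" for i k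
    unfolding \<Omega> r_coset_def using that by blast
  have \<Omega>E: "\<exists>i\<in>{1..n}. \<exists>k\<in>K. y = k \<otimes> x i" if "y \<in> \<Omega>" for y
    using that unfolding \<Omega> r_coset_def by blast
  have inP: "h \<otimes> (k \<otimes> x i) \<in> P #> x i" if "h \<in> H" "k \<in> K" "i \<in> {1..n}" for h k i
  proof -
    have "h \<otimes> (k \<otimes> x i) = (h \<otimes> k) \<otimes> x i" using that Hc Kc xc by (simp add: m_assoc)
    then show ?thesis unfolding r_coset_def using PI[OF that(1,2)] by auto
  qed
  show "compactin T \<Omega>"
    unfolding \<Omega> using compactin_r_coset[OF xc ocsD(3)[OF K]] by (intro compactin_Union) auto
  show "H \<inter> \<Omega> = H \<inter> K"
  proof (intro equalityI subsetI)
    fix h assume h: "h \<in> H \<inter> \<Omega>"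
    then obtain i k where ik: "i \<in> {1..n}" "k \<in> K" "h = k \<otimes> x i" using \<Omega>E by blast
    have "h \<in> P #> x 1"
      using inP[of h \<one> 1] h one ocsD(5)[OF K] Hc x(2) by simp
    moreover have "h \<in> P #> x i"
      using inP[OF subgroup.one_closed[OF H] ik(2,1)] ik Kc xc by simp
    ultimately have "i = 1" using uniq ik(1) one by blast
    then show "h \<in> H \<inter> K" using h ik x(2) Kc by simp
  next
    fix h assume "h \<in> H \<inter> K"
    then show "h \<in> H \<inter> \<Omega>" using \<Omega>I[OF one, of h] x(2) Kc by simp
  qed
  show "\<exists>h\<^sub>0\<in>H. {h\<in>H. inv h \<otimes> g \<in> \<Omega>} = h\<^sub>0 <# (H \<inter> K)" if g: "g \<in> carrier G" for g
  proof -
    obtain i where i: "i \<in> {1..n}" "g \<in> P #> x i" using cover[OF g] by blast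
    then obtain p where "p \<in> P" "g = p \<otimes> x i" unfolding r_coset_def by blast
    then obtain h0 k0 where hk: "h0 \<in> H" "k0 \<in> K" "g = h0 \<otimes> k0 \<otimes> x i" using PE by blast
    note c = Hc[OF hk(1)] Kc[OF hk(2)] xc[OF i(1)]
    have iff: "inv h \<otimes> g \<in> \<Omega> \<longleftrightarrow> inv h \<otimes> h0 \<in> K" if h: "h \<in> H" for h
    proof
      assume "inv h \<otimes> g \<in> \<Omega>"
      then obtain j k where jk: "j \<in> {1..n}" "k \<in> K" "inv h \<otimes> g = k \<otimes> x j" using \<Omega>E by blast
      have "g = h \<otimes> (inv h \<otimes> g)" using g Hc[OF h] by (simp add: m_assoc[symmetric])
      then have "g \<in> P #> x j" using inP[OF h jk(2,1)] jk(3) by simp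
      then have "j = i" using uniq i jk(1) by blast
      then have "(inv h \<otimes> h0 \<otimes> k0) \<otimes> x i = k \<otimes> x i"
        using jk(3) hk(3) c Hc[OF h] by (simp add: m_assoc)
      then have "inv h \<otimes> h0 \<otimes> k0 = k" using c Hc[OF h] Kc[OF jk(2)] by simp
      then have "inv h \<otimes> h0 = k \<otimes> inv k0" using c Hc[OF h] Kc[OF jk(2)] by (simp add: inv_solve_right)
      then show "inv h \<otimes> h0 \<in> K" using ocsD(6,7)[OF K] jk(2) hk(2) by simp
    next
      assume "inv h \<otimes> h0 \<in> K"
      then have "(inv h \<otimes> h0) \<otimes> k0 \<in> K" using ocsD(6)[OF K] hk(2) by blast
      moreover have "inv h \<otimes> g = ((inv h \<otimes> h0) \<otimes> k0) \<otimes> x i"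
        unfolding hk(3) using c Hc[OF h] by (simp add: m_assoc)
      ultimately show "inv h \<otimes> g \<in> \<Omega>" using \<Omega>I[OF i(1)] by simp
    qed
    have "h \<in> h0 <# (H \<inter> K) \<longleftrightarrow> h \<in> H \<and> inv h \<otimes> h0 \<in> K" for h
    proof
      assume "h \<in> h0 <# (H \<inter> K)"
      then obtain k where k: "k \<in> H" "k \<in> K" "h = h0 \<otimes> k" unfolding l_coset_def by blast
      have "inv h \<otimes> h0 = inv k \<otimes> (inv h0 \<otimes> h0)"
        unfolding k(3) using c Kc[OF k(2)] by (simp add: inv_mult_group m_assoc del: l_inv)
      then show "h \<in> H \<and> inv h \<otimes> h0 \<in> K"
        using k c Kc[OF k(2)] ocsD(7)[OF K k(2)] subgroup.m_closed[OF H hk(1) k(1)] by simp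
    next
      assume h: "h \<in> H \<and> inv h \<otimes> h0 \<in> K"
      then have hc: "h \<in> carrier G" using Hc by blast
      have "inv (inv h \<otimes> h0) = inv h0 \<otimes> h" using hc c by (simp add: inv_mult_group)
      then have "inv h0 \<otimes> h \<in> K" using ocsD(7)[OF K, of "inv h \<otimes> h0"] h by simp
      moreover have "inv h0 \<otimes> h \<in> H"
        using h hk(1) subgroup.m_closed[OF H] subgroup.m_inv_closed[OF H] by blast
      ultimately show "h \<in> h0 <# (H \<inter> K)"
        using mem_l_coset[OF c(1), of "H \<inter> K" h] hc HG by blast
    qed
    then have "{h\<in>H. inv h \<otimes> g \<in> \<Omega>} = h0 <# (H \<inter> K)" using iff by blast
    then show ?thesis using hk(1) by blast
  qed
  show "\<exists>L. open_compact_subgroup G T L \<and> (\<forall>y\<in>\<Omega>. \<forall>l\<in>L. y \<otimes> l \<in> \<Omega>)"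
  proof -
    define Q where "Q i = (\<lambda>k. inv (x i) \<otimes> k \<otimes> inv (inv (x i))) ` K" for i
    have "open_compact_subgroup G T (Q i)" if "i \<in> {1..n}" for i
      unfolding Q_def by (rule ocs_conjugate[OF K inv_closed[OF xc[OF that]]])
    then obtain L where L: "open_compact_subgroup G T L" "\<forall>i\<in>{1..n}. L \<subseteq> Q i"
      using ocs_finite_below[of "{1..n}" Q] by blast
    have "y \<otimes> l \<in> \<Omega>" if y: "y \<in> \<Omega>" and l: "l \<in> L" for y l
    proof -
      obtain i k where ik: "i \<in> {1..n}" "k \<in> K" "y = k \<otimes> x i" using \<Omega>E[OF y] by blast
      then obtain k' where k': "k' \<in> K" "l = inv (x i) \<otimes> k' \<otimes> inv (inv (x i))"
        using L(2) l unfolding Q_def by blast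
      have "y \<otimes> l = k \<otimes> (x i \<otimes> (inv (x i) \<otimes> (k' \<otimes> x i)))"
        unfolding ik(3) k'(2) using xc[OF ik(1)] Kc[OF ik(2)] Kc[OF k'(1)] by (simp add: m_assoc)
      also have "x i \<otimes> (inv (x i) \<otimes> (k' \<otimes> x i)) = k' \<otimes> x i"
        using xc[OF ik(1)] Kc[OF k'(1)] by (simp add: m_assoc[symmetric])
      also have "k \<otimes> (k' \<otimes> x i) = (k \<otimes> k') \<otimes> x i"
        using xc[OF ik(1)] Kc[OF ik(2)] Kc[OF k'(1)] by (simp add: m_assoc)
      finally show ?thesis using \<Omega>I[OF ik(1) ocsD(6)[OF K ik(2) k'(1)]] by simp
    qed
    then show ?thesis using L(1) by blast
  qed
qed

section \<open>The descent formula\<close>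

theorem mainTheorem6:
  fixes G :: "('a, 'b) monoid_scheme"
    and T :: "'a topology"
    and H K \<Omega>' :: "'a set"
    and X :: "'x topology"
    and act :: "'a \<Rightarrow> 'x \<Rightarrow> 'x"
    and \<iota> :: "'x \<Rightarrow> 'a \<Rightarrow> 'a"
    and Y :: "'x set"
    and \<omega> :: "'a \<Rightarrow> complex"
    and n :: nat
    and x :: "nat \<Rightarrow> 'a"
    and s :: "complex \<Rightarrow> 'w::ab_group_add \<Rightarrow> 'w"
    and W :: "'w set"
    and \<sigma> :: "'a \<Rightarrow> 'w \<Rightarrow> 'w"
    and S :: "'x \<Rightarrow> 'w \<Rightarrow> 'w"
    and \<mu>\<^sub>G \<mu>\<^sub>H :: "'a measure"
    and \<delta>\<^sub>1 :: 'x
    and \<phi> :: "'x \<Rightarrow> complex"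
  assumes G: "locally_profinite_group G T"
    and H: "subgroup H G" "closedin T H"
    and X: "twisted_space G T X act \<iota>"
    and Y: "twisted_subspace X act \<iota> H Y"
    and \<omega>: "group_character G T \<omega>"
    and compact_mod: "compact_modulo G T H (carrier G)"
    and K: "open_compact_subgroup G T K" "H <#>\<^bsub>G\<^esub> K = K <#>\<^bsub>G\<^esub> H"
    and x: "x ` {1..n} \<subseteq> carrier G" "x 1 = \<one>\<^bsub>G\<^esub>"
      "bij_betw (\<lambda>i. (H <#>\<^bsub>G\<^esub> K) #>\<^bsub>G\<^esub> x i) {1..n} (rcosets\<^bsub>G\<^esub> (H <#>\<^bsub>G\<^esub> K))"
    and \<Omega>': "\<Omega>' = (\<Union>i\<in>{1..n}. K #>\<^bsub>G\<^esub> x i)"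
    and \<mu>: "left_haar_measure G T \<mu>\<^sub>G"
      "left_haar_measure (G\<lparr>carrier := H\<rparr>) (subtopology T H) \<mu>\<^sub>H"
    and \<delta>\<^sub>1: "\<delta>\<^sub>1 \<in> Y"
    and S: "smooth_twisted_rep (G\<lparr>carrier := H\<rparr>) (subtopology T H) (subtopology X Y)
      act \<iota> \<omega> s W \<sigma> S"
    and admissible: "admissible_rep (G\<lparr>carrier := H\<rparr>) (subtopology T H) s W \<sigma>"
    and \<phi>: "test_function X \<phi>"
  shows "twisted_character (scale_fun s) (ind_space G T H W \<sigma>) (ind_map G Y act \<iota> \<omega> s S)
           (twisted_measure X act \<iota> \<mu>\<^sub>G \<delta>\<^sub>1) \<phi>
       = twisted_character s W S (twisted_measure (subtopology X Y) act \<iota> \<mu>\<^sub>H \<delta>\<^sub>1)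
           (descent G act \<iota> \<omega> \<mu>\<^sub>G
             (right_haar_measure (G\<lparr>carrier := H\<rparr>) (subtopology T H) \<mu>\<^sub>H) H \<Omega>' \<phi>)"
proof -
  let ?H = "G\<lparr>carrier := H\<rparr>" and ?TH = "subtopology T H" and ?XY = "subtopology X Y"
  interpret haar_group G T \<mu>\<^sub>G
    by (intro haar_group.intro G haar_group_axioms.intro \<mu>(1))
  interpret XT: twisted_space G T X act \<iota> by (rule X)
  interpret Hh: haar_group ?H ?TH \<mu>\<^sub>H
    by (intro haar_group.intro closed_subgroup_locally_profinite[OF H] haar_group_axioms.intro \<mu>(2))
  interpret HY: twisted_space ?H ?TH ?XY act \<iota>
    by (rule XT.twisted_subspace_is_twisted_space[OF H(1) Y])
  have HG: "H \<subseteq> carrier G" by (rule subgroup.subset[OF H(1)])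
  have Hc: "h \<in> carrier G" if "h \<in> H" for h using that HG by blast
  have one_H: "\<one>\<^bsub>G\<^esub> \<in> H" by (rule subgroup.one_closed[OF H(1)])
  have topH: "topspace ?TH = H" using HG topspace_eq by auto
  have actX: "act g \<gamma> \<in> topspace X" if "g \<in> carrier G" "\<gamma> \<in> topspace X" for g \<gamma>
    using homeomorphic_imp_surjective_map[OF XT.orbit_homeomorphism[OF that(2)]] that(1) topspace_eq
    by blast
  have YX: "Y \<subseteq> topspace X"
    using Y actX Hc unfolding twisted_subspace_def by auto
  have \<delta>X: "\<delta>\<^sub>1 \<in> topspace X" using \<delta>\<^sub>1 YX by blast
  have topY: "topspace ?XY = Y" using YX by auto
  have \<delta>Y: "\<delta>\<^sub>1 \<in> topspace ?XY" using \<delta>\<^sub>1 topY by simp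

  \<comment> \<open>The base point turns the twisted space into \<open>G\<close> with right translation; left translation
    by \<open>g\<close> becomes left translation by \<open>\<theta> g\<close>.\<close>
  define p where "p = right_act act \<iota> \<delta>\<^sub>1"
  obtain \<theta> where \<theta>: "homeomorphic_maps T T (\<iota> \<delta>\<^sub>1) \<theta>"
    using conjunct2[OF XT.Int_automorphism[OF \<delta>X]] homeomorphic_map_maps by blast
  have \<theta>_cont: "continuous_map T T \<theta>" using \<theta> unfolding homeomorphic_maps_def by blast
  have \<theta>_left: "\<theta> (\<iota> \<delta>\<^sub>1 g) = g" and \<theta>_right: "\<iota> \<delta>\<^sub>1 (\<theta> g) = g"
    and \<theta>_closed: "\<theta> g \<in> carrier G" if "g \<in> carrier G" for g
    using \<theta> that continuous_map_funspace[OF \<theta>_cont] topspace_eq unfolding homeomorphic_maps_def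
    by (blast, blast, blast)
  have \<theta>_mult: "\<theta> (g \<otimes>\<^bsub>G\<^esub> h) = \<theta> g \<otimes>\<^bsub>G\<^esub> \<theta> h" if "g \<in> carrier G" "h \<in> carrier G" for g h
    using XT.Int_mult(1)[OF \<delta>X \<theta>_closed[OF that(1)] \<theta>_closed[OF that(2)]] that
      \<theta>_left[OF m_closed[OF \<theta>_closed[OF that(1)] \<theta>_closed[OF that(2)]]] \<theta>_right by simp
  have \<iota>H: "\<iota> \<delta>\<^sub>1 ` H = H"
    using homeomorphic_imp_surjective_map[OF conjunct2[OF HY.Int_automorphism[OF \<delta>Y]]] topH by simp
  have \<theta>_H: "\<theta> h \<in> H" if h: "h \<in> H" for h
  proof -
    obtain k where k: "k \<in> H" "h = \<iota> \<delta>\<^sub>1 k" using h \<iota>H by blast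
    then show ?thesis using \<theta>_left[OF Hc[OF k(1)]] by simp
  qed
  have act_p: "act g (p z) = p (\<theta> g \<otimes>\<^bsub>G\<^esub> z)" if "g \<in> carrier G" "z \<in> carrier G" for g z
    unfolding p_def by (rule XT.act_base_point[OF \<delta>X that(2) \<theta>_closed[OF that(1)] \<theta>_right[OF that(1)]])
  have p_right: "right_act act \<iota> (p z) g = p (z \<otimes>\<^bsub>G\<^esub> g)" if "z \<in> carrier G" "g \<in> carrier G" for g z
    unfolding p_def by (rule XT.right_act_base_point[OF \<delta>X that])
  have p_hom: "homeomorphic_map T X p" unfolding p_def by (rule XT.base_point_homeomorphic[OF \<delta>X])
  have p_inj: "inj_on p (carrier G)" using homeomorphic_imp_injective_map[OF p_hom] topspace_eq by simp
  have p_H: "p ` H = Y"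
    using homeomorphic_imp_surjective_map[OF HY.base_point_homeomorphic[OF \<delta>Y]] topH topY
    unfolding p_def by simp

  define D where "D = S \<delta>\<^sub>1"
  have smooth: "smooth_rep ?H ?TH s W \<sigma>"
    and S_auto: "\<And>\<gamma>. \<gamma> \<in> Y \<Longrightarrow> linear_automorphism s W (S \<gamma>)"
    and S_bi: "\<And>x y \<gamma> v. \<lbrakk>x \<in> H; y \<in> H; \<gamma> \<in> Y; v \<in> W\<rbrakk> \<Longrightarrow>
      S (right_act act \<iota> (act x \<gamma>) y) v = s (\<omega> y) (\<sigma> x (S \<gamma> (\<sigma> y v)))"
    using S topY unfolding smooth_twisted_rep_def by simp_all
  have vs: "vector_space s" using smooth unfolding smooth_rep_def by (rule conjunct1)
  interpret s: vector_space s by (rule vs)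
  have \<sigma>_auto: "linear_automorphism s W (\<sigma> h)" if "h \<in> H" for h
    using smooth that unfolding smooth_rep_def by simp
  have \<sigma>_closed: "\<sigma> h v \<in> W" if "h \<in> H" "v \<in> W" for h v
    using \<sigma>_auto[OF that(1)] that(2) unfolding linear_automorphism_def bij_betw_def by blast
  have \<sigma>_one: "\<sigma> \<one>\<^bsub>G\<^esub> v = v" if v: "v \<in> W" for v
  proof -
    have "\<forall>g\<in>H. \<forall>h\<in>H. \<forall>v\<in>W. \<sigma> (g \<otimes>\<^bsub>G\<^esub> h) v = \<sigma> g (\<sigma> h v)"
      using smooth unfolding smooth_rep_def by simp
    from this[rule_format, OF one_H one_H v]
    have "\<sigma> \<one>\<^bsub>G\<^esub> (\<sigma> \<one>\<^bsub>G\<^esub> v) = \<sigma> \<one>\<^bsub>G\<^esub> v" by simp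
    moreover have "inj_on (\<sigma> \<one>\<^bsub>G\<^esub>) W"
      using \<sigma>_auto[OF one_H] unfolding linear_automorphism_def bij_betw_def by blast
    ultimately show ?thesis using inj_onD[OF _ _ \<sigma>_closed[OF one_H v] v] by blast
  qed
  have \<omega>_mult: "\<omega> (g \<otimes>\<^bsub>G\<^esub> h) = \<omega> g * \<omega> h" if "g \<in> carrier G" "h \<in> carrier G" for g h
    using \<omega> that unfolding group_character_def by simp
  have \<omega>_one: "\<omega> \<one>\<^bsub>G\<^esub> = 1"
    using \<omega>_mult[of "\<one>\<^bsub>G\<^esub>" "\<one>\<^bsub>G\<^esub>"] \<omega> unfolding group_character_def by auto
  have D_linear: "linear_on s W D" and D_closed: "\<And>w. w \<in> W \<Longrightarrow> D w \<in> W"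
    using S_auto[OF \<delta>\<^sub>1] unfolding D_def linear_automorphism_def bij_betw_def by auto
  have S_p: "S (p h) v = s (\<omega> h) (D (\<sigma> h v))" if h: "h \<in> H" and v: "v \<in> W" for h v
    using S_bi[OF one_H h \<delta>\<^sub>1 v] XT.act_one[OF \<delta>X] \<sigma>_one[OF D_closed[OF \<sigma>_closed[OF h v]]]
    unfolding p_def D_def by simp
  have D_twist: "\<sigma> h (D w) = s (\<omega> (\<theta> h)) (D (\<sigma> (\<theta> h) w))" if h: "h \<in> H" and w: "w \<in> W" for h w
  proof -
    have hG: "h \<in> carrier G" using Hc[OF h] .
    have "\<iota> (act h \<delta>\<^sub>1) \<one>\<^bsub>G\<^esub> = \<one>\<^bsub>G\<^esub>"
      using XT.Int_automorphism[OF actX[OF hG \<delta>X]] is_group by (simp add: iso_def hom_one)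
    then have "right_act act \<iota> (act h \<delta>\<^sub>1) \<one>\<^bsub>G\<^esub> = act h \<delta>\<^sub>1"
      unfolding right_act_def using XT.act_one[OF actX[OF hG \<delta>X]] by simp
    moreover have "act h \<delta>\<^sub>1 = p (\<theta> h)" unfolding p_def right_act_def \<theta>_right[OF hG] ..
    ultimately have "S (p (\<theta> h)) w = \<sigma> h (D w)"
      using S_bi[OF h one_H \<delta>\<^sub>1 w] \<sigma>_one[OF w] \<omega>_one unfolding D_def by simp
    then show ?thesis using S_p[OF \<theta>_H[OF h] w] by simp
  qed

  define \<psi> where "\<psi> = (\<lambda>z. \<phi> (p z))"
  have \<psi>: "test_function T \<psi>" unfolding \<psi>_def by (rule test_function_homeomorphic[OF p_hom \<phi>])
  define C where "C = T closure_of {z\<in>topspace T. \<psi> z \<noteq> 0}"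
  have C: "compactin T C" using \<psi> unfolding test_function_def C_def by (rule conjunct2)
  have support: "z \<in> C" if "z \<in> carrier G" "\<psi> z \<noteq> 0" for z
    using closure_of_subset[of "{z\<in>topspace T. \<psi> z \<noteq> 0}" T] that topspace_eq unfolding C_def by blast

  \<comment> \<open>The conditions on \<open>L\<close> come from the invariance of \<open>\<psi>\<close> on both sides, twisted by \<open>\<theta>\<close> on
    the left, from \<open>\<omega>\<close>, and from the stability of the fundamental domain.\<close>
  note domain = fundamental_domain[OF H(1) K x \<Omega>']
  obtain M1 where M1: "open_compact_subgroup G T M1"
      "\<forall>m\<in>M1. \<forall>z\<in>carrier G. \<psi> (z \<otimes>\<^bsub>G\<^esub> m) = \<psi> z \<and> \<psi> (m \<otimes>\<^bsub>G\<^esub> z) = \<psi> z"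
    using test_function_invariance[OF \<psi>] by blast
  obtain M2 where M2: "open_compact_subgroup G T M2" "\<forall>m\<in>M2. \<omega> m = 1"
    using character_trivial_near_one[OF \<omega>] by blast
  obtain M3 where M3: "open_compact_subgroup G T M3" "M3 \<subseteq> {z\<in>topspace T. \<theta> z \<in> M1}"
  proof -
    have "\<theta> \<one>\<^bsub>G\<^esub> = \<one>\<^bsub>G\<^esub>"
      using \<theta>_mult[OF one_closed one_closed] \<theta>_closed[OF one_closed] by (metis l_cancel_one one_closed r_one)
    then have "\<one>\<^bsub>G\<^esub> \<in> {z\<in>topspace T. \<theta> z \<in> M1}" using ocsD(5)[OF M1(1)] topspace_eq by simp
    then show ?thesis
      using basis_at_one[OF openin_continuous_map_preimage[OF \<theta>_cont ocsD(2)[OF M1(1)]]] that by blast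
  qed
  obtain M4 where M4: "open_compact_subgroup G T M4" "\<forall>y\<in>\<Omega>'. \<forall>l\<in>M4. y \<otimes>\<^bsub>G\<^esub> l \<in> \<Omega>'"
    using domain(4) by blast
  define L where "L = M1 \<inter> M2 \<inter> (M3 \<inter> M4)"
  have L: "open_compact_subgroup G T L"
    unfolding L_def by (intro ocs_Int M1(1) M2(1) M3(1) M4(1))
  have LG: "l \<in> carrier G" if "l \<in> L" for l using ocsD(4)[OF L] that by blast
  have \<psi>_right: "\<psi> (z \<otimes>\<^bsub>G\<^esub> l) = \<psi> z" if "z \<in> carrier G" "l \<in> L" for z l
    using M1(2) that unfolding L_def by blast
  have \<psi>_left: "\<psi> (\<theta> l \<otimes>\<^bsub>G\<^esub> z) = \<psi> z" if "z \<in> carrier G" "l \<in> L" for z l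
    using M1(2) M3(2) that unfolding L_def by blast
  have \<omega>_L: "\<omega> l = 1" if "l \<in> L" for l using M2(2) that unfolding L_def by blast
  obtain J where J: "finite J" "J \<subseteq> \<Omega>'" "disjoint_family_on (\<lambda>y. y <#\<^bsub>G\<^esub> L) J"
      "\<Omega>' \<subseteq> (\<Union>y\<in>J. y <#\<^bsub>G\<^esub> L)"
    using coset_transversal[OF L domain(1)] by blast
  have JG: "J \<subseteq> carrier G" using J(2) compactin_carrier[OF domain(1)] by blast
  have "y <#\<^bsub>G\<^esub> L \<subseteq> \<Omega>'" if "y \<in> J" for y
    using M4(2) J(2) that unfolding l_coset_def L_def by blast
  then have \<Omega>J: "\<Omega>' = (\<Union>y\<in>J. y <#\<^bsub>G\<^esub> L)" using J(4) by blast
  have N: "open_compact_subgroup ?H ?TH (H \<inter> K)" by (rule ocs_restrict[OF H K(1)])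

  interpret I: twisted_induction G T \<mu>\<^sub>G H \<mu>\<^sub>H \<theta> \<omega> \<psi> s W \<sigma> D C L "H \<inter> K" J
  proof (intro twisted_induction.intro twisted_induction_axioms.intro)
    show "haar_group G T \<mu>\<^sub>G" "haar_group ?H ?TH \<mu>\<^sub>H" by unfold_locales
    show "\<exists>h\<^sub>0\<in>H. {h\<in>H. inv\<^bsub>G\<^esub> h \<otimes>\<^bsub>G\<^esub> z \<in> (\<Union>y\<in>J. y <#\<^bsub>G\<^esub> L)} = h\<^sub>0 <#\<^bsub>G\<^esub> (H \<inter> K)"
      if "z \<in> carrier G" for z
      using domain(3)[OF that] unfolding \<Omega>J .
  qed (fact H compact_mod \<theta>_closed \<theta>_mult \<theta>_H \<omega> admissible D_linear D_closed D_twist C support L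
      \<psi>_right \<psi>_left \<omega>_L J(1) JG J(3) N)+

  have natural: "ind_natural G Y act \<iota> \<omega> s S f (p z) = s (\<omega> z) (D (f z))"
    if f: "f \<in> ind_space G T H W \<sigma>" and z: "z \<in> carrier G" for f z
    unfolding ind_natural_def
  proof (rule the_equality)
    show "\<exists>\<delta>\<in>Y. \<exists>g\<in>carrier G. p z = right_act act \<iota> \<delta> g \<and> s (\<omega> z) (D (f z)) = s (\<omega> g) (S \<delta> (f g))"
      using \<delta>\<^sub>1 z unfolding p_def D_def by blast
    fix w assume "\<exists>\<delta>\<in>Y. \<exists>g\<in>carrier G. p z = right_act act \<iota> \<delta> g \<and> w = s (\<omega> g) (S \<delta> (f g))"
    then obtain \<delta> g where \<delta>: "\<delta> \<in> Y" and g: "g \<in> carrier G"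
        and pz: "p z = right_act act \<iota> \<delta> g" and w: "w = s (\<omega> g) (S \<delta> (f g))" by blast
    obtain h where h: "h \<in> H" "\<delta> = p h" using \<delta> p_H by blast
    have "p z = p (h \<otimes>\<^bsub>G\<^esub> g)" using pz p_right[OF Hc[OF h(1)] g] h(2) by simp
    then have zg: "z = h \<otimes>\<^bsub>G\<^esub> g" using inj_onD[OF p_inj] z g Hc[OF h(1)] by simp
    have "f z = \<sigma> h (f g)" unfolding zg by (rule I.V_covariant[OF f h(1) g])
    then show "w = s (\<omega> z) (D (f z))"
      unfolding w h(2) S_p[OF h(1) I.V_closed[OF f g]] unfolding zg
      using \<omega>_mult[OF Hc[OF h(1)] g] by (simp add: mult.commute)
  qed

  let ?s = "scale_fun s :: complex \<Rightarrow> ('a \<Rightarrow> 'w) \<Rightarrow> 'a \<Rightarrow> 'w"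
  have vsf: "vector_space ?s"
    by unfold_locales (auto simp: scale_fun_def fun_eq_iff s.scale_right_distrib s.scale_left_distrib)
  interpret F: vector_space ?s by (rule vsf)
  have induced: "simple_integral ?s (twisted_measure X act \<iota> \<mu>\<^sub>G \<delta>\<^sub>1)
      (\<lambda>\<gamma>. ?s (\<phi> \<gamma>) (ind_map G Y act \<iota> \<omega> s S \<gamma> f)) = I.A f" (is "?lhs = _")
    if f: "f \<in> ind_space G T H W \<sigma>" for f
  proof (rule ext)
    fix g
    define E where "E = (\<lambda>z g. if g \<in> carrier G
      then s (\<omega> (\<theta> g \<otimes>\<^bsub>G\<^esub> z)) (D (f (\<theta> g \<otimes>\<^bsub>G\<^esub> z))) else 0)"
    have "?lhs = simple_integral ?s \<mu>\<^sub>G (\<lambda>z. ?s (\<phi> (p z)) (ind_map G Y act \<iota> \<omega> s S (p z) f))"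
      unfolding p_def by (rule XT.simple_integral_twisted_measure[OF \<delta>X space_haar sets_haar])
    also have "\<dots> = simple_integral ?s \<mu>\<^sub>G (\<lambda>z. ?s (\<psi> z) (E z))"
    proof (rule simple_integral_cong)
      fix z assume "z \<in> space \<mu>\<^sub>G"
      then have z: "z \<in> carrier G" using space_haar by simp
      have "ind_map G Y act \<iota> \<omega> s S (p z) f = E z"
        unfolding ind_map_def E_def
        using act_p[OF _ z] natural[OF f m_closed[OF \<theta>_closed z]] by (intro ext) simp
      then show "?s (\<phi> (p z)) (ind_map G Y act \<iota> \<omega> s S (p z) f) = ?s (\<psi> z) (E z)"
        unfolding \<psi>_def by simp
    qed
    finally have lhs: "?lhs = simple_integral ?s \<mu>\<^sub>G (\<lambda>z. ?s (\<psi> z) (E z))" .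
    \<comment> \<open>Evaluation at \<open>g\<close> commutes with the integral because the integrand is a step function
      with values in the space of functions.\<close>
    obtain M where M: "open_compact_subgroup G T M" "\<forall>z\<in>carrier G. \<forall>m\<in>M. f (z \<otimes>\<^bsub>G\<^esub> m) = f z"
      using f unfolding ind_space_def by blast
    have step: "step_function (\<lambda>z. ?s (\<psi> z) (E z))"
    proof (rule step_functionI[OF ocs_Int[OF M(1) L] C])
      fix z m assume z: "z \<in> carrier G" and m: "m \<in> M \<inter> L"
      have mG: "m \<in> carrier G" using LG m by blast
      have "E (z \<otimes>\<^bsub>G\<^esub> m) g = E z g" for g
      proof (cases "g \<in> carrier G")
        case g: True
        have t: "\<theta> g \<otimes>\<^bsub>G\<^esub> z \<in> carrier G" using \<theta>_closed[OF g] z by simp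
        have "\<theta> g \<otimes>\<^bsub>G\<^esub> (z \<otimes>\<^bsub>G\<^esub> m) = (\<theta> g \<otimes>\<^bsub>G\<^esub> z) \<otimes>\<^bsub>G\<^esub> m"
          using \<theta>_closed[OF g] z mG by (simp add: m_assoc)
        moreover have "\<omega> ((\<theta> g \<otimes>\<^bsub>G\<^esub> z) \<otimes>\<^bsub>G\<^esub> m) = \<omega> (\<theta> g \<otimes>\<^bsub>G\<^esub> z)"
          using \<omega>_mult[OF t mG] \<omega>_L m by simp
        moreover have "f ((\<theta> g \<otimes>\<^bsub>G\<^esub> z) \<otimes>\<^bsub>G\<^esub> m) = f (\<theta> g \<otimes>\<^bsub>G\<^esub> z)" using M(2) t m by blast
        ultimately show ?thesis unfolding E_def by simp
      qed (simp add: E_def)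
      then have "E (z \<otimes>\<^bsub>G\<^esub> m) = E z" by blast
      then show "?s (\<psi> (z \<otimes>\<^bsub>G\<^esub> m)) (E (z \<otimes>\<^bsub>G\<^esub> m)) = ?s (\<psi> z) (E z)"
        using \<psi>_right[OF z] m by simp
    next
      fix z assume z: "z \<in> carrier G" "?s (\<psi> z) (E z) \<noteq> 0"
      have "\<psi> z \<noteq> 0" using z(2) by (auto simp: scale_fun_def fun_eq_iff)
      then show "z \<in> C" using support z(1) by blast
    qed
    have "?lhs g = simple_integral s \<mu>\<^sub>G (\<lambda>z. ?s (\<psi> z) (E z) g)"
      unfolding lhs
      by (rule simple_integral_linear(1)[OF vsf vs F.subspace_UNIV step,
            where \<Phi> = "\<lambda>v. v g", symmetric])
        (simp_all add: scale_fun_def)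
    also have "\<dots> = I.A f g"
    proof (cases "g \<in> carrier G")
      case g: True
      let ?G = "\<lambda>z. s (\<psi> (inv\<^bsub>G\<^esub> (\<theta> g) \<otimes>\<^bsub>G\<^esub> z) * \<omega> z) (D (f z))"
      have "simple_integral s \<mu>\<^sub>G (\<lambda>z. ?s (\<psi> z) (E z) g) = simple_integral s \<mu>\<^sub>G (\<lambda>z. ?G (\<theta> g \<otimes>\<^bsub>G\<^esub> z))"
      proof (rule simple_integral_cong)
        fix z assume "z \<in> space \<mu>\<^sub>G"
        then have z: "z \<in> carrier G" using space_haar by simp
        have "inv\<^bsub>G\<^esub> (\<theta> g) \<otimes>\<^bsub>G\<^esub> (\<theta> g \<otimes>\<^bsub>G\<^esub> z) = z" using \<theta>_closed[OF g] z by (simp add: m_assoc[symmetric])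
        then show "?s (\<psi> z) (E z) g = ?G (\<theta> g \<otimes>\<^bsub>G\<^esub> z)" using g by (simp add: E_def scale_fun_def)
      qed
      also have "\<dots> = simple_integral s \<mu>\<^sub>G ?G" by (rule simple_integral_translate[OF \<theta>_closed[OF g]])
      finally show ?thesis using g unfolding I.A_def by simp
    next
      case False
      have "simple_integral s \<mu>\<^sub>G (\<lambda>z. 0) = 0" unfolding simple_integral_def by (rule sum.neutral) auto
      then show ?thesis using False unfolding I.A_def by (simp add: E_def scale_fun_def)
    qed
    finally show "?lhs g = I.A f g" .
  qed

  let ?d = "descent G act \<iota> \<omega> \<mu>\<^sub>G (right_haar_measure ?H ?TH \<mu>\<^sub>H) H \<Omega>' \<phi>"
  have d: "?d (p h) = I.\<kappa> * (\<Sum>y\<in>J. \<omega> y * \<psi> (inv\<^bsub>G\<^esub> (\<theta> y) \<otimes>\<^bsub>G\<^esub> h \<otimes>\<^bsub>G\<^esub> y))" if h: "h \<in> H" for h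
  proof -
    have "(LINT g:\<Omega>'|\<mu>\<^sub>G. \<omega> g * \<phi> (right_act act \<iota> (act (inv\<^bsub>G\<^esub> g) (p h)) g)) =
        (LINT g:\<Omega>'|\<mu>\<^sub>G. \<omega> g * \<psi> (inv\<^bsub>G\<^esub> (\<theta> g) \<otimes>\<^bsub>G\<^esub> h \<otimes>\<^bsub>G\<^esub> g))"
      unfolding set_lebesgue_integral_def
    proof (rule Bochner_Integration.integral_cong[OF refl])
      fix g assume "g \<in> space \<mu>\<^sub>G"
      then have g: "g \<in> carrier G" using space_haar by simp
      have "act (inv\<^bsub>G\<^esub> g) (p h) = p (inv\<^bsub>G\<^esub> (\<theta> g) \<otimes>\<^bsub>G\<^esub> h)"
        using act_p[OF inv_closed[OF g] Hc[OF h]] I.\<theta>_inv[OF g] by simp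
      then show "indicat_real \<Omega>' g *\<^sub>R (\<omega> g * \<phi> (right_act act \<iota> (act (inv\<^bsub>G\<^esub> g) (p h)) g)) =
          indicat_real \<Omega>' g *\<^sub>R (\<omega> g * \<psi> (inv\<^bsub>G\<^esub> (\<theta> g) \<otimes>\<^bsub>G\<^esub> h \<otimes>\<^bsub>G\<^esub> g))"
        unfolding \<psi>_def using p_right[of "inv\<^bsub>G\<^esub> (\<theta> g) \<otimes>\<^bsub>G\<^esub> h" g] \<theta>_closed[OF g] g Hc[OF h] by simp
    qed
    also have "\<dots> = complex_of_real (measure \<mu>\<^sub>G L) * (\<Sum>y\<in>J. \<omega> y * \<psi> (inv\<^bsub>G\<^esub> (\<theta> y) \<otimes>\<^bsub>G\<^esub> h \<otimes>\<^bsub>G\<^esub> y))"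
      unfolding \<Omega>J by (rule I.descent_integral[OF h])
    finally show ?thesis
      unfolding descent_def domain(2) Hh.measure_right_haar_ocs[OF N] I.\<kappa>_def
      by (simp add: divide_inverse mult_ac)
  qed
  have base: "simple_integral s (twisted_measure ?XY act \<iota> \<mu>\<^sub>H \<delta>\<^sub>1) (\<lambda>\<gamma>. s (?d \<gamma>) (S \<gamma> w)) =
      (\<Sum>y\<in>J. s I.\<kappa> (I.kernel y y w))" if w: "w \<in> W" for w
  proof -
    have "simple_integral s (twisted_measure ?XY act \<iota> \<mu>\<^sub>H \<delta>\<^sub>1) (\<lambda>\<gamma>. s (?d \<gamma>) (S \<gamma> w)) =
        simple_integral s \<mu>\<^sub>H (\<lambda>h. s (?d (p h)) (S (p h) w))"
      unfolding p_def by (rule HY.simple_integral_twisted_measure[OF \<delta>Y Hh.space_haar Hh.sets_haar])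
    also have "\<dots> = simple_integral s \<mu>\<^sub>H (\<lambda>h. s (I.\<kappa> * (\<Sum>y\<in>J. \<omega> y * \<psi> (inv\<^bsub>G\<^esub> (\<theta> y) \<otimes>\<^bsub>G\<^esub> h \<otimes>\<^bsub>G\<^esub> y)))
        (s (\<omega> h) (D (\<sigma> h w))))"
      by (rule simple_integral_cong) (simp add: Hh.space_haar d S_p w)
    also have "\<dots> = (\<Sum>y\<in>J. s I.\<kappa> (I.kernel y y w))" by (rule I.kernel_diagonal_sum[OF w])
    finally show ?thesis .
  qed
  show ?thesis
    unfolding twisted_character_def by (rule I.trace_induced[OF induced base])
qed

end
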